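(* Let $\{W_n\}$ be an i.i.d. sequence on $\mathbb R^d$ with zero mean and $E[\exp(\varepsilon_0\|W_n\|^2)]<\infty$ for some $\varepsilon_0>0$, and consider the stochastic gradient recursion $$\theta_{n+1}=\theta_n+\alpha[\bar f(\theta_n)+\Xi_{n+1}],\qquad \bar f(\theta)=-G(\theta)\nabla\Gamma(\theta),$$ where $\Gamma:\mathbb R^d\to\mathbb R$ and $G:\mathbb R^d\to\mathbb R^{d\times d}$ are continuously differentiable, in one of two cases: Case 1 (i.i.d. exploration): $\Xi_{n+1}=W_{n+1}$, with $\Phi_n=W_n$. Case 2 (zig-zag exploration): $\Xi_{n+1}=[W_{n+1}-W_n]/\sqrt2$, with $\Phi_n=(W_{n-1};W_n)$. Suppose that the assumptions (B) stated in the context hold. Then there is $\alpha_0>0$ such that for each $\alpha\in(0,\alpha_0]$ and each initial condition, with $\beta^{\bar f}_N=\frac1N\sum_{n=0}^{N-1}\bar f(\theta_n)$: (i) In case 1, $E[\|\beta_N^{\bar f}\|^2]=O(1/N)$ as $N\to\infty$. (ii) In case 2, $E[\|\beta_N^{\bar f}\|^2]=O(1/N^2)$ as $N\to\infty$. If in addition assumptions (A1)–(A5) stated in the context hold for $f(\theta,\Phi_{n+1})=\bar f(\theta)+\Xi_{n+1}$, then in case 2 the matrix $Z_\theta^*$ (the unique positive semidefinite solution of $0=\bar A^*Z^*_\theta+Z^*_\theta(\bar A^* )^T+\Sigma^{\Xi}_{CLT}$) is zero, and $E_\varpi[\|\theta_0-\theta^*\|^2]=O(\alpha^2)$ as $\alpha\downarrow0$,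 where $\varpi$ is the invariant probability measure of $\Psi=\{(\theta_n,\Phi_n)\}$.
   Context: $\Phi$ is a Markov chain on a locally compact separable metric space $\mathsf X$ with kernel $P$ and unique invariant probability measure $\pi$; a set $C$ is small if $P^m(x,\cdot)\ge\nu(\cdot)$ for all $x\in C$, some $m\ge1$ and nonzero measure $\nu$. $\Sigma_{CLT}^\Xi=\sum_{k=-\infty}^\infty E_\pi[\Xi_0\Xi_k^T]$ (equal to $\mathrm{Cov}(W_n)$ in case 1 and to $0$ in case 2). $E_\varpi$ denotes expectation with $(\theta_n,\Phi_n)\sim\varpi$. Assumption (A2ii): $\Phi$ is aperiodic and, for functions $V:\mathsf X\to\mathbb R_+$, $W:\mathsf X\to[1,\infty)$, a small set $C$, $b_0>0$ and all $x$, $E[\exp(V(\Phi_{k+1}))\mid\Phi_k=x]\le\exp(V(x)-W(x)+b_0\mathbb 1_C(x))$; in addition $S_W(r)=\{x:W(x)\le r\}$ is either small or empty and $\sup_{S_W(r)}V<\infty$ for each $r\ge1$. Assumptions (B): $\bar f$ is globally Lipschitz continuous; $\bar f_\infty(\theta)=\lim_{c\to\infty}c^{-1}\bar f(c\theta)$ exists and the ODE $\frac{d}{dt}\vartheta_t=\bar f_\infty(\vartheta_t)$ is asymptotically stable; $\Xi_n=F(\Phi_n)$ with $F$ measurable, $\pi(F_i)=0$ for each $i$, and $\Phi$ satisfying (A2ii); and for some everywhere positive $p_\Xi:\mathsf X\times\mathbb R^d\to(0,\infty)$, integer $n_0\ge1$, $b<\infty$, $\varepsilon>0$: $E[\exp(\varepsilon\|\Xi_1\|^2)\mid\Phi_0=x]\le\exp(W(x)+b)$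 and $P\{\Xi_{n_0}\in A\mid\Phi_0=x\}=\int_Ap_\Xi(x,r)dr$ for $x\in\mathsf X$, $A\in\mathcal B(\mathbb R^d)$. Assumptions (A1)–(A5) for a recursion $\theta_{n+1}=\theta_n+\alpha f(\theta_n,\Phi_{n+1})$ with $\bar f(\theta)=\int f(\theta,x)\pi(dx)$ and mean flow $\frac{d}{dt}\vartheta_t=\bar f(\vartheta_t)$: (A1) the step-size $\alpha>0$ is constant. (A2) There is $L:\mathsf X\to\mathbb R$ with $\|f(\theta,x)-f(\theta',x)\|\le L(x)\|\theta-\theta'\|$, $\|f(0,x)\|\le L(x)$, and (A2ii) holds. (A3) Either $\bar f_\infty(\theta)$ exists for each $\theta$ and the ODE $\frac{d}{dt}\vartheta_t=\bar f_\infty(\vartheta_t)$ is globally asymptotically stable, or there are a globally Lipschitz $C^1$ function $V_0:\mathbb R^d\to\mathbb R_+$ and $\varrho_v>0$ such that along mean flow solutions, whenever $\|\vartheta_t\|\ge1/\varrho_v$, $V_0(\vartheta_t)\ge\varrho_v\|\vartheta_t\|$ and $\frac{d^+}{dt}V_0(\vartheta_t)\le-\varrho_vV_0(\vartheta_t)$. (A4) $\lim_{r\to\infty}\sup_xL(x)/\max\{r,W(x)\}=0$. (A5) The mean flow is globally asymptotically stable with unique stationary point $\theta^*$; $\bar f$ is $C^1$, $\bar A=\partial_\theta\bar f$ is bounded and Lipschitz, and $\bar A^*=\bar A(\theta^* )$ is Hurwitz. *)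

theory Defs
  imports "HOL-Probability.Probability" "HOL-Library.Landau_Symbols"
begin

section \<open>Markov chains on a topological space\<close>

definition markov_kernel :: "('x::topological_space \<Rightarrow> 'x measure) \<Rightarrow> bool" where
  "markov_kernel P \<longleftrightarrow> P \<in> measurable borel (prob_algebra borel)"

primrec kernel_pow :: "('x::topological_space \<Rightarrow> 'x measure) \<Rightarrow> nat \<Rightarrow> 'x \<Rightarrow> 'x measure" where
  "kernel_pow P 0 x = return borel x"
| "kernel_pow P (Suc n) x = bind (kernel_pow P n x) P"

definition invariant_prob :: "('x::topological_space \<Rightarrow> 'x measure) \<Rightarrow> 'x measure \<Rightarrow> bool" where
  "invariant_prob P \<pi> \<longleftrightarrow> prob_space \<pi> \<and> sets \<pi> = sets borel \<and>
     (\<forall>A\<in>sets borel. emeasure \<pi> A = (\<integral>\<^sup>+x. emeasure (P x) A \<partial>\<pi>))"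

definition unique_invariant_prob :: "('x::topological_space \<Rightarrow> 'x measure) \<Rightarrow> 'x measure \<Rightarrow> bool" where
  "unique_invariant_prob P \<pi> \<longleftrightarrow>
     invariant_prob P \<pi> \<and> (\<forall>\<pi>'. invariant_prob P \<pi>' \<longrightarrow> \<pi>' = \<pi>)"

definition small_set :: "('x::topological_space \<Rightarrow> 'x measure) \<Rightarrow> 'x set \<Rightarrow> bool" where
  "small_set P C \<longleftrightarrow> C \<in> sets borel \<and>
     (\<exists>m\<ge>1. \<exists>\<nu>. sets \<nu> = sets borel \<and> emeasure \<nu> UNIV \<noteq> 0 \<and>
        (\<forall>x\<in>C. \<forall>A\<in>sets borel. emeasure \<nu> A \<le> emeasure (kernel_pow P m x) A))"

text \<open>Irreducibility, cycles and aperiodicity follow Meyn and Tweedie: an irreducible chain is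
  aperiodic if the largest \<open>d\<close> for which a \<open>d\<close>-cycle exists is 1, where the set left over by a
  cycle must be null for a maximal irreducibility measure.\<close>

definition irreducibility_measure ::
    "('x::topological_space \<Rightarrow> 'x measure) \<Rightarrow> 'x measure \<Rightarrow> bool" where
  "irreducibility_measure P \<psi> \<longleftrightarrow>
     sigma_finite_measure \<psi> \<and> sets \<psi> = sets borel \<and> emeasure \<psi> UNIV \<noteq> 0 \<and>
     (\<forall>A\<in>sets borel. emeasure \<psi> A > 0 \<longrightarrow> (\<forall>x. \<exists>n\<ge>1. emeasure (kernel_pow P n x) A > 0))"

definition maximal_irreducibility_measure ::
    "('x::topological_space \<Rightarrow> 'x measure) \<Rightarrow> 'x measure \<Rightarrow> bool" where
  "maximal_irreducibility_measure P \<psi> \<longleftrightarrow> irreducibility_measure P \<psi> \<and>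
     (\<forall>\<phi>. irreducibility_measure P \<phi> \<longrightarrow> absolutely_continuous \<psi> \<phi>)"

definition cycle_of_length ::
    "('x::topological_space \<Rightarrow> 'x measure) \<Rightarrow> 'x measure \<Rightarrow> nat \<Rightarrow> (nat \<Rightarrow> 'x set) \<Rightarrow> bool" where
  "cycle_of_length P \<psi> d D \<longleftrightarrow>
     (\<forall>i<d. D i \<in> sets borel) \<and> disjoint_family_on D {..<d} \<and>
     (\<forall>i<d. \<forall>x\<in>D i. emeasure (P x) (D (Suc i mod d)) = 1) \<and>
     emeasure \<psi> (UNIV - (\<Union>i<d. D i)) = 0"

definition aperiodic :: "('x::topological_space \<Rightarrow> 'x measure) \<Rightarrow> bool" where
  "aperiodic P \<longleftrightarrow> (\<exists>\<psi>. maximal_irreducibility_measure P \<psi> \<and>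
     (\<forall>d\<ge>2. \<not> (\<exists>D. cycle_of_length P \<psi> d D)))"

definition assumption_A2ii ::
    "('x::topological_space \<Rightarrow> 'x measure) \<Rightarrow> ('x \<Rightarrow> real) \<Rightarrow> ('x \<Rightarrow> real) \<Rightarrow> bool" where
  "assumption_A2ii P V W \<longleftrightarrow> markov_kernel P \<and> aperiodic P \<and>
     V \<in> borel_measurable borel \<and> W \<in> borel_measurable borel \<and>
     (\<forall>x. 0 \<le> V x) \<and> (\<forall>x. 1 \<le> W x) \<and>
     (\<exists>C b\<^sub>0. small_set P C \<and> b\<^sub>0 > 0 \<and>
        (\<forall>x. (\<integral>\<^sup>+y. ennreal (exp (V y)) \<partial>P x)
               \<le> ennreal (exp (V x - W x + b\<^sub>0 * indicator C x)))) \<and>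
     (\<forall>r\<ge>1. (small_set P {x. W x \<le> r} \<or> {x. W x \<le> r} = {}) \<and> bdd_above (V ` {x. W x \<le> r}))"


section \<open>Calculus and ODE stability\<close>

definition continuously_differentiable ::
    "('a::real_normed_vector \<Rightarrow> 'b::real_normed_vector) \<Rightarrow> bool" where
  "continuously_differentiable g \<longleftrightarrow>
     (\<exists>g'. (\<forall>x. (g has_derivative blinfun_apply (g' x)) (at x)) \<and> continuous_on UNIV g')"

definition grad :: "('a::real_inner \<Rightarrow> real) \<Rightarrow> 'a \<Rightarrow> 'a" where
  "grad \<Gamma> x = (THE D. GDERIV \<Gamma> x :> D)"

definition ode_solution :: "('a::real_normed_vector \<Rightarrow> 'a) \<Rightarrow> (real \<Rightarrow> 'a) \<Rightarrow> bool" where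
  "ode_solution h \<theta> \<longleftrightarrow> (\<forall>t\<ge>0. (\<theta> has_vector_derivative h (\<theta> t)) (at t within {0..}))"

definition lyapunov_stable :: "('a::real_normed_vector \<Rightarrow> 'a) \<Rightarrow> 'a \<Rightarrow> bool" where
  "lyapunov_stable h \<theta>\<^sub>e \<longleftrightarrow> h \<theta>\<^sub>e = 0 \<and>
     (\<forall>e>0. \<exists>\<delta>>0. \<forall>\<theta>. ode_solution h \<theta> \<and> norm (\<theta> 0 - \<theta>\<^sub>e) < \<delta> \<longrightarrow> (\<forall>t\<ge>0. norm (\<theta> t - \<theta>\<^sub>e) < e))"

definition asymptotically_stable :: "('a::real_normed_vector \<Rightarrow> 'a) \<Rightarrow> 'a \<Rightarrow> bool" where
  "asymptotically_stable h \<theta>\<^sub>e \<longleftrightarrow> lyapunov_stable h \<theta>\<^sub>e \<and>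
     (\<exists>\<delta>>0. \<forall>\<theta>. ode_solution h \<theta> \<and> norm (\<theta> 0 - \<theta>\<^sub>e) < \<delta> \<longrightarrow> (\<theta> \<longlongrightarrow> \<theta>\<^sub>e) at_top)"

definition globally_asymptotically_stable :: "('a::real_normed_vector \<Rightarrow> 'a) \<Rightarrow> 'a \<Rightarrow> bool" where
  "globally_asymptotically_stable h \<theta>\<^sub>e \<longleftrightarrow> lyapunov_stable h \<theta>\<^sub>e \<and>
     (\<forall>\<theta>. ode_solution h \<theta> \<longrightarrow> (\<theta> \<longlongrightarrow> \<theta>\<^sub>e) at_top)"

definition field_at_infinity ::
    "('a::real_normed_vector \<Rightarrow> 'a) \<Rightarrow> ('a \<Rightarrow> 'a) \<Rightarrow> bool" where
  "field_at_infinity fbar h \<longleftrightarrow> (\<forall>\<theta>. ((\<lambda>c::real. (1 / c) *\<^sub>R fbar (c *\<^sub>R \<theta>)) \<longlongrightarrow> h \<theta>) at_top)"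


section \<open>Matrices\<close>

definition outer :: "real^'d \<Rightarrow> real^'d \<Rightarrow> real^'d^'d" where
  "outer u v = (\<chi> i j. u $ i * v $ j)"

definition pos_semidef :: "real^'d^'d \<Rightarrow> bool" where
  "pos_semidef Z \<longleftrightarrow> transpose Z = Z \<and> (\<forall>v. 0 \<le> v \<bullet> (Z *v v))"

definition hurwitz :: "real^'d^'d \<Rightarrow> bool" where
  "hurwitz A \<longleftrightarrow>
     (\<forall>(l::complex) (v::complex^'d). v \<noteq> 0 \<and> (\<chi> i j. complex_of_real (A $ i $ j)) *v v = l *s v
        \<longrightarrow> Re l < 0)"

text \<open>The autocovariance is \<open>E[Xi_0 Xi_k^T]\<close> for \<open>Xi_n = F (Phi_n)\<close> and the stationary chain; by
  the Markov property the pair \<open>(Phi_0, Phi_n)\<close> has law \<open>\<pi>(dx) P^n(x, dy)\<close>, and for negative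
  lags the pair is shifted to start at time 0.\<close>

definition autocov ::
    "('x::topological_space \<Rightarrow> 'x measure) \<Rightarrow> 'x measure \<Rightarrow> ('x \<Rightarrow> real^'d) \<Rightarrow> int \<Rightarrow> real^'d^'d" where
  "autocov P \<pi> F k =
     (if 0 \<le> k then (\<integral>x. (\<integral>y. outer (F x) (F y) \<partial>kernel_pow P (nat k) x) \<partial>\<pi>)
      else (\<integral>x. (\<integral>y. outer (F y) (F x) \<partial>kernel_pow P (nat (- k)) x) \<partial>\<pi>))"

definition Sigma_CLT ::
    "('x::topological_space \<Rightarrow> 'x measure) \<Rightarrow> 'x measure \<Rightarrow> ('x \<Rightarrow> real^'d) \<Rightarrow> real^'d^'d" where
  "Sigma_CLT P \<pi> F = (\<Sum>\<^sub>\<infinity>k. autocov P \<pi> F k)"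

definition lyapunov_solution :: "real^'d^'d \<Rightarrow> real^'d^'d \<Rightarrow> real^'d^'d \<Rightarrow> bool" where
  "lyapunov_solution A \<Sigma> Z \<longleftrightarrow> pos_semidef Z \<and> 0 = A ** Z + Z ** transpose A + \<Sigma>"


section \<open>Assumptions on the recursion\<close>

definition mean_field ::
    "'x measure \<Rightarrow> (real^'d \<Rightarrow> 'x \<Rightarrow> real^'d) \<Rightarrow> real^'d \<Rightarrow> real^'d" where
  "mean_field \<pi> f \<theta> = (\<integral>x. f \<theta> x \<partial>\<pi>)"

definition assumption_A3 :: "(real^'d \<Rightarrow> real^'d) \<Rightarrow> bool" where
  "assumption_A3 fbar \<longleftrightarrow>
     (\<exists>h. field_at_infinity fbar h \<and> globally_asymptotically_stable h 0) \<or>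
     (\<exists>V\<^sub>0 \<rho>. continuously_differentiable V\<^sub>0 \<and> (\<exists>K. K-lipschitz_on UNIV V\<^sub>0) \<and>
        (\<forall>\<theta>. 0 \<le> V\<^sub>0 \<theta>) \<and> \<rho> > 0 \<and>
        (\<forall>\<theta>. ode_solution fbar \<theta> \<longrightarrow>
          (\<forall>t\<ge>0. norm (\<theta> t) \<ge> 1 / \<rho> \<longrightarrow>
             V\<^sub>0 (\<theta> t) \<ge> \<rho> * norm (\<theta> t) \<and>
             (\<exists>D. ((\<lambda>s. V\<^sub>0 (\<theta> s)) has_real_derivative D) (at_right t) \<and>
                  D \<le> - \<rho> * V\<^sub>0 (\<theta> t)))))"

definition assumption_A5 :: "(real^'d \<Rightarrow> real^'d) \<Rightarrow> real^'d \<Rightarrow> bool" where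
  "assumption_A5 fbar \<theta>s \<longleftrightarrow>
     globally_asymptotically_stable fbar \<theta>s \<and> (\<forall>\<theta>. fbar \<theta> = 0 \<longleftrightarrow> \<theta> = \<theta>s) \<and>
     continuously_differentiable fbar \<and>
     bounded (range (\<lambda>\<theta>. jacobian fbar (at \<theta>))) \<and>
     (\<exists>K. K-lipschitz_on UNIV (\<lambda>\<theta>. jacobian fbar (at \<theta>))) \<and>
     hurwitz (jacobian fbar (at \<theta>s))"

text \<open>Assumptions (A2)--(A5); (A1), a constant positive step-size, is part of the recursion itself.
  The supremum in (A4) is taken in the extended reals, as it may be infinite.\<close>

definition assumptions_A ::
    "('x::topological_space \<Rightarrow> 'x measure) \<Rightarrow> 'x measure \<Rightarrow> ('x \<Rightarrow> real) \<Rightarrow> ('x \<Rightarrow> real) \<Rightarrow>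
     (real^'d \<Rightarrow> 'x \<Rightarrow> real^'d) \<Rightarrow> real^'d \<Rightarrow> bool" where
  "assumptions_A P \<pi> V W f \<theta>s \<longleftrightarrow>
     assumption_A2ii P V W \<and>
     (\<exists>L :: 'x \<Rightarrow> real.
        (\<forall>\<theta> \<theta>' x. norm (f \<theta> x - f \<theta>' x) \<le> L x * norm (\<theta> - \<theta>')) \<and>
        (\<forall>x. norm (f 0 x) \<le> L x) \<and>
        ((\<lambda>r::real. SUP x. ereal (L x / max r (W x))) \<longlongrightarrow> 0) at_top) \<and>
     assumption_A3 (mean_field \<pi> f) \<and>
     assumption_A5 (mean_field \<pi> f) \<theta>s"

text \<open>Assumptions (B), for \<open>Xi_n = F (Phi_n)\<close>; conditional expectations given \<open>Phi_0 = x\<close> are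
  integrals against \<open>P^n(x, \<cdot>)\<close>.\<close>

definition assumptions_B ::
    "('x::topological_space \<Rightarrow> 'x measure) \<Rightarrow> 'x measure \<Rightarrow> ('x \<Rightarrow> real) \<Rightarrow> ('x \<Rightarrow> real) \<Rightarrow>
     ('x \<Rightarrow> real^'d) \<Rightarrow> (real^'d \<Rightarrow> real^'d) \<Rightarrow> bool" where
  "assumptions_B P \<pi> V W F fbar \<longleftrightarrow>
     unique_invariant_prob P \<pi> \<and>
     (\<exists>K. K-lipschitz_on UNIV fbar) \<and>
     (\<exists>h. field_at_infinity fbar h \<and> asymptotically_stable h 0) \<and>
     F \<in> borel_measurable borel \<and>
     (\<forall>i. integrable \<pi> (\<lambda>x. F x $ i) \<and> (\<integral>x. F x $ i \<partial>\<pi>) = 0) \<and>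
     assumption_A2ii P V W \<and>
     (\<exists>(p :: 'x \<Rightarrow> real^'d \<Rightarrow> real) (n\<^sub>0::nat) (b::real) (\<epsilon>::real).
        (\<forall>x r. 0 < p x r) \<and> (\<forall>x. p x \<in> borel_measurable borel) \<and> n\<^sub>0 \<ge> 1 \<and> \<epsilon> > 0 \<and>
        (\<forall>x. (\<integral>\<^sup>+y. ennreal (exp (\<epsilon> * (norm (F y))\<^sup>2)) \<partial>P x) \<le> ennreal (exp (W x + b))) \<and>
        (\<forall>x. \<forall>A\<in>sets borel. emeasure (kernel_pow P n\<^sub>0 x) (F -` A)
               = (\<integral>\<^sup>+r\<in>A. ennreal (p x r) \<partial>lborel)))"


section \<open>The stochastic gradient recursion\<close>

definition sgd_field ::
    "(real^'d \<Rightarrow> real) \<Rightarrow> (real^'d \<Rightarrow> real^'d^'d) \<Rightarrow> real^'d \<Rightarrow> real^'d" where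
  "sgd_field \<Gamma> G \<theta> = - (G \<theta> *v grad \<Gamma> \<theta>)"

text \<open>The chain is generated by \<open>Phi_(n+1) = s Phi_n W_(n+1)\<close>: with \<open>iid_step\<close> this gives
  \<open>Phi_n = W_n\<close>, and with \<open>zigzag_step\<close> it gives \<open>Phi_n = (W_(n-1); W_n)\<close>, where \<open>Phi_0\<close>
  supplies the values of \<open>W_0\<close> and, in the second case, \<open>W_(-1)\<close>.\<close>

definition iid_step :: "'a \<Rightarrow> 'a \<Rightarrow> 'a" where
  "iid_step x w = w"

definition iid_F :: "'a \<Rightarrow> 'a" where
  "iid_F x = x"

definition zigzag_step :: "'a \<times> 'a \<Rightarrow> 'a \<Rightarrow> 'a \<times> 'a" where
  "zigzag_step x w = (snd x, w)"

definition zigzag_F :: "'a::real_vector \<times> 'a \<Rightarrow> 'a" where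
  "zigzag_F x = (1 / sqrt 2) *\<^sub>R (snd x - fst x)"

definition step_kernel :: "('x::topological_space \<Rightarrow> 'a \<Rightarrow> 'x) \<Rightarrow> 'a measure \<Rightarrow> 'x \<Rightarrow> 'x measure" where
  "step_kernel s \<mu> x = distr \<mu> borel (s x)"

primrec chain :: "('x \<Rightarrow> 'a \<Rightarrow> 'x) \<Rightarrow> 'x \<Rightarrow> (nat \<Rightarrow> 'a) \<Rightarrow> nat \<Rightarrow> 'x" where
  "chain s x w 0 = x"
| "chain s x w (Suc n) = s (chain s x w n) (w (Suc n))"

primrec theta ::
    "(real^'d \<Rightarrow> 'x \<Rightarrow> real^'d) \<Rightarrow> real \<Rightarrow> real^'d \<Rightarrow> (nat \<Rightarrow> 'x) \<Rightarrow> nat \<Rightarrow> real^'d" where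
  "theta f \<alpha> \<theta>\<^sub>0 \<phi> 0 = \<theta>\<^sub>0"
| "theta f \<alpha> \<theta>\<^sub>0 \<phi> (Suc n) = theta f \<alpha> \<theta>\<^sub>0 \<phi> n + \<alpha> *\<^sub>R f (theta f \<alpha> \<theta>\<^sub>0 \<phi> n) (\<phi> (Suc n))"

text \<open>Here \<open>z = (theta_0, Phi_0)\<close> is the initial condition and \<open>w\<close> a path of the noise.\<close>

definition beta ::
    "('x \<Rightarrow> real^'d \<Rightarrow> 'x) \<Rightarrow> ('x \<Rightarrow> real^'d) \<Rightarrow> (real^'d \<Rightarrow> real^'d) \<Rightarrow> real \<Rightarrow>
     (real^'d) \<times> 'x \<Rightarrow> (nat \<Rightarrow> real^'d) \<Rightarrow> nat \<Rightarrow> real^'d" where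
  "beta s F fbar \<alpha> z w N =
     (1 / real N) *\<^sub>R
       (\<Sum>n<N. fbar (theta (\<lambda>\<theta> x. fbar \<theta> + F x) \<alpha> (fst z) (chain s (snd z) w) n))"

text \<open>The transition kernel of \<open>Psi = (theta_n, Phi_n)\<close>: the recursion at time \<open>n\<close> uses the new
  state \<open>Phi_(n+1)\<close>.\<close>

definition joint_kernel ::
    "('x::topological_space \<Rightarrow> 'x measure) \<Rightarrow> (real^'d \<Rightarrow> 'x \<Rightarrow> real^'d) \<Rightarrow> real \<Rightarrow>
     (real^'d) \<times> 'x \<Rightarrow> ((real^'d) \<times> 'x) measure" where
  "joint_kernel P f \<alpha> z = distr (P (snd z)) borel (\<lambda>y. (fst z + \<alpha> *\<^sub>R f (fst z) y, y))"

definition iid_noise :: "'w measure \<Rightarrow> (nat \<Rightarrow> 'w \<Rightarrow> real^'d) \<Rightarrow> bool" where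
  "iid_noise M W \<longleftrightarrow> prob_space M \<and> prob_space.indep_vars M (\<lambda>_. borel) W UNIV \<and>
     (\<forall>n. distr M borel (W n) = distr M borel (W 0))"

text \<open>An initial condition \<open>(theta_0, Phi_0)\<close> is a square-integrable random variable independent of
  \<open>W_1, W_2, \<dots>\<close>. Every deterministic initial condition is of this form, and so is a
  deterministic \<open>theta_0\<close> together with a \<open>Phi_0\<close> built from further members of the i.i.d.
  sequence.\<close>

definition initial_condition ::
    "'w measure \<Rightarrow> (nat \<Rightarrow> 'w \<Rightarrow> real^'d) \<Rightarrow> ('w \<Rightarrow> (real^'d) \<times> 'x::real_normed_vector) \<Rightarrow> bool" where
  "initial_condition M W z \<longleftrightarrow>
     z \<in> borel_measurable M \<and> integrable M (\<lambda>\<omega>. (norm (z \<omega>))\<^sup>2) \<and>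
     prob_space.indep_set M
       (sets (vimage_algebra (space M) z borel))
       (sets (vimage_algebra (space M) (\<lambda>\<omega>. \<lambda>n\<in>{1..}. W n \<omega>) (PiM {1..} (\<lambda>_. borel))))"

end

theory Submission
  imports Defs "HOL-Computational_Algebra.Fundamental_Theorem_Algebra"
begin

text \<open>By the recursion, \<open>\<alpha>\<close> times the sum of the \<open>fbar (\<theta>_n)\<close> is \<open>\<theta>_N - \<theta>_0\<close> minus \<open>\<alpha>\<close> times the sum of the
  noise; that sum has second moment of order \<open>N\<close> in case 1 and telescopes in case 2, so everything
  rests on second moments of \<open>\<theta>_n\<close>. In case 2, \<open>Y_n = \<theta>_n - (\<alpha> / sqrt 2) W_n\<close> satisfies
  \<open>Y_(n+1) = Y_n + \<alpha> fbar (\<theta>_n)\<close>, an Euler scheme perturbed by \<open>O(\<alpha>)\<close> only.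

  If some time-\<open>T\<close> map of a flow halves the norm, then there is a Lipschitz function \<open>V\<close>, comparable
  to the norm, with \<open>V (x + s (f x + e)) \<le> (1 - c s) V x + K s |e|\<close> for all small \<open>s\<close>. This is applied
  to the field at infinity, which differs from \<open>fbar\<close> by \<open>\<epsilon> |x| + C\<close> and so bounds the moments for small
  \<open>\<alpha>\<close>, and under (A5) to \<open>fbar\<close> around \<open>\<theta>s\<close>: the flow contracts near \<open>\<theta>s\<close> by linearization, far
  away by the field at infinity, and in between by compactness. Integrating the latter drift against
  a stationary law gives second moment \<open>O(\<alpha>^2)\<close>.\<close>

section \<open>Flows of Lipschitz vector fields\<close>

text \<open>A norm-like V is preferred to a quadratic one because the error e then enters its drift
  additively; squaring happens only at the end, where convexity keeps the factor 1 - c s. So one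
  moment bound serves both cases: e is the noise itself in case 1, and in case 2 the difference
  between fbar at \<theta>_n and at Y_n. Since V need not be differentiable, its drift comes from
  comparing an Euler step with the flow, whose second-order gap is absorbed for small s.

  The threshold \<alpha>_0 has to be fixed before \<theta>s and the family \<nu> are given. It is
  therefore the step bound of the Lyapunov function of the field at infinity. Recentring that
  function at \<theta>s keeps its step bound and gives finite second moments for all steps up to
  \<alpha>_0, but with an additive constant; the function built from (A5) has no such constant,
  which yields the order \<alpha>^2, though possibly only for still smaller steps.\<close>

lemma exp_has_integral:
  fixes c C t :: real
  assumes "c \<noteq> 0" "0 \<le> t"
  shows "((\<lambda>s. C * exp (c * s)) has_integral C / c * (exp (c * t) - 1)) {0..t}"
proof -
  have "((\<lambda>s. C * exp (c * s)) has_integral C / c * exp (c * t) - C / c * exp (c * 0)) {0..t}"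
    using assms
    by (intro fundamental_theorem_of_calculus)
       (auto intro!: derivative_eq_intros simp: has_real_derivative_iff_has_vector_derivative[symmetric])
  then show ?thesis by (simp add: algebra_simps)
qed

lemma norm_integral_exp_le:
  fixes g :: "real \<Rightarrow> 'a::euclidean_space"
  assumes "0 < c" "0 \<le> t" "continuous_on {0..t} g"
    and "\<And>s. s \<in> {0..t} \<Longrightarrow> norm (g s) \<le> C * exp (c * s)"
  shows "norm (integral {0..t} g) \<le> C / c * (exp (c * t) - 1)"
proof -
  have "norm (integral {0..t} g) \<le> integral {0..t} (\<lambda>s. C * exp (c * s))"
    using assms
    by (intro integral_norm_bound_integral integrable_continuous_real continuous_intros) auto
  also have "\<dots> = C / c * (exp (c * t) - 1)"
    by (rule integral_unique[OF exp_has_integral]) (use assms in auto)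
  finally show ?thesis .
qed

text \<open>The integral operator contracts by the factor 1/2 in the weighted norm
  \<open>sup_t exp (- 2 K t) |u t|\<close>, so that no gluing of local solutions is needed.\<close>

lemma lipschitz_ode_solution_exists:
  fixes f :: "'a::euclidean_space \<Rightarrow> 'a"
  assumes lip: "L-lipschitz_on UNIV f"
  shows "\<exists>u. ode_solution f u \<and> u 0 = x"
proof -
  \<comment> \<open>Adding 1 keeps the growth rate 2 K of the weight positive even when the
    Lipschitz constant is 0.\<close>
  define K where "K = L + 1"
  have L0: "0 \<le> L" using lipschitz_on_nonneg[OF lip] .
  have K: "0 < K" using L0 by (simp add: K_def)
  have fK: "norm (f a - f b) \<le> K * norm (a - b)" for a b
  proof -
    have "norm (f a - f b) \<le> L * norm (a - b)"
      using lipschitz_onD[OF lip, of a b] by (simp add: dist_norm)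
    also have "\<dots> \<le> K * norm (a - b)" by (intro mult_right_mono) (auto simp: K_def)
    finally show ?thesis .
  qed
  have fcont: "continuous_on UNIV f" by (rule lipschitz_on_continuous_on[OF lip])
  \<comment> \<open>A candidate u is stored as w t = exp (- 2 K t) u t, so that the sup norm of
    bounded continuous functions becomes the weighted norm of u; \<open>g w\<close> is the field
    along u.\<close>
  define g :: "(real \<Rightarrow>\<^sub>C 'a) \<Rightarrow> real \<Rightarrow> 'a" where
    "g w s = f (exp (2 * K * s) *\<^sub>R apply_bcontfun w s)" for w s
  define I where "I w t = x + integral {0..t} (g w)" for w t
  have gcont: "continuous_on A (g w)" for w A
    unfolding g_def
    by (rule continuous_on_compose2[OF fcont]) (auto intro!: continuous_intros)
  have Ider: "(I w has_vector_derivative g w t) (at t within {0..b})" if "0 \<le> t" "t \<le> b" for w t b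
    unfolding I_def
    using integral_has_vector_derivative[OF gcont[of "{0..b}" w], of t] that
    by (auto intro!: derivative_eq_intros)
  have Icont: "continuous_on {0..} (I w)" for w
    unfolding continuous_on_eq_continuous_within
  proof
    fix t :: real assume t: "t \<in> {0..}"
    have "continuous (at t within {0..t+1}) (I w)"
      using Ider[of t "t+1" w] t by (auto intro: has_vector_derivative_continuous)
    moreover have "at t within {0..t+1} = at t within {0..}"
      by (rule at_within_nhd[of _ "{..<t+1}"]) auto
    ultimately show "continuous (at t within {0..}) (I w)" by simp
  qed
  \<comment> \<open>Bounded continuous functions live on the whole line; for negative t the image is
    frozen at its value x at time 0.\<close>
  define T where "T w t = exp (- (2 * K * max 0 t)) *\<^sub>R I w (max 0 t)" for w t
  have Tcont: "continuous_on UNIV (T w)" for w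
    unfolding T_def
    by (intro continuous_intros continuous_on_compose2[OF Icont]) auto
  have gbound: "norm (g w s) \<le> (norm (f 0) + K * norm w) * exp (2 * K * s)" if "0 \<le> s" for w s
  proof -
    have "norm (g w s) \<le> norm (f 0) + K * norm (exp (2 * K * s) *\<^sub>R apply_bcontfun w s)"
      unfolding g_def using fK[of "exp (2 * K * s) *\<^sub>R apply_bcontfun w s" 0]
        norm_triangle_sub[of "f (exp (2 * K * s) *\<^sub>R apply_bcontfun w s)" "f 0"] by auto
    also have "\<dots> \<le> norm (f 0) * exp (2 * K * s) + K * (exp (2 * K * s) * norm w)"
      using K that norm_bounded[of w s]
      by (intro add_mono mult_left_mono) (auto simp: mult_le_cancel_left1)
    finally show ?thesis by (simp add: algebra_simps)
  qed
  have Tbound: "norm (T w t) \<le> norm x + (norm (f 0) + K * norm w) / (2 * K)" for w t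
  proof -
    define m where "m = max 0 t"
    have m: "0 \<le> m" by (simp add: m_def)
    have "norm (T w t) = exp (- (2 * K * m)) * norm (I w m)" by (simp add: T_def m_def)
    also have "\<dots> \<le> exp (- (2 * K * m)) * (norm x + (norm (f 0) + K * norm w) / (2 * K) * (exp (2 * K * m) - 1))"
      unfolding I_def
      by (intro mult_left_mono norm_triangle_le add_left_mono norm_integral_exp_le gcont)
         (use K m gbound in auto)
    also have "\<dots> = exp (- (2 * K * m)) * norm x + (norm (f 0) + K * norm w) / (2 * K) * (1 - exp (- (2 * K * m)))"
      by (simp add: algebra_simps exp_minus)
    also have "\<dots> \<le> 1 * norm x + (norm (f 0) + K * norm w) / (2 * K) * 1"
      using K m by (intro add_mono mult_right_mono mult_left_mono) auto
    finally show ?thesis by simp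
  qed
  define TB where "TB w = Bcontfun (T w)" for w
  have TB: "apply_bcontfun (TB w) = T w" for w
    unfolding TB_def by (intro Bcontfun_inverse bcontfun_normI[OF Tcont Tbound])
  have contr: "dist (TB v) (TB w) \<le> 1 / 2 * dist v w" for v w
  proof (rule dist_bound)
    fix t :: real
    define m where "m = max 0 t"
    have m: "0 \<le> m" by (simp add: m_def)
    have "dist (apply_bcontfun (TB v) t) (apply_bcontfun (TB w) t) = exp (- (2 * K * m)) * norm (I v m - I w m)"
      by (simp add: TB T_def m_def dist_norm flip: scaleR_diff_right)
    also have "I v m - I w m = integral {0..m} (\<lambda>s. g v s - g w s)"
      unfolding I_def using integral_diff[OF integrable_continuous_real[OF gcont] integrable_continuous_real[OF gcont], of 0 m v w]
      by simp
    also have "exp (- (2 * K * m)) * norm \<dots> \<le> exp (- (2 * K * m)) * (K * dist v w / (2 * K) * (exp (2 * K * m) - 1))"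
    proof (intro mult_left_mono norm_integral_exp_le continuous_intros gcont)
      fix s assume s: "s \<in> {0..m}"
      have "norm (g v s - g w s) \<le> K * (exp (2 * K * s) * dist (apply_bcontfun v s) (apply_bcontfun w s))"
        unfolding g_def by (rule order.trans[OF fK]) (simp add: dist_norm flip: scaleR_diff_right)
      also have "\<dots> \<le> K * (exp (2 * K * s) * dist v w)"
        using K by (intro mult_left_mono dist_bounded) auto
      finally show "norm (g v s - g w s) \<le> K * dist v w * exp (2 * K * s)" by (simp add: algebra_simps)
    qed (use K m in auto)
    also have "\<dots> = 1 / 2 * dist v w * (1 - exp (- (2 * K * m)))"
      using K by (simp add: field_simps exp_minus)
    also have "\<dots> \<le> 1 / 2 * dist v w * 1" by (intro mult_left_mono) auto
    finally show "dist (apply_bcontfun (TB v) t) (apply_bcontfun (TB w) t) \<le> 1 / 2 * dist v w" by simp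
  qed
  obtain w where w: "TB w = w"
    using banach_fix_type[of "1/2" TB] contr by auto
  have wI: "exp (2 * K * t) *\<^sub>R apply_bcontfun w t = I w t" if "0 \<le> t" for t
  proof -
    have "apply_bcontfun w t = exp (- (2 * K * t)) *\<^sub>R I w t"
      using TB[of w] that unfolding w by (simp add: T_def)
    then show ?thesis by (simp add: exp_minus)
  qed
  have "ode_solution f (I w)"
    unfolding ode_solution_def
  proof (intro allI impI)
    fix t :: real assume t: "0 \<le> t"
    have "(I w has_vector_derivative g w t) (at t within {0..t+1})"
      using Ider[of t "t+1" w] t by auto
    moreover have "at t within {0..t+1} = at t within {0..}"
      by (rule at_within_nhd[of _ "{..<t+1}"]) auto
    moreover have "g w t = f (I w t)" using wI[OF t] by (simp add: g_def)
    ultimately show "(I w has_vector_derivative f (I w t)) (at t within {0..})" by simp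
  qed
  moreover have "I w 0 = x" by (simp add: I_def)
  ultimately show ?thesis by blast
qed

text \<open>Multiplying g - b by exp (- k (t - s)) gives a function with nonpositive derivative. The
  sign of k is free: positive for growth of distances, negative for damping, zero for conserved
  quantities.\<close>

lemma gronwall_derivative:
  fixes g g' :: "real \<Rightarrow> real"
  assumes der: "\<And>t. s \<le> t \<Longrightarrow> (g has_real_derivative g' t) (at t within {s..})"
    and le: "\<And>t. s \<le> t \<Longrightarrow> g' t \<le> k * (g t - b)"
    and "s \<le> t"
  shows "g t - b \<le> (g s - b) * exp (k * (t - s))"
proof -
  define F where "F r = (g r - b) * exp (- (k * (r - s)))" for r
  define F' where "F' r = (g' r - k * (g r - b)) * exp (- (k * (r - s)))" for r
  have "(F has_derivative (\<lambda>h. F' r * h)) (at r within {s..t})" if "s \<le> r" "r \<le> t" for r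
  proof -
    have g: "(g has_real_derivative g' r) (at r within {s..t})"
      by (rule DERIV_subset[OF der[OF that(1)]]) auto
    have "(F has_real_derivative F' r) (at r within {s..t})"
      unfolding F_def F'_def
      by (rule derivative_eq_intros g refl | simp)+ (simp add: algebra_simps)
    then show ?thesis by (simp add: has_field_derivative_def)
  qed
  then have "\<exists>r\<in>{s..t}. F t - F s = F' r * (t - s)"
    using mvt_very_simple[of s t F "\<lambda>r h. F' r * h"] assms(3) by blast
  then obtain r where r: "r \<in> {s..t}" "F t - F s = F' r * (t - s)" by blast
  have "F' r \<le> 0"
    unfolding F'_def using le[of r] r by (intro mult_nonpos_nonneg) auto
  then have "F t \<le> F s" using r assms(3) using mult_nonpos_nonneg[of "F' r" "t - s"] by auto
  then have "(g t - b) * exp (- (k * (t - s))) \<le> g s - b" by (simp add: F_def)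
  then have "(g t - b) * exp (- (k * (t - s))) * exp (k * (t - s)) \<le> (g s - b) * exp (k * (t - s))"
    by (intro mult_right_mono) auto
  then show ?thesis by (simp add: mult.assoc flip: exp_add)
qed

lemma norm_power2_has_real_derivative:
  fixes u :: "real \<Rightarrow> 'a::real_inner"
  assumes "(u has_vector_derivative u') (at t within S)"
  shows "((\<lambda>t. (norm (u t))\<^sup>2) has_real_derivative 2 * (u t \<bullet> u')) (at t within S)"
  unfolding power2_norm_eq_inner has_field_derivative_def
  by (rule derivative_eq_intros assms[unfolded has_vector_derivative_def] refl)+
     (auto simp: fun_eq_iff inner_commute)

text \<open>Gronwall is applied to the squared distance, since the norm is not differentiable at 0.
  Uniqueness of solutions is the case of equal initial values.\<close>

lemma ode_solution_diff_le:
  fixes f :: "'a::real_inner \<Rightarrow> 'a"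
  assumes lip: "L-lipschitz_on UNIV f" and u: "ode_solution f u" and v: "ode_solution f v" and t: "0 \<le> t"
  shows "norm (u t - v t) \<le> norm (u 0 - v 0) * exp (L * t)"
proof -
  have "(norm (u t - v t))\<^sup>2 - 0 \<le> ((norm (u 0 - v 0))\<^sup>2 - 0) * exp (2 * L * (t - 0))"
  proof (rule gronwall_derivative[OF _ _ t])
    fix r :: real assume r: "0 \<le> r"
    have "((\<lambda>t. u t - v t) has_vector_derivative f (u r) - f (v r)) (at r within {0..})"
      using u v r unfolding ode_solution_def by (intro derivative_intros) auto
    then show "((\<lambda>t. (norm (u t - v t))\<^sup>2) has_real_derivative 2 * ((u r - v r) \<bullet> (f (u r) - f (v r)))) (at r within {0..})"
      by (rule norm_power2_has_real_derivative)
    have "(u r - v r) \<bullet> (f (u r) - f (v r)) \<le> norm (u r - v r) * norm (f (u r) - f (v r))"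
      by (rule norm_cauchy_schwarz)
    also have "\<dots> \<le> norm (u r - v r) * (L * norm (u r - v r))"
      using lipschitz_onD[OF lip, of "u r" "v r"] by (intro mult_left_mono) (auto simp: dist_norm)
    finally show "2 * ((u r - v r) \<bullet> (f (u r) - f (v r))) \<le> 2 * L * ((norm (u r - v r))\<^sup>2 - 0)"
      by (simp add: power2_eq_square algebra_simps)
  qed
  also have "\<dots> = (norm (u 0 - v 0) * exp (L * t))\<^sup>2"
    by (simp add: power_mult_distrib power2_eq_square flip: exp_add)
  finally have "(norm (u t - v t))\<^sup>2 \<le> (norm (u 0 - v 0) * exp (L * t))\<^sup>2" by simp
  then show ?thesis by (rule power2_le_imp_le) auto
qed

text \<open>For a Lipschitz field the choice is unique at nonnegative times; at negative times
  \<open>ode_solution\<close> leaves the value open.\<close>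

definition flow :: "('a::euclidean_space \<Rightarrow> 'a) \<Rightarrow> 'a \<Rightarrow> real \<Rightarrow> 'a" where
  "flow f x = (SOME u. ode_solution f u \<and> u 0 = x)"

context
  fixes f :: "'a::euclidean_space \<Rightarrow> 'a" and L :: real
  assumes lip: "L-lipschitz_on UNIV f"
begin

lemma flow_solution: "ode_solution f (flow f x)" and flow_0 [simp]: "flow f x 0 = x"
  using someI_ex[OF lipschitz_ode_solution_exists[OF lip, of x]] by (auto simp: flow_def)

lemma ode_solution_eq_flow:
  assumes "ode_solution f u" "0 \<le> t"
  shows "u t = flow f (u 0) t"
  using ode_solution_diff_le[OF lip assms(1) flow_solution assms(2), of "u 0"] by simp

lemma flow_diff_le: "0 \<le> t \<Longrightarrow> norm (flow f x t - flow f y t) \<le> norm (x - y) * exp (L * t)"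
  using ode_solution_diff_le[OF lip flow_solution flow_solution] by simp

lemma flow_add:
  assumes "0 \<le> s" "0 \<le> t"
  shows "flow f x (s + t) = flow f (flow f x s) t"
proof -
  have "ode_solution f (\<lambda>t. flow f x (s + t))"
    unfolding ode_solution_def
  proof (intro allI impI)
    fix t :: real assume t: "0 \<le> t"
    have "(flow f x has_vector_derivative f (flow f x (s + t))) (at (s + t) within (\<lambda>t. s + t) ` {0..})"
      using flow_solution[of x] t assms(1) unfolding ode_solution_def
      by (elim allE[where x = "s + t"]) (auto elim!: has_vector_derivative_within_subset)
    moreover have "((\<lambda>t. s + t) has_vector_derivative 1) (at t within {0..})"
      by (auto intro!: derivative_eq_intros)
    ultimately have "(flow f x \<circ> (\<lambda>t. s + t) has_vector_derivative 1 *\<^sub>R f (flow f x (s + t))) (at t within {0..})"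
      by (intro vector_diff_chain_within)
    then show "((\<lambda>t. flow f x (s + t)) has_vector_derivative f (flow f x (s + t))) (at t within {0..})"
      by (simp add: o_def)
  qed
  from ode_solution_eq_flow[OF this assms(2)] show ?thesis by simp
qed

context
  assumes f0: "f 0 = 0"
begin

lemma lipschitz_norm_le: "norm (f x) \<le> L * norm x"
  using lipschitz_onD[OF lip, of x 0] f0 by (simp add: dist_norm)

lemma flow_zero [simp]: "0 \<le> t \<Longrightarrow> flow f 0 t = 0"
  using ode_solution_eq_flow[of "\<lambda>_. 0" t] by (simp add: ode_solution_def f0)

lemma norm_flow_le: "0 \<le> t \<Longrightarrow> norm (flow f x t) \<le> norm x * exp (L * t)"
  using flow_diff_le[of t x 0] by simp

text \<open>The local error of an Euler step. The mean value inequality is used twice: the flow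
  moves by O(t norm x), so the field along it changes by that much, and integrating this change
  gives the second power of t. Errors scale with norm x because f vanishes at 0.\<close>

lemma flow_euler_error:
  assumes t: "0 \<le> t" "t \<le> 1"
  shows "norm (flow f x t - (x + t *\<^sub>R f x)) \<le> L\<^sup>2 * exp L * t\<^sup>2 * norm x"
proof -
  have L0: "0 \<le> L" using lipschitz_on_nonneg[OF lip] .
  define C where "C = L * exp L * norm x"
  have C: "0 \<le> C" using L0 by (simp add: C_def)
  have d1: "norm (flow f x r - x) \<le> C * t" if r: "0 \<le> r" "r \<le> t" for r
  proof -
    have "norm (flow f x r - flow f x 0) \<le> C * norm (r - 0)"
    proof (rule differentiable_bound[where S = "{0..t}" and f' = "\<lambda>s h. h *\<^sub>R f (flow f x s)"])
      fix s assume s: "s \<in> {0..t}"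
      have "(flow f x has_vector_derivative f (flow f x s)) (at s within {0..t})"
        using flow_solution[of x] s unfolding ode_solution_def
        by (auto intro: has_vector_derivative_within_subset[where S = "{0..}"])
      then show "(flow f x has_derivative (\<lambda>h. h *\<^sub>R f (flow f x s))) (at s within {0..t})"
        by (simp add: has_vector_derivative_def)
      have "norm (f (flow f x s)) \<le> L * (norm x * exp (L * s))"
        using lipschitz_norm_le[of "flow f x s"] norm_flow_le[of s x] s L0
        by (meson atLeastAtMost_iff mult_left_mono order_trans)
      also have "\<dots> \<le> L * (norm x * exp (L * 1))"
        using L0 s t by (intro mult_left_mono) (auto intro!: mult_left_le)
      finally have "norm (f (flow f x s)) \<le> C" by (simp add: C_def algebra_simps)
      then show "onorm (\<lambda>h. h *\<^sub>R f (flow f x s)) \<le> C"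
        by (intro onorm_bound C) (auto simp: mult.commute[of C] intro!: mult_left_mono)
    qed (use that t in auto)
    also have "\<dots> \<le> C * t" using r C by (auto intro!: mult_left_mono)
    finally show ?thesis by simp
  qed
  have "norm ((flow f x t - t *\<^sub>R f x) - (flow f x 0 - 0 *\<^sub>R f x)) \<le> (L * (C * t)) * norm (t - 0)"
  proof (rule differentiable_bound[where S = "{0..t}" and f' = "\<lambda>s h. h *\<^sub>R (f (flow f x s) - f x)"
        and f = "\<lambda>t. flow f x t - t *\<^sub>R f x"])
    fix s assume s: "s \<in> {0..t}"
    have "(flow f x has_vector_derivative f (flow f x s)) (at s within {0..t})"
      using flow_solution[of x] s unfolding ode_solution_def
      by (elim allE[where x = s]) (auto elim!: has_vector_derivative_within_subset)
    then have "((\<lambda>t. flow f x t - t *\<^sub>R f x) has_vector_derivative f (flow f x s) - f x) (at s within {0..t})"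
      by (auto intro!: derivative_eq_intros)
    then show "((\<lambda>t. flow f x t - t *\<^sub>R f x) has_derivative (\<lambda>h. h *\<^sub>R (f (flow f x s) - f x))) (at s within {0..t})"
      by (simp add: has_vector_derivative_def)
    have "norm (f (flow f x s) - f x) \<le> L * norm (flow f x s - x)"
      using lipschitz_onD[OF lip, of "flow f x s" x] by (simp add: dist_norm)
    also have "\<dots> \<le> L * (C * t)" using d1[of s] s L0 by (intro mult_left_mono) auto
    finally have "norm (f (flow f x s) - f x) \<le> L * (C * t)" .
    then show "onorm (\<lambda>h. h *\<^sub>R (f (flow f x s) - f x)) \<le> L * (C * t)"
      using C L0 t by (intro onorm_bound) (auto simp: mult.commute[of "L * (C * t)"] intro!: mult_left_mono)
  qed (use t in auto)
  also have "\<dots> = L\<^sup>2 * exp L * t\<^sup>2 * norm x" using t by (simp add: C_def power2_eq_square)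
  finally show ?thesis by (simp add: algebra_simps)
qed

end

end

section \<open>Lyapunov functions for Euler schemes\<close>

text \<open>From each point the flow enters the stability neighbourhood, and nearby points do so at the
  same time.\<close>

lemma uniform_attraction:
  fixes f :: "'a::euclidean_space \<Rightarrow> 'a"
  assumes lip: "L-lipschitz_on UNIV f" and stab: "lyapunov_stable f 0" and K: "compact K"
    and attr: "\<And>x. x \<in> K \<Longrightarrow> (flow f x \<longlongrightarrow> 0) at_top" and e: "0 < e"
  shows "\<exists>T\<ge>0. \<forall>x\<in>K. \<forall>t\<ge>T. norm (flow f x t) < e"
proof -
  obtain d where d: "0 < d" "\<And>u t. ode_solution f u \<Longrightarrow> norm (u 0) < d \<Longrightarrow> 0 \<le> t \<Longrightarrow> norm (u t) < e"
    using stab e unfolding lyapunov_stable_def by (metis diff_zero)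
  have "\<exists>s\<ge>0. norm (flow f x s) < d" if "x \<in> K" for x
  proof -
    have "\<forall>\<^sub>F t in at_top. norm (flow f x t) < d"
      using tendstoD[OF attr[OF that] d(1)] by simp
    then have "\<forall>\<^sub>F t in at_top. 0 \<le> t \<and> norm (flow f x t) < d"
      using eventually_ge_at_top[of 0] by (rule eventually_elim2) auto
    from eventually_happens[OF this] show ?thesis by auto
  qed
  then obtain s where s: "\<And>x. x \<in> K \<Longrightarrow> 0 \<le> s x \<and> norm (flow f x (s x)) < d" by metis
  \<comment> \<open>Within this radius the growth exp (L s) of distances up to time
    \<open>s x\<close> stays within the slack that the flow from x leaves below d.\<close>
  define r where "r x = (d - norm (flow f x (s x))) / exp (L * s x)" for x
  have r: "0 < r x" if "x \<in> K" for x using s[OF that] by (simp add: r_def)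
  have near: "norm (flow f y t) < e" if "x \<in> K" "y \<in> ball x (r x)" "s x \<le> t" for x y t
  proof -
    have "norm (flow f y (s x)) \<le> norm (flow f x (s x)) + norm (flow f y (s x) - flow f x (s x))"
      by (rule norm_triangle_sub)
    also have "norm (flow f y (s x) - flow f x (s x)) \<le> norm (y - x) * exp (L * s x)"
      by (rule flow_diff_le[OF lip]) (use s that in auto)
    also have "norm (y - x) * exp (L * s x) < r x * exp (L * s x)"
      using that by (intro mult_strict_right_mono) (auto simp: dist_norm norm_minus_commute)
    finally have "norm (flow f y (s x)) < d" by (simp add: r_def)
    then have "norm (flow f (flow f y (s x)) (t - s x)) < e"
      using that by (intro d(2) flow_solution[OF lip]) (auto simp: flow_0[OF lip])
    then show ?thesis using flow_add[OF lip, of "s x" "t - s x" y] s that by auto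
  qed
  obtain D where D: "D \<subseteq> K" "finite D" "K \<subseteq> (\<Union>x\<in>D. ball x (r x))"
  proof -
    have "K \<subseteq> (\<Union>x\<in>K. ball x (r x))" using r by force
    from compactE_image[OF K _ this] that show thesis by (metis open_ball)
  qed
  \<comment> \<open>A sum of nonnegative times bounds each of them, and it makes sense even when D
    is empty.\<close>
  define T where "T = (\<Sum>x\<in>D. s x)"
  have "s x \<le> T" if "x \<in> D" for x
    unfolding T_def using D s that by (intro member_le_sum) auto
  moreover have "0 \<le> T" unfolding T_def using D s by (intro sum_nonneg) auto
  ultimately show ?thesis using D near by (intro exI[of _ T]) fastforce
qed

text \<open>The rate is c and the largest step is a; K serves at once as comparison constant,
  Lipschitz constant and gain for errors. The offset C is a defect that remains when e = 0; C = 0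
  forces decay towards 0. The condition a c < 1 keeps the weight 1 - c s positive.\<close>

definition euler_lyapunov ::
    "('a::real_normed_vector \<Rightarrow> 'a) \<Rightarrow> ('a \<Rightarrow> real) \<Rightarrow> real \<Rightarrow> real \<Rightarrow> real \<Rightarrow> real \<Rightarrow> bool" where
  "euler_lyapunov f V c K a C \<longleftrightarrow> 0 < c \<and> 0 < K \<and> 0 < a \<and> a * c < 1 \<and> 0 \<le> C \<and> continuous_on UNIV V \<and>
     (\<forall>x. norm x \<le> V x \<and> V x \<le> K * norm x) \<and>
     (\<forall>x y. V x \<le> V y + K * norm (x - y)) \<and>
     (\<forall>s\<in>{0<..a}. \<forall>x e. V (x + s *\<^sub>R (f x + e)) \<le> (1 - c * s) * V x + K * s * (C + norm e))"

text \<open>The Lyapunov function is \<open>V x = sup {exp (k t) |flow x t| : 0 \<le> t \<le> T}\<close> with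
  \<open>exp (k T) = 2\<close>.\<close>

lemma contraction_imp_euler_lyapunov:
  fixes f :: "'a::euclidean_space \<Rightarrow> 'a"
  assumes lip: "L-lipschitz_on UNIV f" and f0: "f 0 = 0" and T: "0 < T"
    and contr: "\<And>x. norm (flow f x T) \<le> norm x / 2"
  shows "\<exists>V c K a. euler_lyapunov f V c K a 0"
proof -
  have L0: "0 \<le> L" using lipschitz_on_nonneg[OF lip] .
  define k where "k = ln 2 / T"
  have k: "0 < k" "exp (k * T) = 2" using T by (auto simp: k_def)
  define W where "W x t = exp (k * t) * norm (flow f x t)" for x t
  define V where "V x = (SUP t\<in>{0..T}. W x t)" for x
  \<comment> \<open>The weight exp (k t) contributes at most 2 on [0, T], and the flow separates
    points by at most the factor exp (L T).\<close>
  define K where "K = 2 * exp (L * T)"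
  have "1 \<le> exp (L * T)" using L0 T by simp
  then have K1: "1 \<le> K" unfolding K_def by linarith
  have exple: "exp (k * t) \<le> 2" "exp (L * t) \<le> exp (L * T)" if "t \<in> {0..T}" for t
    using that k L0 T by (auto simp flip: k(2) intro!: mult_left_mono)
  have Wle: "W x t \<le> K * norm x" if "t \<in> {0..T}" for x t
  proof -
    have "norm (flow f x t) \<le> norm x * exp (L * t)"
      using that by (intro norm_flow_le[OF lip f0]) auto
    also have "\<dots> \<le> norm x * exp (L * T)" using exple[OF that] by (intro mult_left_mono) auto
    finally have "W x t \<le> 2 * (norm x * exp (L * T))"
      unfolding W_def using exple[OF that] by (intro mult_mono) auto
    then show ?thesis by (simp add: K_def algebra_simps)
  qed
  have bdd: "bdd_above (W x ` {0..T})" for x using Wle by (intro bdd_aboveI2) auto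
  have WV: "W x t \<le> V x" if "t \<in> {0..T}" for x t
    unfolding V_def by (rule cSUP_upper[OF that bdd])
  have VI: "V x \<le> B" if "\<And>t. t \<in> {0..T} \<Longrightarrow> W x t \<le> B" for x B
    unfolding V_def using T that by (intro cSUP_least) auto
  have Vge: "norm x \<le> V x" for x
    using WV[of 0 x] T by (simp add: W_def flow_0[OF lip])
  have Vle: "V x \<le> K * norm x" for x by (rule VI) (rule Wle)
  have Vlip: "V x \<le> V y + K * norm (x - y)" for x y
  proof (rule VI)
    fix t assume t: "t \<in> {0..T}"
    have "norm (flow f x t) \<le> norm (flow f y t) + norm (flow f x t - flow f y t)"
      by (rule norm_triangle_sub)
    also have "norm (flow f x t - flow f y t) \<le> norm (x - y) * exp (L * t)"
      using t by (intro flow_diff_le[OF lip]) auto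
    finally have "W x t \<le> exp (k * t) * (norm (flow f y t) + norm (x - y) * exp (L * t))"
      unfolding W_def by (intro mult_left_mono) auto
    also have "\<dots> = W y t + exp (k * t) * exp (L * t) * norm (x - y)"
      by (simp add: W_def algebra_simps)
    also have "\<dots> \<le> V y + 2 * exp (L * T) * norm (x - y)"
      using exple[OF t] by (intro add_mono WV t mult_right_mono mult_mono) auto
    finally show "W x t \<le> V y + K * norm (x - y)" by (simp add: K_def)
  qed
  have Vcont: "continuous_on UNIV V"
  proof (rule lipschitz_on_continuous_on)
    show "K-lipschitz_on UNIV V"
    proof (rule lipschitz_onI)
      fix x y show "dist (V x) (V y) \<le> K * dist x y"
        using Vlip[of x y] Vlip[of y x] by (simp add: dist_norm norm_minus_commute abs_le_iff)
    qed (use K1 in auto)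
  qed
  have Vflow: "V (flow f x s) \<le> exp (- (k * s)) * V x" if s: "0 \<le> s" "s \<le> T" for x s
  proof (rule VI)
    fix t assume t: "t \<in> {0..T}"
    have "exp (k * (s + t)) * norm (flow f x (s + t)) \<le> V x"
    \<comment> \<open>If s + t runs past T, the contraction over a time T contributes the factor
      1/2, which pays for the factor exp (k T) = 2 in the weight.\<close>
    proof (cases "s + t \<le> T")
      case True
      then show ?thesis using WV[of "s + t" x] s t by (simp add: W_def)
    next
      case False
      define r where "r = s + t - T"
      have r: "r \<in> {0..T}" using False s t by (auto simp: r_def)
      have "exp (k * (s + t)) = exp (k * r) * 2"
        by (simp add: r_def algebra_simps flip: k(2) exp_add)
      moreover have "norm (flow f x (s + t)) \<le> norm (flow f x r) / 2"
        using flow_add[OF lip, of r T x] contr[of "flow f x r"] r T by (simp add: r_def)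
      ultimately have "exp (k * (s + t)) * norm (flow f x (s + t)) \<le> exp (k * r) * 2 * (norm (flow f x r) / 2)"
        by (auto intro!: mult_left_mono)
      also have "\<dots> = W x r" by (simp add: W_def)
      also have "\<dots> \<le> V x" by (rule WV[OF r])
      finally show ?thesis .
    qed
    then have "exp (- (k * s)) * (exp (k * (s + t)) * norm (flow f x (s + t))) \<le> exp (- (k * s)) * V x"
      by (intro mult_left_mono) auto
    moreover have "exp (- (k * s)) * exp (k * (s + t)) = exp (k * t)"
      by (simp add: algebra_simps flip: exp_add)
    ultimately show "W (flow f x s) t \<le> exp (- (k * s)) * V x"
      unfolding W_def using flow_add[OF lip, of s t x] s t by (simp flip: mult.assoc)
  qed
  define C where "C = K * (L\<^sup>2 * exp L)"
  have C0: "0 \<le> C" using K1 by (simp add: C_def)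
  \<comment> \<open>The four bounds serve, in turn, the Euler error estimate, the decay of V along
    the flow, the inequality exp (- k s) \<le> 1 - k s / 2, and the absorption of the second-order
    error into half of the rate k / 2.\<close>
  define a where "a = min (min 1 T) (min (1 / (2 * k)) (k / (4 * (C + 1))))"
  have a: "0 < a" "a \<le> 1" "a \<le> T" "a * k \<le> 1 / 2" "C * a \<le> k / 4"
  proof -
    show "0 < a" "a \<le> 1" "a \<le> T" using k T C0 by (auto simp: a_def)
    have "a \<le> 1 / (2 * k)" by (simp add: a_def)
    then show "a * k \<le> 1 / 2" using k by (simp add: field_simps)
    have "a \<le> k / (4 * (C + 1))" by (simp add: a_def)
    then have "(C + 1) * a \<le> k / 4" using C0 by (simp add: field_simps)
    then show "C * a \<le> k / 4" using \<open>0 < a\<close> by (simp add: algebra_simps)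
  qed
  have "V (x + s *\<^sub>R (f x + e)) \<le> (1 - k / 4 * s) * V x + K * s * norm e" if s: "s \<in> {0<..a}" for s x e
  proof -
    have sa: "s * k \<le> a * k" "C * s \<le> C * a"
      using s k C0 by (auto intro!: mult_right_mono mult_left_mono)
    have s': "0 < s" "s \<le> 1" "s \<le> T" "s * k \<le> 1 / 2" "C * s \<le> k / 4"
      using s a sa by auto
    have "V (x + s *\<^sub>R (f x + e)) \<le> V (flow f x s) + K * norm ((x + s *\<^sub>R (f x + e)) - flow f x s)"
      by (rule Vlip)
    also have "norm ((x + s *\<^sub>R (f x + e)) - flow f x s) \<le> norm (flow f x s - (x + s *\<^sub>R f x)) + s * norm e"
    proof -
      have "(x + s *\<^sub>R (f x + e)) - flow f x s = s *\<^sub>R e - (flow f x s - (x + s *\<^sub>R f x))"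
        by (simp add: algebra_simps)
      then show ?thesis
        using norm_triangle_ineq4[of "s *\<^sub>R e" "flow f x s - (x + s *\<^sub>R f x)"] s'
        by (simp only: norm_scaleR abs_of_pos add.commute)
    qed
    also have "norm (flow f x s - (x + s *\<^sub>R f x)) \<le> L\<^sup>2 * exp L * s\<^sup>2 * norm x"
      using s' by (intro flow_euler_error[OF lip f0]) auto
    also have "V (flow f x s) \<le> exp (- (k * s)) * V x" using s' by (intro Vflow) auto
    \<comment> \<open>With y = k s this is exp (- y) \<le> 1 / (1 + y) \<le> 1 - y / 2 for 0 \<le> y
      \<le> 1, multiplied through by 1 + y.\<close>
    also have "exp (- (k * s)) \<le> 1 - k * s / 2"
    proof -
      have "(1 + k * s) * exp (- (k * s)) \<le> exp (k * s) * exp (- (k * s))"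
        by (intro mult_right_mono) auto
      then have "(1 + k * s) * exp (- (k * s)) \<le> 1" by (simp flip: exp_add)
      moreover have "1 \<le> (1 + k * s) * (1 - k * s / 2)"
      proof -
        have "0 \<le> k * s * (1 - k * s) / 2" using k s' by (simp add: mult.commute)
        then show ?thesis by (simp add: algebra_simps power2_eq_square)
      qed
      ultimately have "(1 + k * s) * exp (- (k * s)) \<le> (1 + k * s) * (1 - k * s / 2)" by linarith
      moreover have "0 < 1 + k * s" using k s' by (simp add: add_pos_pos)
      ultimately show ?thesis by (simp add: mult_le_cancel_left_pos)
    qed
    finally have "V (x + s *\<^sub>R (f x + e)) \<le> (1 - k * s / 2) * V x + K * (L\<^sup>2 * exp L * s\<^sup>2 * norm x + s * norm e)"
      using K1 Vge[of x] norm_ge_zero[of x] by (auto simp: mult_left_mono mult_right_mono)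
    also have "K * (L\<^sup>2 * exp L * s\<^sup>2 * norm x + s * norm e) = s * (C * s) * norm x + K * s * norm e"
      by (simp add: C_def algebra_simps power2_eq_square)
    also have "s * (C * s) * norm x \<le> s * (k / 4) * V x"
      using s' Vge[of x] k C0 by (intro mult_mono) auto
    finally show ?thesis by (simp add: algebra_simps)
  qed
  then show ?thesis
    unfolding euler_lyapunov_def
    using k K1 a Vcont Vge Vle Vlip
    by (intro exI[of _ V] exI[of _ "k / 4"] exI[of _ K] exI[of _ a]) auto
qed

text \<open>The difference g - f is treated as part of the error e. Through the gain K its linear
  part costs c / 2, half of the rate, and its constant part is added to the offset.\<close>

lemma euler_lyapunov_perturb:
  fixes f g :: "'a::real_normed_vector \<Rightarrow> 'a"
  assumes V: "euler_lyapunov f V c K a C"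
    and close: "\<And>x. norm (g x - f x) \<le> c / (2 * K) * norm x + D" and D: "0 \<le> D"
  shows "euler_lyapunov g V (c / 2) K a (C + D)"
proof -
  have pos: "0 < c" "0 < K" "0 < a" "0 \<le> C" using V by (auto simp: euler_lyapunov_def)
  have "V (x + s *\<^sub>R (g x + e)) \<le> (1 - c / 2 * s) * V x + K * s * (C + D + norm e)"
    if s: "s \<in> {0<..a}" for s x e
  proof -
    have "V (x + s *\<^sub>R (f x + (g x - f x + e))) \<le> (1 - c * s) * V x + K * s * (C + norm (g x - f x + e))"
      using V s unfolding euler_lyapunov_def by blast
    also have "\<dots> \<le> (1 - c * s) * V x + K * s * (C + (c / (2 * K) * V x + D + norm e))"
    proof -
      have "c / (2 * K) * norm x \<le> c / (2 * K) * V x"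
        using V pos by (intro mult_left_mono) (auto simp: euler_lyapunov_def)
      then have "norm (g x - f x + e) \<le> c / (2 * K) * V x + D + norm e"
        using close[of x] by (intro norm_triangle_le add_mono) auto
      then show ?thesis using pos s by (intro add_left_mono mult_left_mono) auto
    qed
    also have "\<dots> = (1 - c / 2 * s) * V x + K * s * (C + D + norm e)"
      using pos by (simp add: field_simps)
    finally show ?thesis by (simp add: algebra_simps)
  qed
  moreover have "a * (c / 2) < 1"
  proof -
    have "a * c < 1" "0 < a * c" using V pos by (auto simp: euler_lyapunov_def)
    then show ?thesis by simp
  qed
  ultimately show ?thesis using V D unfolding euler_lyapunov_def by auto
qed

text \<open>Translation changes a Lipschitz field by a bounded amount, which goes into the offset;
  rate and step bound stay as they were.\<close>

lemma euler_lyapunov_shift: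
  fixes f :: "'a::real_normed_vector \<Rightarrow> 'a"
  assumes V: "euler_lyapunov f V c K a C" and L: "L-lipschitz_on UNIV f"
  shows "euler_lyapunov (\<lambda>x. f (x + z)) V c K a (C + L * norm z)"
proof -
  have "V (x + s *\<^sub>R (f (x + z) + e)) \<le> (1 - c * s) * V x + K * s * (C + L * norm z + norm e)"
    if s: "s \<in> {0<..a}" for s x e
  proof -
    have "V (x + s *\<^sub>R (f x + (f (x + z) - f x + e)))
        \<le> (1 - c * s) * V x + K * s * (C + norm (f (x + z) - f x + e))"
      using V s unfolding euler_lyapunov_def by blast
    also have "\<dots> \<le> (1 - c * s) * V x + K * s * (C + L * norm z + norm e)"
    proof -
      have "norm (f (x + z) - f x + e) \<le> L * norm z + norm e"
        using lipschitz_onD[OF L, of "x + z" x]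
        by (intro norm_triangle_le add_mono) (auto simp: dist_norm)
      then show ?thesis
        using V s by (intro add_left_mono mult_left_mono) (auto simp: euler_lyapunov_def)
    qed
    finally show ?thesis by (simp add: algebra_simps)
  qed
  then show ?thesis
    using V lipschitz_on_nonneg[OF L] unfolding euler_lyapunov_def by auto
qed

text \<open>The flow is itself an Euler step with an error \<open>e\<close> of order \<open>s\<close>, so a one-step drift on a set
  \<open>S\<close> invariant under it makes the flow decay.\<close>

lemma flow_decay:
  fixes f :: "'a::euclidean_space \<Rightarrow> 'a"
  assumes lip: "L-lipschitz_on UNIV f" and f0: "f 0 = 0"
    and pos: "0 < c" "0 < K" "0 < a" "a * c < 1" "0 \<le> C"
    and V: "\<And>x. norm x \<le> V x" "\<And>x. V x \<le> K * norm x"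
    and drift: "\<And>x s e. x \<in> S \<Longrightarrow> s \<in> {0<..a} \<Longrightarrow>
        V (x + s *\<^sub>R (f x + e)) \<le> (1 - c * s) * V x + K * s * (C + norm e)"
    and inv: "\<And>x y s. x \<in> S \<Longrightarrow> s \<in> {0<..a} \<Longrightarrow> V y \<le> (1 - c / 2 * s) * V x + K * s * C \<Longrightarrow> y \<in> S"
  shows "\<exists>D\<ge>0. (C = 0 \<longrightarrow> D = 0) \<and> (\<forall>\<eta>>0. \<exists>T. \<forall>t\<ge>T. \<forall>x\<in>S. norm (flow f x t) \<le> \<eta> * norm x + D)"
proof -
  have L0: "0 \<le> L" using lipschitz_on_nonneg[OF lip] .
  define E where "E = L\<^sup>2 * exp L"
  have E0: "0 \<le> E" by (simp add: E_def)
  \<comment> \<open>The error of the Euler step, of size K E s^2 V x, then costs at most half of the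
    rate c, which leaves the factor q below.\<close>
  define s where "s = min (min a 1) (c / (2 * (K * E + 1)))"
  have s: "0 < s" "s \<le> a" "s \<le> 1" "s \<in> {0<..a}" using pos E0 by (auto simp: s_def add_nonneg_pos)
  have "s \<le> c / (2 * (K * E + 1))" by (simp add: s_def)
  moreover have "0 < 2 * (K * E + 1)" using pos E0 by (simp add: add_nonneg_pos)
  ultimately have "(K * E + 1) * s \<le> c / 2" by (simp add: pos_le_divide_eq algebra_simps)
  then have sE: "K * E * s \<le> c / 2" using s by (simp add: algebra_simps)
  define q where "q = 1 - c / 2 * s"
  have sc: "s * c < 1" using pos s mult_right_mono[of s a c] by linarith
  have q: "0 < q" "q < 1" using pos s sc by (auto simp: q_def mult.commute)
  have step: "V (flow f x s) \<le> q * V x + K * s * C" if x: "x \<in> S" for x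
  proof -
    define e where "e = (1 / s) *\<^sub>R (flow f x s - (x + s *\<^sub>R f x))"
    have "norm e \<le> 1 / s * (E * s\<^sup>2 * norm x)"
      unfolding e_def E_def using s flow_euler_error[OF lip f0, of s x]
      by (simp add: divide_right_mono)
    also have "\<dots> = E * s * norm x" using s by (simp add: power2_eq_square)
    also have "\<dots> \<le> E * s * V x" using E0 s V by (intro mult_left_mono) auto
    finally have e: "norm e \<le> E * s * V x" .
    have "flow f x s = x + s *\<^sub>R (f x + e)" using s by (simp add: e_def algebra_simps)
    then have "V (flow f x s) \<le> (1 - c * s) * V x + K * s * (C + norm e)"
      using drift[OF x s(4), of e] by simp
    also have "\<dots> \<le> (1 - c * s) * V x + K * s * (C + E * s * V x)"
      using e pos s by (intro add_left_mono mult_left_mono) auto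
    also have "\<dots> = (1 - c * s + s * (K * E * s)) * V x + K * s * C" by (simp add: algebra_simps)
    also have "\<dots> \<le> (1 - c * s + s * (c / 2)) * V x + K * s * C"
      using sE s V(1)[of x] norm_ge_zero[of x]
      by (intro add_right_mono mult_right_mono add_left_mono mult_left_mono) linarith+
    finally show ?thesis by (simp add: q_def algebra_simps)
  qed
  \<comment> \<open>The fixed point of b = q b + K s C, hence 0 when C = 0.\<close>
  define B where "B = K * s * C / (1 - q)"
  have B: "0 \<le> B" "q * B + K * s * C = B" "C = 0 \<Longrightarrow> B = 0"
    using q pos s by (auto simp: B_def field_simps)
  have iter: "flow f x (real n * s) \<in> S \<and> V (flow f x (real n * s)) \<le> q ^ n * V x + B" if x: "x \<in> S" for x n
  proof (induction n)
    case 0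
    then show ?case using x B by (simp add: flow_0[OF lip])
  next
    case (Suc n)
    define y where "y = flow f x (real n * s)"
    have eq: "flow f x (real (Suc n) * s) = flow f y s"
      using flow_add[OF lip, of "real n * s" s x] s by (simp add: y_def algebra_simps)
    have y: "y \<in> S" "V y \<le> q ^ n * V x + B" using Suc by (auto simp: y_def)
    have st: "V (flow f y s) \<le> q * V y + K * s * C" by (rule step[OF y(1)])
    also have "\<dots> \<le> q * (q ^ n * V x + B) + K * s * C"
      using y q by (intro add_right_mono mult_left_mono) auto
    also have "\<dots> = q ^ Suc n * V x + (q * B + K * s * C)" by (simp add: algebra_simps)
    finally have "V (flow f y s) \<le> q ^ Suc n * V x + B" by (simp only: B(2))
    moreover have "flow f y s \<in> S" using inv[OF y(1) s(4)] st by (simp add: q_def)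
    ultimately show ?case unfolding eq by blast
  qed
  \<comment> \<open>Decay is known at multiples of s only; between two of them the norm grows by at
    most the factor exp (L s).\<close>
  define D where "D = exp (L * s) * B"
  have "\<exists>T. \<forall>t\<ge>T. \<forall>x\<in>S. norm (flow f x t) \<le> \<eta> * norm x + D" if \<eta>: "0 < \<eta>" for \<eta>
  proof -
    have "(\<lambda>n. exp (L * s) * K * q ^ n) \<longlonglongrightarrow> exp (L * s) * K * 0"
      by (intro tendsto_intros LIMSEQ_realpow_zero) (use q in auto)
    then have "\<forall>\<^sub>F n in sequentially. exp (L * s) * K * q ^ n < \<eta>"
      using order_tendstoD(2)[OF _ \<eta>] by simp
    then obtain N where N: "\<And>n. n \<ge> N \<Longrightarrow> exp (L * s) * K * q ^ n < \<eta>"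
      unfolding eventually_sequentially by blast
    have "norm (flow f x t) \<le> \<eta> * norm x + D" if t: "t \<ge> real N * s" and x: "x \<in> S" for t x
    proof -
      define n where "n = nat \<lfloor>t / s\<rfloor>"
      have "real N \<le> t / s" using t s by (simp add: field_simps)
      then have n: "N \<le> n" "real n \<le> t / s" "t / s \<le> real n + 1"
        unfolding n_def by linarith+
      have n': "real n * s \<le> t" "t - real n * s \<le> s" using n s by (auto simp: field_simps)
      have "norm (flow f x t) = norm (flow f (flow f x (real n * s)) (t - real n * s))"
        using flow_add[OF lip, of "real n * s" "t - real n * s" x] n' s by simp
      also have "\<dots> \<le> norm (flow f x (real n * s)) * exp (L * (t - real n * s))"
        using n' by (intro norm_flow_le[OF lip f0]) auto
      also have "\<dots> \<le> (q ^ n * V x + B) * exp (L * s)"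
      proof (intro mult_mono)
        show "norm (flow f x (real n * s)) \<le> q ^ n * V x + B"
          using iter[OF x, of n] V(1)[of "flow f x (real n * s)"] by linarith
        then show "0 \<le> q ^ n * V x + B" using norm_ge_zero order.trans by blast
        show "exp (L * (t - real n * s)) \<le> exp (L * s)"
          using mult_left_mono[OF n'(2) L0] by simp
      qed simp
      also have "\<dots> \<le> (q ^ n * (K * norm x) + B) * exp (L * s)"
        using V(2)[of x] q by (intro mult_right_mono add_right_mono mult_left_mono) auto
      also have "\<dots> = exp (L * s) * K * q ^ n * norm x + D" by (simp add: D_def algebra_simps)
      also have "\<dots> \<le> \<eta> * norm x + D" using N[OF n(1)] by (intro add_right_mono mult_right_mono) auto
      finally show ?thesis .
    qed
    then show ?thesis by blast
  qed
  then show ?thesis using B by (intro exI[of _ D]) (auto simp: D_def)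
qed

text \<open>Three regions cover the space. On norm x \<le> r the near bound halves the norm; on norm
  x \<ge> 4 D the far bound with \<eta> = 1/4 gives norm x / 4 + D \<le> norm x / 2; the shell
  between lies in a compact ball, from which the flow enters radius r / 2 uniformly.\<close>

lemma global_contraction:
  fixes f :: "'a::euclidean_space \<Rightarrow> 'a"
  assumes lip: "L-lipschitz_on UNIV f" and gas: "globally_asymptotically_stable f 0"
    and near: "0 < r" "\<And>\<eta>. 0 < \<eta> \<Longrightarrow> \<exists>T. \<forall>t\<ge>T. \<forall>x\<in>cball 0 r. norm (flow f x t) \<le> \<eta> * norm x"
    and far: "\<And>\<eta>. 0 < \<eta> \<Longrightarrow> \<exists>T. \<forall>t\<ge>T. \<forall>x. norm (flow f x t) \<le> \<eta> * norm x + D"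
  shows "\<exists>T>0. \<forall>x. norm (flow f x T) \<le> norm x / 2"
proof -
  obtain T1 where T1: "\<And>t x. T1 \<le> t \<Longrightarrow> norm x \<le> r \<Longrightarrow> norm (flow f x t) \<le> 1 / 2 * norm x"
    using near(2)[of "1/2"] by (metis dist_0_norm half_gt_zero mem_cball zero_less_one)
  obtain T2 where T2: "\<And>t x. T2 \<le> t \<Longrightarrow> norm (flow f x t) \<le> 1 / 4 * norm x + D"
    using far[of "1/4"] by auto
  have "\<exists>T\<ge>0. \<forall>x\<in>cball 0 (4 * D). \<forall>t\<ge>T. norm (flow f x t) < r / 2"
    using gas near(1) flow_solution[OF lip] unfolding globally_asymptotically_stable_def
    by (intro uniform_attraction[OF lip]) auto
  then obtain T3 where "\<forall>x\<in>cball 0 (4 * D). \<forall>t\<ge>T3. norm (flow f x t) < r / 2" by blast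
  then have T3: "norm (flow f x t) < r / 2" if "norm x \<le> 4 * D" "T3 \<le> t" for x t
    using that by simp
  define T where "T = max 1 (max T1 (max T2 T3))"
  have T: "T1 \<le> T" "T2 \<le> T" "T3 \<le> T" "0 < T" by (auto simp: T_def)
  have "norm (flow f x T) \<le> norm x / 2" for x
  proof -
    consider "norm x \<le> r" | "r \<le> norm x" "norm x \<le> 4 * D" | "4 * D \<le> norm x" by linarith
    then show ?thesis
    proof cases
      case 1 then show ?thesis using T1[OF T(1), of x] by simp
    next
      case 2 then show ?thesis using T3[OF _ T(3), of x] by linarith
    next
      case 3 then show ?thesis using T2[OF T(2), of x] by linarith
    qed
  qed
  then show ?thesis using T(4) by blast
qed

section \<open>The field at infinity\<close>

context
  fixes f h :: "'a::euclidean_space \<Rightarrow> 'a" and L :: real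
  assumes lip: "L-lipschitz_on UNIV f" and inf: "field_at_infinity f h"
begin

lemma field_at_infinity_lipschitz: "L-lipschitz_on UNIV h"
proof (rule lipschitz_onI)
  fix x y :: 'a
  have "((\<lambda>c. norm ((1 / c) *\<^sub>R f (c *\<^sub>R x) - (1 / c) *\<^sub>R f (c *\<^sub>R y))) \<longlongrightarrow> norm (h x - h y)) at_top"
    using inf unfolding field_at_infinity_def by (intro tendsto_intros) auto
  moreover have "\<forall>\<^sub>F c in at_top. norm ((1 / c) *\<^sub>R f (c *\<^sub>R x) - (1 / c) *\<^sub>R f (c *\<^sub>R y)) \<le> L * norm (x - y)"
    using eventually_gt_at_top[of 0]
  proof eventually_elim
    case (elim c)
    have "norm (f (c *\<^sub>R x) - f (c *\<^sub>R y)) \<le> L * norm (c *\<^sub>R x - c *\<^sub>R y)"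
      using lipschitz_onD[OF lip, of "c *\<^sub>R x" "c *\<^sub>R y"] by (simp add: dist_norm)
    also have "\<dots> = c * (L * norm (x - y))" using elim by (simp flip: scaleR_diff_right)
    finally have "(1 / c) * norm (f (c *\<^sub>R x) - f (c *\<^sub>R y)) \<le> L * norm (x - y)"
      using elim by (simp add: pos_divide_le_eq mult.commute)
    then show ?case using elim by (simp flip: scaleR_diff_right)
  qed
  ultimately have "norm (h x - h y) \<le> L * norm (x - y)"
    by (rule tendsto_upperbound) simp
  then show "dist (h x) (h y) \<le> L * dist x y" by (simp add: dist_norm)
qed (rule lipschitz_on_nonneg[OF lip])

text \<open>Rescaling the parameter c to c k leaves the limit unchanged. Homogeneity carries
  estimates on a single sphere over to all nonzero points.\<close>

lemma field_at_infinity_scaleR: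
  assumes k: "0 < k"
  shows "h (k *\<^sub>R x) = k *\<^sub>R h x"
proof -
  have "((\<lambda>c::real. (1 / c) *\<^sub>R f (c *\<^sub>R k *\<^sub>R x)) \<longlongrightarrow> h (k *\<^sub>R x)) at_top"
    using inf unfolding field_at_infinity_def by blast
  moreover have "filterlim (\<lambda>c::real. c * k) at_top at_top"
    by (subst mult.commute) (rule filterlim_tendsto_pos_mult_at_top[OF tendsto_const k filterlim_ident])
  then have "((\<lambda>c::real. k *\<^sub>R ((1 / (c * k)) *\<^sub>R f ((c * k) *\<^sub>R x))) \<longlongrightarrow> k *\<^sub>R h x) at_top"
    using inf unfolding field_at_infinity_def
    by (intro tendsto_intros) (auto intro: filterlim_compose[where g = "\<lambda>c. (1 / c) *\<^sub>R f (c *\<^sub>R x)"])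
  then have "((\<lambda>c::real. (1 / c) *\<^sub>R f (c *\<^sub>R k *\<^sub>R x)) \<longlongrightarrow> k *\<^sub>R h x) at_top"
    using k by simp
  ultimately show ?thesis by (rule tendsto_unique[OF trivial_limit_at_top_linorder])
qed

text \<open>The limit at infinity is only pointwise in the direction. A finite net of the sphere and
  the common Lipschitz constant make it uniform, homogeneity carries it to large x, and the
  remaining ball is paid for by C.\<close>

lemma field_at_infinity_close:
  assumes h0: "h 0 = 0" and e: "0 < e"
  shows "\<exists>C\<ge>0. \<forall>x. norm (f x - h x) \<le> e * norm x + C"
proof -
  note liph = field_at_infinity_lipschitz
  have L0: "0 \<le> L" using lipschitz_on_nonneg[OF lip] .
  \<comment> \<open>Replacing a direction by its net point costs L d for f and for h, together at
    most e / 2; the limit at the net points takes the other e / 2.\<close>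
  define d where "d = e / (4 * (L + 1))"
  have d: "0 < d" "L * d \<le> e / 4" using e L0 by (auto simp: d_def field_simps)
  obtain N :: "'a set" where N: "N \<subseteq> sphere 0 1" "finite N" "sphere 0 1 \<subseteq> (\<Union>v\<in>N. ball v d)"
  proof -
    have "sphere (0::'a) 1 \<subseteq> (\<Union>v\<in>sphere 0 1. ball v d)" using d by force
    then show thesis by (rule compactE_image[OF compact_sphere _, rotated]) (auto intro: that)
  qed
  have "\<forall>\<^sub>F c in at_top. dist ((1 / c) *\<^sub>R f (c *\<^sub>R v)) (h v) < e / 2" for v
    using inf e unfolding field_at_infinity_def by (intro tendstoD) auto
  then have "\<forall>\<^sub>F c in at_top. \<forall>v\<in>N. dist ((1 / c) *\<^sub>R f (c *\<^sub>R v)) (h v) < e / 2"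
    using N(2) by (intro eventually_ball_finite) auto
  then obtain c0 where c0: "\<And>c v. c0 \<le> c \<Longrightarrow> v \<in> N \<Longrightarrow> dist ((1 / c) *\<^sub>R f (c *\<^sub>R v)) (h v) < e / 2"
    unfolding eventually_at_top_linorder by blast
  define R where "R = max 1 c0"
  define C where "C = norm (f 0) + 2 * L * R"
  have C: "0 \<le> C" using L0 by (simp add: C_def R_def)
  have "norm (f x - h x) \<le> e * norm x + C" for x
  proof (cases "norm x \<le> R")
    case True
    have "norm (f x) \<le> norm (f 0) + L * norm x" "norm (h x) \<le> L * norm x"
      using lipschitz_onD[OF lip, of x 0] lipschitz_onD[OF liph, of x 0] norm_triangle_sub[of "f x" "f 0"]
      by (auto simp: dist_norm h0)
    then have "norm (f x - h x) \<le> norm (f 0) + L * norm x + L * norm x"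
      using norm_triangle_ineq4[of "f x" "h x"] by linarith
    also have "\<dots> \<le> C" using True L0 by (simp add: C_def mult_left_mono)
    also have "\<dots> \<le> e * norm x + C" using e by simp
    finally show ?thesis .
  next
    case False
    define c where "c = norm x"
    have c: "1 \<le> c" "c0 \<le> c" "0 < c" using False by (auto simp: c_def R_def)
    define u where "u = (1 / c) *\<^sub>R x"
    have u: "x = c *\<^sub>R u" "norm u = 1" using c by (auto simp: u_def c_def)
    obtain v where v: "v \<in> N" "dist u v \<le> d"
      using N(3) u by (force simp: dist_commute)
    have ev: "norm (f (c *\<^sub>R v) - c *\<^sub>R h v) \<le> c * (e / 2)"
    proof -
      have "f (c *\<^sub>R v) - c *\<^sub>R h v = c *\<^sub>R ((1 / c) *\<^sub>R f (c *\<^sub>R v) - h v)" using c by (simp add: algebra_simps)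
      then show ?thesis using c0[OF c(2) v(1)] c by (simp add: dist_norm)
    qed
    have "f x - h x = (f (c *\<^sub>R u) - f (c *\<^sub>R v)) + (f (c *\<^sub>R v) - c *\<^sub>R h v) + c *\<^sub>R (h v - h u)"
      using field_at_infinity_scaleR[OF c(3), of u] by (simp add: u(1)[symmetric] algebra_simps)
    then have "norm (f x - h x) \<le> norm (f (c *\<^sub>R u) - f (c *\<^sub>R v)) + norm (f (c *\<^sub>R v) - c *\<^sub>R h v) + norm (c *\<^sub>R (h v - h u))"
      by (metis (no_types) norm_triangle_le norm_triangle_ineq add_right_mono)
    also have "norm (f (c *\<^sub>R u) - f (c *\<^sub>R v)) \<le> L * (c * dist u v)"
      using lipschitz_onD[OF lip, of "c *\<^sub>R u" "c *\<^sub>R v"] c by (simp add: dist_norm flip: scaleR_diff_right)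
    also have "norm (c *\<^sub>R (h v - h u)) \<le> c * (L * dist u v)"
      using lipschitz_onD[OF liph, of v u] c by (simp add: dist_norm norm_minus_commute)
    finally have "norm (f x - h x) \<le> L * (c * dist u v) + c * (e / 2) + c * (L * dist u v)" using ev by simp
    also have "\<dots> = c * (2 * (L * dist u v) + e / 2)" by (simp add: algebra_simps)
    also have "\<dots> \<le> c * (2 * (e / 4) + e / 2)"
      using d(2) mult_left_mono[OF v(2) L0] c by (intro mult_left_mono) auto
    also have "\<dots> \<le> e * norm x + C" using C by (simp add: c_def algebra_simps)
    finally show ?thesis .
  qed
  then show ?thesis using C by blast
qed

text \<open>Local attraction gives a uniform time after which the flow from one small sphere has
  halved its norm. Positive multiples of solutions are solutions, so the same time works for every
  starting point.\<close>

lemma field_at_infinity_contraction: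
  assumes stab: "asymptotically_stable h 0"
  shows "\<exists>T>0. \<forall>x. norm (flow h x T) \<le> norm x / 2"
proof -
  note liph = field_at_infinity_lipschitz
  have h0: "h 0 = 0" using stab by (auto simp: asymptotically_stable_def lyapunov_stable_def)
  obtain d where d: "0 < d" "\<And>u. ode_solution h u \<Longrightarrow> norm (u 0) < d \<Longrightarrow> (u \<longlongrightarrow> 0) at_top"
    using stab by (auto simp: asymptotically_stable_def)
  have "\<exists>T\<ge>0. \<forall>x\<in>sphere 0 (d / 2). \<forall>t\<ge>T. norm (flow h x t) < d / 4"
    using stab d
    by (intro uniform_attraction[OF liph])
       (auto simp: asymptotically_stable_def intro!: d(2) flow_solution[OF liph] simp: flow_0[OF liph])
  then obtain T where T: "0 \<le> T" "\<And>x t. norm x = d / 2 \<Longrightarrow> T \<le> t \<Longrightarrow> norm (flow h x t) < d / 4"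
    by auto
  have "norm (flow h x (T + 1)) \<le> norm x / 2" for x
  proof (cases "x = 0")
    case True
    then show ?thesis using T by (simp add: flow_zero[OF liph h0])
  next
    case False
    \<comment> \<open>Moves x onto the sphere of radius d / 2, where attraction is known.\<close>
    define k where "k = d / (2 * norm x)"
    have k: "0 < k" using False d by (simp add: k_def)
    have "ode_solution h (\<lambda>t. k *\<^sub>R flow h x t)"
      using flow_solution[OF liph, of x] unfolding ode_solution_def
      by (auto simp: field_at_infinity_scaleR[OF k] intro!: derivative_eq_intros)
    then have "k *\<^sub>R flow h x (T + 1) = flow h (k *\<^sub>R x) (T + 1)"
      using ode_solution_eq_flow[OF liph, of "\<lambda>t. k *\<^sub>R flow h x t" "T + 1"] T
      by (simp add: flow_0[OF liph])
    moreover have "norm (k *\<^sub>R x) = d / 2" using False d by (simp add: k_def)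
    ultimately have "norm (k *\<^sub>R flow h x (T + 1)) < d / 4" using T(2) by simp
    then have "k * norm (flow h x (T + 1)) < k * (norm x / 2)" using k False d by (simp add: k_def)
    then show ?thesis using k by (simp add: mult_less_cancel_left_pos)
  qed
  then show ?thesis using T by (intro exI[of _ "T + 1"]) auto
qed

lemma field_at_infinity_euler_lyapunov:
  assumes stab: "asymptotically_stable h 0"
  shows "\<exists>V c K a C. euler_lyapunov f V c K a C"
proof -
  have h0: "h 0 = 0" using stab by (auto simp: asymptotically_stable_def lyapunov_stable_def)
  obtain T where "0 < T" "\<And>x. norm (flow h x T) \<le> norm x / 2"
    using field_at_infinity_contraction[OF stab] by blast
  then obtain V c K a where V: "euler_lyapunov h V c K a 0"
    using contraction_imp_euler_lyapunov[OF field_at_infinity_lipschitz h0] by blast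
  then have "0 < c / (2 * K)" by (simp add: euler_lyapunov_def)
  from field_at_infinity_close[OF h0 this] obtain C
    where "0 \<le> C" "\<And>x. norm (f x - h x) \<le> c / (2 * K) * norm x + C" by blast
  from euler_lyapunov_perturb[OF V this(2,1)] show ?thesis by blast
qed

end

text \<open>After z is translated to 0, V supplies the far estimate and VA, the function of the
  linearization, the near one. V leaves an offset and VA works near z only; the contraction that
  both imply yields a new function, global and without offset.\<close>

lemma globally_stable_euler_lyapunov:
  fixes f A :: "'a::euclidean_space \<Rightarrow> 'a"
  assumes lip: "L-lipschitz_on UNIV f" and gas: "globally_asymptotically_stable f z"
    and inf: "euler_lyapunov f V c K a C"
    and A: "euler_lyapunov A VA cA KA aA 0" and der: "(f has_derivative A) (at z)"
  shows "\<exists>V c K a. euler_lyapunov (\<lambda>x. f (x + z)) V c K a 0"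
proof -
  define g where "g x = f (x + z)" for x
  have fz: "f z = 0" using gas by (auto simp: globally_asymptotically_stable_def lyapunov_stable_def)
  then have g0: "g 0 = 0" by (simp add: g_def)
  have lipg: "L-lipschitz_on UNIV g"
  proof (rule lipschitz_onI)
    fix x y show "dist (g x) (g y) \<le> L * dist x y"
      using lipschitz_onD[OF lip, of "x + z" "y + z"] by (simp add: g_def)
  qed (rule lipschitz_on_nonneg[OF lip])
  have sol: "ode_solution f (\<lambda>t. u t + z)" if "ode_solution g u" for u
    using that unfolding ode_solution_def g_def by (auto intro!: derivative_eq_intros)
  have gasg: "globally_asymptotically_stable g 0"
    unfolding globally_asymptotically_stable_def lyapunov_stable_def
  proof (intro conjI allI impI)
    fix e :: real assume "0 < e"
    then obtain d where "0 < d" "\<And>u t. ode_solution f u \<Longrightarrow> norm (u 0 - z) < d \<Longrightarrow> 0 \<le> t \<Longrightarrow> norm (u t - z) < e"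
      using gas unfolding globally_asymptotically_stable_def lyapunov_stable_def by metis
    from this(1) this(2)[OF sol]
    show "\<exists>d>0. \<forall>u. ode_solution g u \<and> norm (u 0 - 0) < d \<longrightarrow> (\<forall>t\<ge>0. norm (u t - 0) < e)"
      by (intro exI[of _ d]) auto
  next
    fix u assume "ode_solution g u"
    then have "((\<lambda>t. u t + z) \<longlongrightarrow> z) at_top"
      using gas sol unfolding globally_asymptotically_stable_def by blast
    from tendsto_diff[OF this tendsto_const[of z]] show "(u \<longlongrightarrow> 0) at_top" by simp
  qed (rule g0)
  have "\<exists>D\<ge>0. (C + L * norm z = 0 \<longrightarrow> D = 0) \<and>
      (\<forall>\<eta>>0. \<exists>T. \<forall>t\<ge>T. \<forall>x\<in>UNIV. norm (flow g x t) \<le> \<eta> * norm x + D)"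
    using euler_lyapunov_shift[OF inf lip, of z] unfolding g_def[symmetric] euler_lyapunov_def
    by (intro flow_decay[OF lipg g0, of c K a _ V]) auto
  then obtain D where far: "\<And>\<eta>. 0 < \<eta> \<Longrightarrow> \<exists>T. \<forall>t\<ge>T. \<forall>x. norm (flow g x t) \<le> \<eta> * norm x + D"
    by auto
  have pos: "0 < cA" "0 < KA" "0 < aA" "aA * cA < 1" using A by (auto simp: euler_lyapunov_def)
  have VA: "norm x \<le> VA x" "VA x \<le> KA * norm x" for x using A by (auto simp: euler_lyapunov_def)
  \<comment> \<open>Multiplied by the gain KA, the linearization error costs half of the rate
    cA.\<close>
  define \<epsilon> where "\<epsilon> = cA / (2 * KA)"
  have "0 < \<epsilon>" using pos by (simp add: \<epsilon>_def)
  then obtain r where r: "0 < r" "\<And>y. norm (y - z) < r \<Longrightarrow> norm (f y - f z - A (y - z)) \<le> \<epsilon> * norm (y - z)"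
    using der unfolding has_derivative_at_alt by metis
  have close: "norm (g x - A x) \<le> \<epsilon> * norm x" if "norm x < r" for x
    using r(2)[of "x + z"] that by (simp add: g_def fz)
  \<comment> \<open>A sublevel set of VA, unlike a ball, is preserved by steps that do not increase
    VA, and on it g is close to A.\<close>
  define S where "S = {x. VA x < r}"
  have "\<exists>D\<ge>0. (0 = (0::real) \<longrightarrow> D = 0) \<and> (\<forall>\<eta>>0. \<exists>T. \<forall>t\<ge>T. \<forall>x\<in>S. norm (flow g x t) \<le> \<eta> * norm x + D)"
  proof (rule flow_decay[OF lipg g0, of "cA / 2" KA aA 0 VA])
    fix x s and e :: 'a assume x: "x \<in> S" and s: "s \<in> {0<..aA}"
    have "norm x < r" using x VA(1)[of x] by (simp add: S_def)
    then have "norm (g x - A x) \<le> \<epsilon> * VA x"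
      using close[of x] mult_left_mono[OF VA(1)[of x], of \<epsilon>] \<open>0 < \<epsilon>\<close> by linarith
    then have ge: "norm (g x - A x + e) \<le> \<epsilon> * VA x + norm e" by (intro norm_triangle_le) auto
    have "VA (x + s *\<^sub>R (A x + (g x - A x + e))) \<le> (1 - cA * s) * VA x + KA * s * (0 + norm (g x - A x + e))"
      using A s unfolding euler_lyapunov_def by blast
    also have "\<dots> \<le> (1 - cA * s) * VA x + KA * s * (\<epsilon> * VA x + norm e)"
      using ge pos s by (intro add_left_mono mult_left_mono) auto
    also have "\<dots> = (1 - cA / 2 * s) * VA x + KA * s * (0 + norm e)"
      using pos by (simp add: \<epsilon>_def field_simps)
    finally show "VA (x + s *\<^sub>R (g x + e)) \<le> (1 - cA / 2 * s) * VA x + KA * s * (0 + norm e)"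
      by (simp add: algebra_simps)
  next
    fix x y s assume x: "x \<in> S" and s: "s \<in> {0<..aA}"
      and y: "VA y \<le> (1 - cA / 2 / 2 * s) * VA x + KA * s * 0"
    have "(1 - cA / 2 / 2 * s) * VA x \<le> 1 * VA x"
      using s pos order.trans[OF norm_ge_zero VA(1)] by (intro mult_right_mono) auto
    then show "y \<in> S" using y x by (simp add: S_def)
  next
    show "aA * (cA / 2) < 1" using pos mult_pos_pos[of aA cA] by simp
  qed (use pos VA in auto)
  then have near: "\<And>\<eta>. 0 < \<eta> \<Longrightarrow> \<exists>T. \<forall>t\<ge>T. \<forall>x\<in>S. norm (flow g x t) \<le> \<eta> * norm x" by auto
  have sub: "cball 0 (r / (2 * KA)) \<subseteq> S"
  proof
    fix x :: 'a assume "x \<in> cball 0 (r / (2 * KA))"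
    then have "KA * norm x \<le> r / 2" using pos by (simp add: field_simps)
    then show "x \<in> S" using VA(2)[of x] r by (simp add: S_def)
  qed
  have "\<exists>T>0. \<forall>x. norm (flow g x T) \<le> norm x / 2"
  proof (rule global_contraction[OF lipg gasg _ _ far])
    show "0 < r / (2 * KA)" using r pos by simp
    show "\<exists>T. \<forall>t\<ge>T. \<forall>x\<in>cball 0 (r / (2 * KA)). norm (flow g x t) \<le> \<eta> * norm x" if "0 < \<eta>" for \<eta>
      using near[OF that] sub by blast
  qed
  then obtain T where "0 < T" "\<And>x. norm (flow g x T) \<le> norm x / 2" by blast
  from contraction_imp_euler_lyapunov[OF lipg g0 this] show ?thesis by (simp add: g_def[abs_def])
qed

section \<open>Hurwitz matrices\<close>

text \<open>Once the forcing w is below a e / 2, Young's inequality spends half of the damping 2 a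
  of the squared norm on it, and Gronwall with rate - a brings the squared norm below e^2.\<close>

lemma damped_tendsto_zero:
  fixes y w :: "real \<Rightarrow> 'a::real_inner"
  assumes der: "\<And>t. 0 \<le> t \<Longrightarrow> (y has_vector_derivative y' t) (at t within {0..})"
    and damp: "\<And>t. 0 \<le> t \<Longrightarrow> y t \<bullet> y' t \<le> - a * (norm (y t))\<^sup>2 + norm (y t) * norm (w t)"
    and a: "0 < a" and w: "(w \<longlongrightarrow> 0) at_top"
  shows "(y \<longlongrightarrow> 0) at_top"
proof (rule tendstoI)
  fix e :: real assume e: "0 < e"
  \<comment> \<open>Half of e^2 is the level towards which the squared norm relaxes; the other half
    is left for the decaying transient.\<close>
  define b where "b = e\<^sup>2 / 2"
  have "\<forall>\<^sub>F t in at_top. norm (w t) < a * e / 2"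
    using tendstoD[OF w, of "a * e / 2"] a e by simp
  then obtain s0 where s0: "\<And>t. s0 \<le> t \<Longrightarrow> norm (w t) < a * e / 2"
    unfolding eventually_at_top_linorder by blast
  define s where "s = max 0 s0"
  have s: "0 \<le> s" "s0 \<le> s" by (auto simp: s_def)
  define g where "g t = (norm (y t))\<^sup>2" for t
  have g: "g t - b \<le> (g s - b) * exp (- a * (t - s))" if t: "s \<le> t" for t
  proof (rule gronwall_derivative[OF _ _ t])
    fix r assume r: "s \<le> r"
    have "(y has_vector_derivative y' r) (at r within {s..})"
      using r s by (intro has_vector_derivative_within_subset[OF der]) auto
    then show "(g has_real_derivative 2 * (y r \<bullet> y' r)) (at r within {s..})"
      unfolding g_def by (rule norm_power2_has_real_derivative)
    have "norm (y r) * norm (w r) \<le> norm (y r) * (a * e / 2)"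
      using s0[of r] r s by (intro mult_left_mono) auto
    moreover have "2 * (norm (y r) * (a * e / 2)) \<le> a * ((norm (y r))\<^sup>2 + b)"
    proof -
      have "0 \<le> (norm (y r) - e / 2)\<^sup>2 + e\<^sup>2 / 4" by simp
      then have "norm (y r) * e \<le> (norm (y r))\<^sup>2 + b"
        by (simp add: b_def power2_eq_square algebra_simps)
      then have "a * (norm (y r) * e) \<le> a * ((norm (y r))\<^sup>2 + b)"
        using a by (intro mult_left_mono) auto
      then show ?thesis by (simp add: algebra_simps)
    qed
    moreover have "y r \<bullet> y' r \<le> - a * (norm (y r))\<^sup>2 + norm (y r) * norm (w r)"
      using damp r s by auto
    ultimately show "2 * (y r \<bullet> y' r) \<le> - a * (g r - b)"
      unfolding g_def by (simp add: algebra_simps)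
  qed
  have "((\<lambda>t. (g s - b) * exp (- a * (t - s))) \<longlongrightarrow> 0) at_top"
    using a by real_asymp
  then have "\<forall>\<^sub>F t in at_top. (g s - b) * exp (- a * (t - s)) < b"
    using e by (intro order_tendstoD(2)) (auto simp: b_def)
  then show "\<forall>\<^sub>F t in at_top. dist (y t) 0 < e"
    using eventually_ge_at_top[of s]
  proof eventually_elim
    case (elim t)
    then have "(norm (y t))\<^sup>2 < e\<^sup>2" using g[of t] by (simp add: g_def b_def)
    then show ?case using e by (simp add: power_less_imp_less_base)
  qed
qed

section \<open>Polynomials p(M) applied to a vector, and linear equations with constant
  coefficients\<close>

definition matrix_poly :: "complex^'d^'d \<Rightarrow> complex poly \<Rightarrow> complex^'d \<Rightarrow> complex^'d" where
  "matrix_poly M p v = (\<Sum>i\<le>degree p. coeff p i *s ((*v) M ^^ i) v)"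

text \<open>A common range of summation, so that polynomials of different degrees can be
  added.\<close>

lemma matrix_poly_upto: "degree p \<le> n \<Longrightarrow> matrix_poly M p v = (\<Sum>i\<le>n. coeff p i *s ((*v) M ^^ i) v)"
  unfolding matrix_poly_def by (rule sum.mono_neutral_left) (auto simp: coeff_eq_0)

lemma matrix_poly_add: "matrix_poly M (p + q) v = matrix_poly M p v + matrix_poly M q v"
  using matrix_poly_upto[of p "max (degree p) (degree q)" M v] matrix_poly_upto[of q "max (degree p) (degree q)" M v]
    matrix_poly_upto[of "p + q" "max (degree p) (degree q)" M v]
  by (simp add: degree_add_le_max vec.scale_left_distrib sum.distrib)

lemma matrix_poly_smult: "matrix_poly M (smult c p) v = c *s matrix_poly M p v"
  using matrix_poly_upto[of "smult c p" "degree p" M v]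
  by (simp add: matrix_poly_def vec.scale_sum_right vector_smult_assoc)

lemma matrix_poly_pCons: "matrix_poly M (pCons a p) v = a *s v + matrix_poly M p (M *v v)"
  using matrix_poly_upto[of "pCons a p" "Suc (degree p)" M v]
  by (simp add: matrix_poly_def degree_pCons_le sum.atMost_Suc_shift funpow_Suc_right del: funpow.simps(2) sum.atMost_Suc)

lemma matrix_poly_diff_right: "matrix_poly M p (u - v) = matrix_poly M p u - matrix_poly M p v"
proof -
  have "((*v) M ^^ i) (u - v) = ((*v) M ^^ i) u - ((*v) M ^^ i) v" for i
    by (induction i) (auto simp: matrix_vector_mult_diff_distrib)
  then show ?thesis by (simp add: matrix_poly_def vec.scale_right_diff_distrib sum_subtractf)
qed

lemma matrix_poly_scale_right: "matrix_poly M p (c *s v) = c *s matrix_poly M p v"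
proof -
  have "((*v) M ^^ i) (c *s v) = c *s ((*v) M ^^ i) v" for i
    by (induction i) (auto simp: vector_scalar_commute)
  then show ?thesis by (simp add: matrix_poly_def vec.scale_sum_right vector_smult_assoc mult.commute)
qed

text \<open>Powers of M commute, so a root of a polynomial can be split off and its factor M - l
  applied to the vector first.\<close>

lemma matrix_poly_linear_factor:
  "matrix_poly M ([:- l, 1:] * q) v = matrix_poly M q (M *v v - l *s v)"
proof -
  have "[:- l, 1:] * q = smult (- l) q + pCons 0 q" by simp
  then show ?thesis
    by (simp only: matrix_poly_add matrix_poly_smult matrix_poly_pCons matrix_poly_diff_right matrix_poly_scale_right)
       (simp add: vec.scale_minus_left)
qed

lemma matrix_poly_monom: "matrix_poly M (monom c n) v = c *s ((*v) M ^^ n) v"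
  using matrix_poly_upto[OF degree_monom_le[of c n], of M v] by (simp add: if_distrib[of "\<lambda>x. x *s _"] cong: if_cong)

lemma scaleR_eq_of_real_scale: "r *\<^sub>R v = complex_of_real r *s v"
  by (simp add: vec_eq_iff scaleR_conv_of_real[where 'a = complex])

text \<open>The vectors v, M v, M^2 v, ... cannot stay independent in finite dimension. Dependence
  is taken over the reals, so one more vector than the real dimension is listed; a repetition among
  them, which would make the set smaller than the index range, is a dependence by itself.\<close>

lemma annihilating_poly_exists:
  fixes M :: "complex^'d^'d"
  shows "\<exists>p. p \<noteq> 0 \<and> matrix_poly M p v = 0"
proof -
  define x where "x i = ((*v) M ^^ i) v" for i
  show ?thesis
  proof (cases "inj_on x {..DIM(complex^'d)}")
    case False
    then obtain i j where ij: "x i = x j" "i \<noteq> j" by (auto simp: inj_on_def)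
    have "coeff (monom 1 i + smult (-1) (monom 1 j)) i = (1::complex)" using ij by simp
    then have "monom 1 i + smult (-1) (monom 1 j) \<noteq> (0 :: complex poly)" by (metis coeff_0 zero_neq_one)
    moreover have "matrix_poly M (monom 1 i + smult (-1) (monom 1 j)) v = 0"
      using ij by (simp only: matrix_poly_add matrix_poly_smult matrix_poly_monom flip: x_def) (simp add: vec.scale_minus_left)
    ultimately show ?thesis by blast
  next
    case True
    let ?n = "DIM(complex^'d)"
    have "dependent (x ` {..?n})"
      by (rule dependent_biggerset) (use card_image[OF True] in simp)
    then obtain u b where u: "b \<in> x ` {..?n}" "u b \<noteq> 0" "(\<Sum>b\<in>x ` {..?n}. u b *\<^sub>R b) = 0"
      by (subst (asm) dependent_finite) auto
    define p where "p = (\<Sum>i\<le>?n. monom (complex_of_real (u (x i))) i)"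
    obtain j where j: "j \<le> ?n" "b = x j" using u(1) by auto
    have "coeff p j = complex_of_real (u (x j))" using j by (simp add: p_def coeff_sum)
    then have "p \<noteq> 0" using u(2) j(2) by auto
    moreover have "matrix_poly M (sum f A) v = (\<Sum>i\<in>A. matrix_poly M (f i) v)" for f and A :: "nat set"
    proof -
      have "matrix_poly M 0 v = 0" by (simp add: matrix_poly_def)
      then show ?thesis by (induction A rule: infinite_finite_induct) (auto simp: matrix_poly_add)
    qed
    then have "matrix_poly M p v = (\<Sum>i\<le>?n. u (x i) *\<^sub>R x i)"
      by (simp add: p_def matrix_poly_monom scaleR_eq_of_real_scale x_def)
    then have "matrix_poly M p v = 0" using u(3) unfolding sum.reindex[OF True] by simp
    ultimately show ?thesis by blast
  qed
qed

text \<open>The product of the commuting factors M - l over the list, applied to v. The induction on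
  solutions consumes one factor per step.\<close>

primrec shifted_prod :: "complex^'d^'d \<Rightarrow> complex list \<Rightarrow> complex^'d \<Rightarrow> complex^'d" where
  "shifted_prod M [] v = v"
| "shifted_prod M (l # ls) v = shifted_prod M ls (M *v v - l *s v)"

text \<open>The fundamental theorem of algebra splits an annihilating polynomial into linear
  factors; a nonzero constant annihilates v only if v = 0. This takes the place of a Jordan
  form.\<close>

lemma annihilating_shifted_prod_exists: "\<exists>ls. shifted_prod M ls v = 0"
proof -
  have "\<exists>ls. shifted_prod M ls v = 0" if "p \<noteq> 0" "matrix_poly M p v = 0" for p v
    using that
  proof (induction "degree p" arbitrary: p v)
    case 0
    then obtain c where "p = [:c:]" "c \<noteq> 0" by (metis degree_eq_zeroE pCons_0_0)
    then have "v = 0" using 0(3) by (simp add: matrix_poly_def)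
    then show ?case by (intro exI[of _ "[]"]) simp
  next
    case (Suc n)
    then have "\<not> constant (poly p)" by (simp add: constant_degree)
    then obtain l where "poly p l = 0" using fundamental_theorem_of_algebra by blast
    then obtain q where q: "p = [:- l, 1:] * q" by (auto simp: poly_eq_0_iff_dvd dvd_def)
    then have q0: "q \<noteq> 0" using Suc(3) by auto
    have "degree p = Suc (degree q)" using q0 unfolding q by (subst degree_mult_eq) auto
    then have "n = degree q" using Suc(2) by simp
    moreover have "matrix_poly M q (M *v v - l *s v) = 0"
      using Suc(4) unfolding q matrix_poly_linear_factor .
    ultimately obtain ls where "shifted_prod M ls (M *v v - l *s v) = 0"
      using Suc(1) q0 by blast
    then show ?case by (intro exI[of _ "l # ls"]) simp
  qed
  then show ?thesis using annihilating_poly_exists by blast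
qed

lemma bounded_linear_lipschitz_on:
  assumes "bounded_linear f"
  shows "\<exists>L. L-lipschitz_on UNIV f"
  by (rule bounded_linear.lipschitz_boundE[OF assms]) blast

text \<open>Induction on a list that annihilates the initial value. For w = (M - l) y the same
  equation holds and the shorter list annihilates the initial value, so w tends to 0, while y' = l y
  + w.\<close>

lemma complex_linear_ode_tendsto_zero:
  fixes M :: "complex^'d^'d"
  assumes hur: "\<And>l v. v \<noteq> 0 \<Longrightarrow> M *v v = l *s v \<Longrightarrow> Re l < 0"
    and y: "ode_solution ((*v) M) y"
  shows "(y \<longlongrightarrow> 0) at_top"
proof -
  obtain L where L: "L-lipschitz_on UNIV ((*v) M)"
    using bounded_linear_lipschitz_on[OF matrix_vector_mul_bounded_linear] by blast
  have "(y \<longlongrightarrow> 0) at_top" if "ode_solution ((*v) M) y" "shifted_prod M ls (y 0) = 0" for ls y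
    using that
  proof (induction ls arbitrary: y)
    case Nil
    have "\<forall>\<^sub>F t in at_top. y t = 0"
      using eventually_ge_at_top[of 0]
    proof eventually_elim
      case (elim t)
      then show ?case
        using ode_solution_eq_flow[OF L Nil(1), of t] Nil(2) flow_zero[OF L, of t] by simp
    qed
    then show ?case by (rule tendsto_eventually)
  next
    case (Cons l ls)
    define T where "T v = M *v v - l *s v" for v
    have linT: "linear T"
      unfolding T_def by (intro linear_compose_sub matrix_vector_mul_linear)
        (auto intro!: linearI simp: vector_add_ldistrib vec_eq_iff)
    then have blT: "bounded_linear T" by (simp add: linear_conv_bounded_linear)
    have TM: "T (M *v v) = M *v T v" for v
      by (simp add: T_def matrix_vector_mult_diff_distrib vector_scalar_commute)
    have "ode_solution ((*v) M) (\<lambda>t. T (y t))"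
      using Cons.prems(1) unfolding ode_solution_def TM[symmetric]
      by (auto intro: bounded_linear.has_vector_derivative[OF blT])
    moreover have "shifted_prod M ls (T (y 0)) = 0" using Cons.prems(2) by (simp add: T_def)
    ultimately have w: "((\<lambda>t. T (y t)) \<longlongrightarrow> 0) at_top" by (rule Cons.IH)
    show ?case
    \<comment> \<open>The members of the list need not be eigenvalues. If Re l \<ge> 0, then l is
      none by hypothesis, so M - l is injective and y is bounded by a multiple of w; otherwise w is
      a vanishing forcing of a damped equation.\<close>
    proof (cases "Re l < 0")
      case True
      show ?thesis
      proof (rule damped_tendsto_zero[where a = "- Re l", OF _ _ _ w])
        fix t :: real assume t: "0 \<le> t"
        show "(y has_vector_derivative M *v y t) (at t within {0..})"
          using Cons.prems(1) t by (simp add: ode_solution_def)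
        have "y t \<bullet> (l *s y t) = Re l * (norm (y t))\<^sup>2"
        proof -
          have "z \<bullet> (l * z) = Re l * (z \<bullet> z)" for z :: complex
            by (simp add: inner_complex_def algebra_simps)
          then show ?thesis
            by (simp add: power2_norm_eq_inner inner_vec_def sum_distrib_left)
        qed
        moreover have "M *v y t = l *s y t + T (y t)" by (simp add: T_def)
        moreover have "y t \<bullet> T (y t) \<le> norm (y t) * norm (T (y t))" by (rule norm_cauchy_schwarz)
        ultimately show "y t \<bullet> (M *v y t) \<le> - (- Re l) * (norm (y t))\<^sup>2 + norm (y t) * norm (T (y t))"
          by (simp add: inner_add_right)
      qed (use True in simp)
    next
      case False
      have "inj T"
        unfolding linear_injective_0[OF linT]
        using hur[of _ l] False by (auto simp: T_def)
      then obtain B where B: "0 < B" "\<And>v. B * norm v \<le> norm (T v)"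
        using linear_inj_bounded_below_pos[OF linT] by blast
      have "((\<lambda>t. norm (T (y t)) / B) \<longlongrightarrow> 0) at_top"
        using tendsto_divide[OF tendsto_norm[OF w] tendsto_const[of B]] B by simp
      then show ?thesis
        by (rule Lim_null_comparison[rotated]) (use B in \<open>auto simp: field_simps\<close>)
    qed
  qed
  then show ?thesis using annihilating_shifted_prod_exists y by blast
qed

text \<open>The embedding into complex space intertwines the two equations and is isometric, so
  convergence there is convergence here.\<close>

lemma hurwitz_ode_tendsto_zero:
  fixes A :: "real^'d^'d"
  assumes hur: "hurwitz A" and u: "ode_solution ((*v) A) u"
  shows "(u \<longlongrightarrow> 0) at_top"
proof -
  define M :: "complex^'d^'d" where "M = (\<chi> i j. complex_of_real (A $ i $ j))"
  define cv :: "real^'d \<Rightarrow> complex^'d" where "cv v = (\<chi> i. complex_of_real (v $ i))" for v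
  have "linear cv" by (auto intro!: linearI simp: cv_def vec_eq_iff scaleR_conv_of_real[where 'a = complex])
  then have bl: "bounded_linear cv" by (simp add: linear_conv_bounded_linear)
  have cvA: "cv (A *v v) = M *v cv v" for v
    by (simp add: cv_def M_def matrix_vector_mult_def vec_eq_iff)
  have "ode_solution ((*v) M) (\<lambda>t. cv (u t))"
    using u unfolding ode_solution_def cvA[symmetric]
    by (auto intro: bounded_linear.has_vector_derivative[OF bl])
  then have lim: "((\<lambda>t. cv (u t)) \<longlongrightarrow> 0) at_top"
    using hur unfolding hurwitz_def by (intro complex_linear_ode_tendsto_zero) (auto simp: M_def)
  have "norm (cv v) = norm v" for v by (simp add: cv_def norm_vec_def)
  then show ?thesis using tendsto_norm_zero[OF lim] by (simp add: tendsto_norm_zero_iff)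
qed

text \<open>By superposition every solution is a combination of the finitely many solutions that
  start at basis vectors, so pointwise convergence becomes uniform on bounded sets.\<close>

lemma linear_flow_contraction:
  fixes f :: "'a::euclidean_space \<Rightarrow> 'a"
  assumes lin: "linear f" and lip: "L-lipschitz_on UNIV f"
    and lim: "\<And>x. (flow f x \<longlongrightarrow> 0) at_top"
  shows "\<exists>T>0. \<forall>x. norm (flow f x T) \<le> norm x / 2"
proof -
  have "((\<lambda>t. \<Sum>b\<in>Basis. norm (flow f b t)) \<longlongrightarrow> (\<Sum>b\<in>(Basis::'a set). 0)) at_top"
    by (intro tendsto_sum tendsto_norm_zero lim)
  then have "\<forall>\<^sub>F t in at_top. (\<Sum>b\<in>Basis. norm (flow f b t)) < 1 / 2"
    by (intro order_tendstoD(2)) auto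
  then have "\<forall>\<^sub>F t in at_top. (\<Sum>b\<in>Basis. norm (flow f b t)) < 1 / 2 \<and> 0 < t"
    using eventually_gt_at_top[of 0] by (rule eventually_conj)
  then obtain T where T: "(\<Sum>b\<in>Basis. norm (flow f b T)) < 1 / 2" "0 < T"
    using eventually_happens'[OF trivial_limit_at_top_linorder] by blast
  have "norm (flow f x T) \<le> norm x / 2" for x
  proof -
    define u where "u t = (\<Sum>b\<in>Basis. (x \<bullet> b) *\<^sub>R flow f b t)" for t
    have "ode_solution f u"
      using flow_solution[OF lip] unfolding ode_solution_def u_def
      by (auto intro!: has_vector_derivative_sum derivative_eq_intros
          simp: linear_sum[OF lin] linear_scale[OF lin])
    moreover have "u 0 = x" by (simp add: u_def flow_0[OF lip] euclidean_representation)
    ultimately have "flow f x T = u T" using ode_solution_eq_flow[OF lip, of u T] T by simp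
    also have "norm (u T) \<le> (\<Sum>b\<in>Basis. norm x * norm (flow f b T))"
      unfolding u_def by (intro sum_norm_le) (auto intro!: mult_right_mono simp: Basis_le_norm)
    also have "\<dots> = norm x * (\<Sum>b\<in>Basis. norm (flow f b T))" by (simp add: sum_distrib_left)
    also have "\<dots> \<le> norm x * (1 / 2)" using T by (intro mult_left_mono) auto
    finally show ?thesis by simp
  qed
  then show ?thesis using T by blast
qed

lemma hurwitz_euler_lyapunov:
  fixes A :: "real^'d^'d"
  assumes "hurwitz A"
  shows "\<exists>V c K a. euler_lyapunov ((*v) A) V c K a 0"
proof -
  obtain L where L: "L-lipschitz_on UNIV ((*v) A)"
    using bounded_linear_lipschitz_on[OF matrix_vector_mul_bounded_linear] by blast
  obtain T where "0 < T" "\<And>x. norm (flow ((*v) A) x T) \<le> norm x / 2"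
    using linear_flow_contraction[OF matrix_vector_mul_linear L]
      hurwitz_ode_tendsto_zero[OF assms flow_solution[OF L]] by blast
  then show ?thesis by (intro contraction_imp_euler_lyapunov[OF L]) auto
qed

section \<open>Uniqueness for the Lyapunov equation\<close>

lemma hurwitz_transpose:
  fixes A :: "real^'d^'d"
  assumes "hurwitz A"
  shows "hurwitz (transpose A)"
  unfolding hurwitz_def
proof (intro allI impI, elim conjE)
  fix l and v :: "complex^'d"
  define M :: "complex^'d^'d" where "M = (\<chi> i j. complex_of_real (A $ i $ j))"
  have sub: "(B - mat l) *v w = B *v w - l *s w" for B :: "complex^'d^'d" and w
    by (simp add: vec_eq_iff matrix_vector_mult_def mat_def left_diff_distrib sum_subtractf
        if_distrib[of "\<lambda>x. x * _"] cong: if_cong)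
  assume v: "v \<noteq> 0" "(\<chi> i j. complex_of_real (transpose A $ i $ j)) *v v = l *s v"
  have tr: "(\<chi> i j. complex_of_real (transpose A $ i $ j)) = transpose M"
    by (simp add: M_def transpose_def vec_eq_iff)
  have "(transpose M - mat l) *v v = 0" using v(2) unfolding tr sub by simp
  \<comment> \<open>Eigenvectors do not pass to the transpose, but singularity of M - l does,
    through the determinant.\<close>
  then have "\<not> invertible (transpose M - mat l)"
    using v(1) by (auto simp: invertible_left_inverse matrix_left_invertible_ker)
  moreover have "transpose M - mat l = transpose (M - mat l)"
    by (simp add: transpose_def mat_def vec_eq_iff)
  ultimately have "\<not> invertible (M - mat l)" by (simp add: invertible_det_nz)
  then obtain w where "w \<noteq> 0" "(M - mat l) *v w = 0"
    by (auto simp: invertible_left_inverse matrix_left_invertible_ker)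
  then show "Re l < 0" using assms unfolding hurwitz_def M_def[symmetric] sub by auto
qed

text \<open>Along solutions of u' = \<open>transpose A\<close> u the form u \<bullet> Z u has
  derivative u \<bullet> (A Z + Z \<open>transpose A\<close>) u = 0, yet u tends to 0. So the form
  vanishes identically, and a symmetric Z with vanishing form is 0.\<close>

lemma homogeneous_lyapunov_equation:
  fixes A Z :: "real^'d^'d"
  assumes hur: "hurwitz A" and Z: "transpose Z = Z" and eq: "A ** Z + Z ** transpose A = 0"
  shows "Z = 0"
proof -
  obtain L where L: "L-lipschitz_on UNIV ((*v) (transpose A))"
    using bounded_linear_lipschitz_on[OF matrix_vector_mul_bounded_linear] by blast
  have zero: "x \<bullet> (Z *v x) = 0" for x
  proof -
    define u where "u = flow ((*v) (transpose A)) x"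
    have u: "ode_solution ((*v) (transpose A)) u" "u 0 = x"
      by (auto simp: u_def flow_solution[OF L] flow_0[OF L])
    define q where "q t = u t \<bullet> (Z *v u t)" for t
    have q': "(q has_real_derivative 0) (at t within {0..})" if t: "0 \<le> t" for t
    proof -
      have du: "(u has_vector_derivative transpose A *v u t) (at t within {0..})"
        using u t by (simp add: ode_solution_def)
      have "(q has_vector_derivative u t \<bullet> (Z *v (transpose A *v u t)) + (transpose A *v u t) \<bullet> (Z *v u t)) (at t within {0..})"
        unfolding q_def
        by (intro bounded_bilinear.has_vector_derivative[OF bounded_bilinear_inner] du
            bounded_linear.has_vector_derivative[OF matrix_vector_mul_bounded_linear])
      moreover have "(transpose A *v u t) \<bullet> (Z *v u t) = u t \<bullet> (A *v (Z *v u t))"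
        by (metis dot_lmul_matrix transpose_matrix_vector inner_commute vector_transpose_matrix transpose_transpose)
      moreover have "u t \<bullet> (Z *v (transpose A *v u t)) + u t \<bullet> (A *v (Z *v u t)) = u t \<bullet> ((A ** Z + Z ** transpose A) *v u t)"
        by (simp only: matrix_vector_mult_add_rdistrib inner_add_right matrix_vector_mul_assoc add.commute)
      ultimately show ?thesis by (simp add: eq has_real_derivative_iff_has_vector_derivative)
    qed
    have qc: "q t = q 0" if t: "0 \<le> t" for t
    proof -
      \<comment> \<open>Gronwall with rate 0, for q and for - q, makes q constant.\<close>
      have "q t - 0 \<le> (q 0 - 0) * exp (0 * (t - 0))"
        by (rule gronwall_derivative[OF q' _ t]) auto
      moreover have "- q t - 0 \<le> (- q 0 - 0) * exp (0 * (t - 0))"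
        by (rule gronwall_derivative[OF _ _ t, of "\<lambda>t. - q t" "\<lambda>_. 0"])
           (use q' in \<open>auto intro!: derivative_eq_intros\<close>)
      ultimately show ?thesis by simp
    qed
    have u0: "(u \<longlongrightarrow> 0) at_top" by (rule hurwitz_ode_tendsto_zero[OF hurwitz_transpose[OF hur] u(1)])
    have "(q \<longlongrightarrow> 0 \<bullet> (Z *v 0)) at_top"
      unfolding q_def
      by (intro tendsto_inner u0 bounded_linear.tendsto[OF matrix_vector_mul_bounded_linear])
    moreover have "(q \<longlongrightarrow> q 0) at_top"
      by (rule tendsto_eventually, rule eventually_mono[OF eventually_ge_at_top[of 0]]) (rule qc)
    ultimately have "q 0 = 0" using tendsto_unique[OF trivial_limit_at_top_linorder] by fastforce
    then show ?thesis by (simp add: q_def u)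
  qed
  have "Z *v y = 0" for y
  proof -
    \<comment> \<open>Polarization: for this x the mixed term is the squared norm of Z y.\<close>
    define x where "x = Z *v y"
    have "x \<bullet> (Z *v y) = y \<bullet> (Z *v x)"
      by (metis Z dot_lmul_matrix transpose_matrix_vector inner_commute)
    moreover have "(x + y) \<bullet> (Z *v (x + y)) = x \<bullet> (Z *v x) + x \<bullet> (Z *v y) + y \<bullet> (Z *v x) + y \<bullet> (Z *v y)"
      by (simp add: matrix_vector_right_distrib inner_add_left inner_add_right)
    ultimately have "x \<bullet> x = 0" using zero[of x] zero[of y] zero[of "x + y"] by (simp add: x_def)
    then show ?thesis by (simp add: x_def)
  qed
  then show ?thesis by (simp add: matrix_eq)
qed

section \<open>Moment bounds\<close>

text \<open>The drift bound is the convex combination of V x and w = K / c (C + norm e) with weights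
  1 - c s and c s, so squaring keeps both weights.\<close>

lemma euler_lyapunov_square:
  fixes f :: "'a::real_normed_vector \<Rightarrow> 'a"
  assumes V: "euler_lyapunov f V c K a C" and s: "s \<in> {0<..a}"
  shows "(V (x + s *\<^sub>R (f x + e)))\<^sup>2 \<le> (1 - c * s) * (V x)\<^sup>2 + c * s * (K / c * (C + norm e))\<^sup>2"
proof -
  have pos: "0 < c" "0 < K" "0 \<le> C" using V by (auto simp: euler_lyapunov_def)
  define w where "w = K / c * (C + norm e)"
  have cs: "0 < c * s" "c * s < 1"
  proof -
    have "c * s \<le> a * c" using s pos by (simp add: mult.commute mult_left_mono)
    moreover have "a * c < 1" using V by (auto simp: euler_lyapunov_def)
    ultimately show "c * s < 1" by linarith
  qed (use s pos in auto)
  have "V (x + s *\<^sub>R (f x + e)) \<le> (1 - c * s) * V x + K * s * (C + norm e)"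
    using V s unfolding euler_lyapunov_def by blast
  also have "K * s * (C + norm e) = c * s * w" using pos by (simp add: w_def)
  finally have "V (x + s *\<^sub>R (f x + e)) \<le> (1 - c * s) * V x + c * s * w" .
  moreover have "0 \<le> V (x + s *\<^sub>R (f x + e))"
    using V by (auto simp: euler_lyapunov_def intro: order.trans[OF norm_ge_zero])
  ultimately have "(V (x + s *\<^sub>R (f x + e)))\<^sup>2 \<le> ((1 - c * s) * V x + c * s * w)\<^sup>2"
    by (rule power_mono)
  also have "\<dots> = (1 - c * s) * (V x)\<^sup>2 + c * s * w\<^sup>2 - (1 - c * s) * (c * s) * (V x - w)\<^sup>2"
    by (simp add: power2_eq_square algebra_simps)
  also have "\<dots> \<le> (1 - c * s) * (V x)\<^sup>2 + c * s * w\<^sup>2" using cs by simp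
  finally show ?thesis by (simp add: w_def)
qed

lemma square_sum_le: "((x::real) + y)\<^sup>2 \<le> 2 * x\<^sup>2 + 2 * y\<^sup>2"
  using zero_le_power2[of "x - y"] by (simp add: power2_eq_square algebra_simps)

lemma integrable_dominated_square:
  fixes g :: "'w \<Rightarrow> real"
  assumes "integrable M h" "g \<in> borel_measurable M" "\<And>\<omega>. (g \<omega>)\<^sup>2 \<le> h \<omega>"
  shows "integrable M (\<lambda>\<omega>. (g \<omega>)\<^sup>2)"
  by (rule Bochner_Integration.integrable_bound[OF assms(1)])
     (use assms(2,3) in \<open>auto intro: order.trans[OF _ abs_ge_self]\<close>)

text \<open>The expected squares satisfy E (n + 1) \<le> (1 - c s) E n + c s B', a convex
  combination, so they never exceed E 0 + B'. Integrability is carried along in the same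
  induction.\<close>

lemma (in prob_space) euler_second_moment_bounded:
  fixes f :: "'b::euclidean_space \<Rightarrow> 'b"
  assumes V: "euler_lyapunov f V c K a C" and s: "s \<in> {0<..a}"
    and y: "\<And>n. y n \<in> borel_measurable M" and e: "\<And>n. e n \<in> borel_measurable M"
    and y0: "integrable M (\<lambda>\<omega>. (norm (y 0 \<omega>))\<^sup>2)"
    and e2: "\<And>n. integrable M (\<lambda>\<omega>. (norm (e n \<omega>))\<^sup>2)" "\<And>n. (\<integral>\<omega>. (norm (e n \<omega>))\<^sup>2 \<partial>M) \<le> B"
    and rec: "\<And>n \<omega>. y (Suc n) \<omega> = y n \<omega> + s *\<^sub>R (f (y n \<omega>) + e n \<omega>)"
  shows "\<exists>D. \<forall>n. integrable M (\<lambda>\<omega>. (norm (y n \<omega>))\<^sup>2) \<and> (\<integral>\<omega>. (norm (y n \<omega>))\<^sup>2 \<partial>M) \<le> D"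
proof -
  have pos: "0 < c" "0 < K" "0 \<le> C" and cont: "continuous_on UNIV V"
    and Vb: "norm x \<le> V x" "V x \<le> K * norm x" for x
    using V by (auto simp: euler_lyapunov_def)
  have cs: "0 < c * s" "c * s < 1"
  proof -
    have "c * s \<le> a * c" using s pos by (simp add: mult.commute mult_left_mono)
    moreover have "a * c < 1" using V by (auto simp: euler_lyapunov_def)
    ultimately show "c * s < 1" by linarith
  qed (use s pos in auto)
  have V0: "0 \<le> V x" for x using Vb(1)[of x] norm_ge_zero[of x] by linarith
  have [measurable]: "V \<in> borel_measurable borel" by (rule borel_measurable_continuous_onI[OF cont])
  note [measurable] = y e
  have VK: "(V x)\<^sup>2 \<le> K\<^sup>2 * (norm x)\<^sup>2" for x
    using power_mono[OF Vb(2) V0, of x 2] by (simp add: power_mult_distrib)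
  define p where "p n \<omega> = (K / c * (C + norm (e n \<omega>)))\<^sup>2" for n \<omega>
  have ple: "p n \<omega> \<le> (K / c)\<^sup>2 * (2 * C\<^sup>2 + 2 * (norm (e n \<omega>))\<^sup>2)" for n \<omega>
    unfolding p_def power_mult_distrib by (intro mult_left_mono square_sum_le) auto
  have pint: "integrable M (p n)" for n
    unfolding p_def
    by (rule integrable_dominated_square[OF _ _ ple[unfolded p_def]]) (auto intro!: e2)
  define B' where "B' = (K / c)\<^sup>2 * (2 * C\<^sup>2 + 2 * B)"
  have pB: "(\<integral>\<omega>. p n \<omega> \<partial>M) \<le> B'" for n
  proof -
    have "(\<integral>\<omega>. p n \<omega> \<partial>M) \<le> (\<integral>\<omega>. (K / c)\<^sup>2 * (2 * C\<^sup>2 + 2 * (norm (e n \<omega>))\<^sup>2) \<partial>M)"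
      by (intro integral_mono pint ple) (auto intro!: e2)
    also have "\<dots> = (K / c)\<^sup>2 * (2 * C\<^sup>2 + 2 * (\<integral>\<omega>. (norm (e n \<omega>))\<^sup>2 \<partial>M))"
      using e2(1)[of n] by (simp add: prob_space)
    also have "\<dots> \<le> B'" unfolding B'_def using e2(2)[of n] by (intro mult_left_mono) auto
    finally show ?thesis .
  qed
  have B0: "0 \<le> B'" using order.trans[OF _ pB[of 0]] by (simp add: p_def)
  define E where "E n = (\<integral>\<omega>. (V (y n \<omega>))\<^sup>2 \<partial>M)" for n
  have step: "(V (y (Suc n) \<omega>))\<^sup>2 \<le> (1 - c * s) * (V (y n \<omega>))\<^sup>2 + c * s * p n \<omega>" for n \<omega>
    unfolding rec p_def by (rule euler_lyapunov_square[OF V s])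
  have E0: "0 \<le> E 0" by (simp add: E_def)
  have main: "integrable M (\<lambda>\<omega>. (V (y n \<omega>))\<^sup>2) \<and> E n \<le> E 0 + B'" for n
  proof (induction n)
    case 0
    have "integrable M (\<lambda>\<omega>. (V (y 0 \<omega>))\<^sup>2)"
      by (rule integrable_dominated_square[OF _ _ VK]) (auto intro!: y0)
    then show ?case using B0 by simp
  next
    case (Suc n)
    have int: "integrable M (\<lambda>\<omega>. (1 - c * s) * (V (y n \<omega>))\<^sup>2 + c * s * p n \<omega>)"
      using Suc pint by auto
    have i: "integrable M (\<lambda>\<omega>. (V (y (Suc n) \<omega>))\<^sup>2)"
      by (rule integrable_dominated_square[OF int _ step]) auto
    have "E (Suc n) \<le> (\<integral>\<omega>. (1 - c * s) * (V (y n \<omega>))\<^sup>2 + c * s * p n \<omega> \<partial>M)"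
      unfolding E_def by (intro integral_mono i int step)
    also have "\<dots> = (1 - c * s) * E n + c * s * (\<integral>\<omega>. p n \<omega> \<partial>M)"
      using Suc pint by (simp add: E_def)
    also have "\<dots> \<le> (1 - c * s) * (E 0 + B') + c * s * B'"
      using Suc cs pB by (intro add_mono mult_left_mono) auto
    also have "\<dots> \<le> E 0 + B'" using mult_nonneg_nonneg[of "c * s" "E 0"] cs E0 by (simp add: algebra_simps)
    finally show ?case using i by blast
  qed
  have le: "(norm (y n \<omega>))\<^sup>2 \<le> (V (y n \<omega>))\<^sup>2" for n \<omega> by (intro power_mono Vb) auto
  show ?thesis
  proof (intro exI[of _ "E 0 + B'"] allI conjI)
    fix n
    show i: "integrable M (\<lambda>\<omega>. (norm (y n \<omega>))\<^sup>2)"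
      using main[of n] by (intro integrable_dominated_square[OF _ _ le]) auto
    have "(\<integral>\<omega>. (norm (y n \<omega>))\<^sup>2 \<partial>M) \<le> E n"
      unfolding E_def using main[of n] by (intro integral_mono i le) auto
    then show "(\<integral>\<omega>. (norm (y n \<omega>))\<^sup>2 \<partial>M) \<le> E 0 + B'" using main[of n] by linarith
  qed
qed

text \<open>Stationarity makes \<open>A\<close> and \<open>A'\<close> equal in law, but \<open>A\<close> is not known to be integrable, so the
  drift inequality is integrated after truncation at a level \<open>m\<close>.\<close>

lemma (in prob_space) stationary_drift_bound:
  fixes A A' B :: "'a \<Rightarrow> real"
  assumes [measurable]: "A \<in> borel_measurable M" "A' \<in> borel_measurable M"
    and law: "distr M borel A' = distr M borel A"
    and A0: "\<And>x. 0 \<le> A x" and B0: "\<And>x. 0 \<le> B x" and B: "integrable M B"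
    and drift: "\<And>x. A' x \<le> r * A x + B x" and r: "0 \<le> r" "r < 1"
  shows "integrable M A" "(\<integral>x. A x \<partial>M) \<le> (\<integral>x. B x \<partial>M) / (1 - r)"
proof -
  define I where "I = (\<integral>x. B x \<partial>M) / (1 - r)"
  have I0: "0 \<le> I" using B0 r by (simp add: I_def)
  \<comment> \<open>The cut goes to 0 above m, not to m: (1 - r) T is then below min A m - min (r A)
    m, whose integral stationarity controls.\<close>
  define T where "T m x = A x * indicator {x. A x \<le> real m} x" for m x
  have T: "integrable M (T m)" "(\<integral>x. T m x \<partial>M) \<le> I" for m
  proof -
    have Tm: "T m x = (if A x \<le> real m then A x else 0)" for x by (simp add: T_def)
    show Ti: "integrable M (T m)"
      by (rule integrable_const_bound[where B = "real m"]) (use A0 in \<open>auto simp: Tm[abs_def]\<close>)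
    have i1: "integrable M (\<lambda>x. min (A x) (real m))" "integrable M (\<lambda>x. min (r * A x) (real m))"
      by (rule integrable_const_bound[where B = "real m"]; use A0 r in auto)+
    have i2: "integrable M (\<lambda>x. min (A' x) (real m))"
    proof -
      have "integrable (distr M borel A') (\<lambda>x. min x (real m))"
        unfolding law using i1(1) by (simp add: integrable_distr_eq)
      then show ?thesis by (simp add: integrable_distr_eq)
    qed
    have "(\<integral>x. min (A x) (real m) \<partial>M) = (\<integral>x. min x (real m) \<partial>distr M borel A)"
      by (simp add: integral_distr)
    also have "\<dots> = (\<integral>x. min (A' x) (real m) \<partial>M)"
      unfolding law[symmetric] by (simp add: integral_distr)
    also have "\<dots> \<le> (\<integral>x. min (r * A x) (real m) + B x \<partial>M)"
    proof (rule integral_mono[OF i2])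
      show "integrable M (\<lambda>x. min (r * A x) (real m) + B x)" using i1 B by auto
      show "min (A' x) (real m) \<le> min (r * A x) (real m) + B x" for x
        using drift[of x] B0[of x] by linarith
    qed
    finally have "(\<integral>x. min (A x) (real m) \<partial>M) - (\<integral>x. min (r * A x) (real m) \<partial>M) \<le> (\<integral>x. B x \<partial>M)"
      using i1 B by simp
    moreover have "(\<integral>x. (1 - r) * T m x \<partial>M) \<le> (\<integral>x. min (A x) (real m) - min (r * A x) (real m) \<partial>M)"
    proof (rule integral_mono)
      show "(1 - r) * T m x \<le> min (A x) (real m) - min (r * A x) (real m)" for x
      proof -
        have "r * A x \<le> A x" using mult_right_mono[of r 1 "A x"] A0[of x] r by simp
        then show ?thesis by (auto simp: Tm algebra_simps)
      qed
    qed (use i1 Ti in auto)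
    ultimately have "(1 - r) * (\<integral>x. T m x \<partial>M) \<le> (\<integral>x. B x \<partial>M)" using i1 by simp
    then show "(\<integral>x. T m x \<partial>M) \<le> I" using r by (simp add: I_def field_simps)
  qed
  have T0: "0 \<le> T m x" for m x using A0 by (simp add: T_def indicator_def)
  have "(\<integral>\<^sup>+x. ennreal (A x) \<partial>M) = (\<integral>\<^sup>+x. (SUP m. ennreal (T m x)) \<partial>M)"
  proof (rule nn_integral_cong)
    fix x
    obtain m where "A x \<le> real m" using real_arch_simple by blast
    then have "ennreal (A x) \<le> (SUP m. ennreal (T m x))"
      by (intro SUP_upper2[of m]) (auto simp: T_def)
    moreover have "(SUP m. ennreal (T m x)) \<le> ennreal (A x)"
      using A0 by (intro SUP_least ennreal_leI) (auto simp: T_def indicator_def)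
    ultimately show "ennreal (A x) = (SUP m. ennreal (T m x))" by simp
  qed
  also have "\<dots> = (SUP m. \<integral>\<^sup>+x. ennreal (T m x) \<partial>M)"
  proof (rule nn_integral_monotone_convergence_SUP)
    show "incseq (\<lambda>m x. ennreal (T m x))"
      using A0 by (intro incseq_SucI le_funI ennreal_leI) (auto simp: T_def indicator_def)
    show "(\<lambda>x. ennreal (T m x)) \<in> borel_measurable M" for m
      using borel_measurable_integrable[OF T(1)[of m]] by measurable
  qed
  also have "\<dots> \<le> ennreal I"
    using T T0 by (intro SUP_least) (auto simp: nn_integral_eq_integral intro!: ennreal_leI)
  finally have nn: "(\<integral>\<^sup>+x. ennreal (A x) \<partial>M) \<le> ennreal I" .
  show Ai: "integrable M A"
    using nn A0 by (intro integrableI_nonneg) (auto simp: less_top[symmetric] top_unique intro: le_less_trans)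
  show "(\<integral>x. A x \<partial>M) \<le> (\<integral>x. B x \<partial>M) / (1 - r)"
    using nn I0 A0 Ai unfolding I_def[symmetric] by (simp add: nn_integral_eq_integral)
qed

section \<open>Averages of the mean field along a trajectory\<close>

lemma sum_mean_field_theta:
  assumes "\<alpha> \<noteq> 0"
  shows "(\<Sum>n<N. fbar (theta (\<lambda>\<theta> x. fbar \<theta> + F x) \<alpha> \<theta>\<^sub>0 \<phi> n))
    = (1 / \<alpha>) *\<^sub>R (theta (\<lambda>\<theta> x. fbar \<theta> + F x) \<alpha> \<theta>\<^sub>0 \<phi> N - \<theta>\<^sub>0) - (\<Sum>n<N. F (\<phi> (Suc n)))"
  by (induction N) (use assms in \<open>auto simp: algebra_simps\<close>)

lemma (in prob_space) beta_second_moment: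
  fixes \<theta> :: "nat \<Rightarrow> 'a \<Rightarrow> 'b::euclidean_space"
  assumes [measurable]: "\<theta> N \<in> borel_measurable M" "\<theta> 0 \<in> borel_measurable M" "S \<in> borel_measurable M"
    and \<theta>: "\<And>n. integrable M (\<lambda>\<omega>. (norm (\<theta> n \<omega>))\<^sup>2) \<and> (\<integral>\<omega>. (norm (\<theta> n \<omega>))\<^sup>2 \<partial>M) \<le> D"
    and S: "integrable M (\<lambda>\<omega>. (norm (S \<omega>))\<^sup>2)"
    and b: "\<And>\<omega>. b \<omega> = (1 / real N) *\<^sub>R ((1 / \<alpha>) *\<^sub>R (\<theta> N \<omega> - \<theta> 0 \<omega>) - S \<omega>)"
  shows "integrable M (\<lambda>\<omega>. (norm (b \<omega>))\<^sup>2)"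
    "(\<integral>\<omega>. (norm (b \<omega>))\<^sup>2 \<partial>M) \<le> 1 / (real N)\<^sup>2 * (8 * D / \<alpha>\<^sup>2 + 2 * (\<integral>\<omega>. (norm (S \<omega>))\<^sup>2 \<partial>M))"
proof -
  \<comment> \<open>Splitting off the noise sum doubles the squares, and splitting
    \<open>\<theta> N - \<theta> 0\<close> doubles them again; with two moments bounded by D this
    gives 8 D / \<alpha>^2.\<close>
  define h where "h \<omega> = 1 / (real N)\<^sup>2 * (4 / \<alpha>\<^sup>2 * ((norm (\<theta> N \<omega>))\<^sup>2 + (norm (\<theta> 0 \<omega>))\<^sup>2) + 2 * (norm (S \<omega>))\<^sup>2)" for \<omega>
  have le: "(norm (b \<omega>))\<^sup>2 \<le> h \<omega>" for \<omega>
  proof -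
    have "norm ((1 / \<alpha>) *\<^sub>R (\<theta> N \<omega> - \<theta> 0 \<omega>) - S \<omega>) \<le> norm ((1 / \<alpha>) *\<^sub>R (\<theta> N \<omega> - \<theta> 0 \<omega>)) + norm (S \<omega>)"
      by (rule norm_triangle_ineq4)
    then have "(norm ((1 / \<alpha>) *\<^sub>R (\<theta> N \<omega> - \<theta> 0 \<omega>) - S \<omega>))\<^sup>2
        \<le> 2 * (norm ((1 / \<alpha>) *\<^sub>R (\<theta> N \<omega> - \<theta> 0 \<omega>)))\<^sup>2 + 2 * (norm (S \<omega>))\<^sup>2"
      by (intro order.trans[OF power_mono square_sum_le]) auto
    also have "(norm ((1 / \<alpha>) *\<^sub>R (\<theta> N \<omega> - \<theta> 0 \<omega>)))\<^sup>2 = 1 / \<alpha>\<^sup>2 * (norm (\<theta> N \<omega> - \<theta> 0 \<omega>))\<^sup>2"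
      by (simp add: power_mult_distrib power_divide)
    also have "(norm (\<theta> N \<omega> - \<theta> 0 \<omega>))\<^sup>2 \<le> 2 * (norm (\<theta> N \<omega>))\<^sup>2 + 2 * (norm (\<theta> 0 \<omega>))\<^sup>2"
      by (intro order.trans[OF power_mono square_sum_le] norm_triangle_ineq4) auto
    finally have "(norm ((1 / \<alpha>) *\<^sub>R (\<theta> N \<omega> - \<theta> 0 \<omega>) - S \<omega>))\<^sup>2
        \<le> 4 / \<alpha>\<^sup>2 * ((norm (\<theta> N \<omega>))\<^sup>2 + (norm (\<theta> 0 \<omega>))\<^sup>2) + 2 * (norm (S \<omega>))\<^sup>2"
      by (simp add: divide_right_mono add_divide_distrib algebra_simps)
    then have "1 / (real N)\<^sup>2 * (norm ((1 / \<alpha>) *\<^sub>R (\<theta> N \<omega> - \<theta> 0 \<omega>) - S \<omega>))\<^sup>2 \<le> h \<omega>"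
      unfolding h_def by (intro mult_left_mono) auto
    then show ?thesis by (simp add: b power_mult_distrib power_divide)
  qed
  have h: "integrable M h" unfolding h_def using \<theta> S by auto
  show i: "integrable M (\<lambda>\<omega>. (norm (b \<omega>))\<^sup>2)"
    by (rule integrable_dominated_square[OF h _ le]) (simp add: b)
  have "(\<integral>\<omega>. (norm (b \<omega>))\<^sup>2 \<partial>M) \<le> (\<integral>\<omega>. h \<omega> \<partial>M)" by (rule integral_mono[OF i h le])
  also have "\<dots> = 1 / (real N)\<^sup>2 * (4 / \<alpha>\<^sup>2 * ((\<integral>\<omega>. (norm (\<theta> N \<omega>))\<^sup>2 \<partial>M) + (\<integral>\<omega>. (norm (\<theta> 0 \<omega>))\<^sup>2 \<partial>M))
      + 2 * (\<integral>\<omega>. (norm (S \<omega>))\<^sup>2 \<partial>M))"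
    unfolding h_def using \<theta> S by simp
  also have "\<dots> \<le> 1 / (real N)\<^sup>2 * (4 / \<alpha>\<^sup>2 * (D + D) + 2 * (\<integral>\<omega>. (norm (S \<omega>))\<^sup>2 \<partial>M))"
    using \<theta> by (intro mult_left_mono add_mono) auto
  finally show "(\<integral>\<omega>. (norm (b \<omega>))\<^sup>2 \<partial>M) \<le> 1 / (real N)\<^sup>2 * (8 * D / \<alpha>\<^sup>2 + 2 * (\<integral>\<omega>. (norm (S \<omega>))\<^sup>2 \<partial>M))"
    by (simp add: algebra_simps)
qed

text \<open>Orthogonality is checked coordinatewise, where independence makes the mean of a product
  the product of the means.\<close>

lemma (in prob_space) indep_centered_sum_second_moment:
  fixes X :: "nat \<Rightarrow> 'a \<Rightarrow> real^'d"
  assumes ind: "indep_vars (\<lambda>_. borel) X UNIV"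
    and X: "\<And>n. integrable M (X n)" "\<And>n. (\<integral>\<omega>. X n \<omega> \<partial>M) = 0"
    and X2: "\<And>n. integrable M (\<lambda>\<omega>. (norm (X n \<omega>))\<^sup>2)"
  shows "integrable M (\<lambda>\<omega>. (norm (\<Sum>n\<in>{1..N}. X n \<omega>))\<^sup>2) \<and>
    (\<integral>\<omega>. (norm (\<Sum>n\<in>{1..N}. X n \<omega>))\<^sup>2 \<partial>M) = (\<Sum>n\<in>{1..N}. \<integral>\<omega>. (norm (X n \<omega>))\<^sup>2 \<partial>M)"
proof -
  have orth: "integrable M (\<lambda>\<omega>. X m \<omega> \<bullet> X n \<omega>) \<and> (\<integral>\<omega>. X m \<omega> \<bullet> X n \<omega> \<partial>M) = 0" if "m \<noteq> n" for m n
  proof -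
    have comp: "integrable M (\<lambda>\<omega>. X m \<omega> $ i)" "(\<integral>\<omega>. X m \<omega> $ i \<partial>M) = 0" for m i
      using integrable_bounded_linear[OF bounded_linear_vec_nth X(1)]
        integral_bounded_linear[OF bounded_linear_vec_nth X(1)] X(2) by auto
    have iv: "indep_var borel (\<lambda>\<omega>. X m \<omega> $ i) borel (\<lambda>\<omega>. X n \<omega> $ i)" for i
    proof -
      have nth: "(\<lambda>x::real^'d. x $ i) \<in> borel_measurable borel"
        by (intro borel_measurable_continuous_onI continuous_intros)
      have "(\<lambda>f. f k) \<in> borel_measurable (Pi\<^sub>M {k} (\<lambda>_. borel :: (real^'d) measure))" for k :: nat
        by (rule measurable_component_singleton) simp
      note meas = measurable_compose[OF this nth]
      \<comment> \<open>Two members of the family are extracted as its restrictions to the disjoint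
        index sets {m} and {n}.\<close>
      have "indep_var borel ((\<lambda>f. f m $ i) \<circ> (\<lambda>\<omega>. \<lambda>k\<in>{m}. X k \<omega>)) borel ((\<lambda>f. f n $ i) \<circ> (\<lambda>\<omega>. \<lambda>k\<in>{n}. X k \<omega>))"
        using that by (intro indep_var_compose[OF indep_var_restrict[OF ind]] meas) auto
      then show ?thesis by (simp add: o_def)
    qed
    have "integrable M (\<lambda>\<omega>. X m \<omega> $ i * X n \<omega> $ i) \<and> (\<integral>\<omega>. X m \<omega> $ i * X n \<omega> $ i \<partial>M) = 0" for i
      using indep_var_integrable[OF iv comp(1) comp(1)] indep_var_lebesgue_integral[OF iv comp(1) comp(1)] comp(2)
      by simp
    then show ?thesis by (simp add: inner_vec_def)
  qed
  show ?thesis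
  proof (induction N)
    case (Suc N)
    define S where "S \<omega> = (\<Sum>n\<in>{1..N}. X n \<omega>)" for \<omega>
    have eq: "(norm (\<Sum>n\<in>{1..Suc N}. X n \<omega>))\<^sup>2
        = (norm (S \<omega>))\<^sup>2 + 2 * (\<Sum>n\<in>{1..N}. X n \<omega> \<bullet> X (Suc N) \<omega>) + (norm (X (Suc N) \<omega>))\<^sup>2" for \<omega>
      by (simp add: S_def power2_norm_eq_inner inner_add_left inner_add_right inner_commute flip: inner_sum_left)
    have c: "integrable M (\<lambda>\<omega>. \<Sum>n\<in>{1..N}. X n \<omega> \<bullet> X (Suc N) \<omega>)"
      "(\<integral>\<omega>. (\<Sum>n\<in>{1..N}. X n \<omega> \<bullet> X (Suc N) \<omega>) \<partial>M) = 0"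
      using orth[of _ "Suc N"] by (auto simp: Bochner_Integration.integral_sum)
    show ?case unfolding eq using Suc[folded S_def] c X2[of "Suc N"] by simp
  qed simp
qed

section \<open>The zig-zag chain\<close>

lemma zigzag_F_continuous: "continuous_on UNIV (zigzag_F :: (real^'d) \<times> (real^'d) \<Rightarrow> _)"
  unfolding zigzag_F_def by (intro continuous_intros)

lemma zigzag_F_measurable [measurable]: "zigzag_F \<in> borel_measurable (borel :: ((real^'d) \<times> (real^'d)) measure)"
  by (rule borel_measurable_continuous_onI[OF zigzag_F_continuous])

lemma fst_snd_borel_measurable [measurable]:
  "(fst :: (real^'d) \<times> (real^'d) \<Rightarrow> real^'d) \<in> borel_measurable borel"
  "(snd :: (real^'d) \<times> (real^'d) \<Rightarrow> real^'d) \<in> borel_measurable borel"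
  by (auto intro!: borel_measurable_continuous_onI continuous_intros)

lemma emeasure_zigzag_kernel:
  fixes \<mu> :: "('a::euclidean_space) measure"
  assumes "sets \<mu> = sets borel" "A \<in> sets borel"
  shows "emeasure (step_kernel zigzag_step \<mu> x) A = emeasure \<mu> {w. (snd x, w) \<in> A}"
proof -
  have sp: "space \<mu> = UNIV" using sets_eq_imp_space_eq[OF assms(1)] by simp
  have "zigzag_step x \<in> borel_measurable \<mu>"
    unfolding zigzag_step_def measurable_cong_sets[OF assms(1) refl]
    by (intro borel_measurable_continuous_onI continuous_intros)
  then show ?thesis
    using assms by (simp add: step_kernel_def emeasure_distr sp zigzag_step_def vimage_def)
qed

lemma outer_bounded_bilinear: "bounded_bilinear (outer :: real^'d \<Rightarrow> real^'d \<Rightarrow> real^'d^'d)"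
proof -
  have "bilinear (outer :: real^'d \<Rightarrow> real^'d \<Rightarrow> real^'d^'d)"
    unfolding bilinear_def by (auto intro!: linearI simp: outer_def vec_eq_iff algebra_simps)
  then show ?thesis by (simp add: bilinear_conv_bounded_bilinear)
qed

lemma integrable_outer:
  fixes f g :: "'b \<Rightarrow> real^'d"
  assumes [measurable]: "f \<in> borel_measurable M" "g \<in> borel_measurable M"
    and "integrable M (\<lambda>x. (norm (f x))\<^sup>2)" "integrable M (\<lambda>x. (norm (g x))\<^sup>2)"
  shows "integrable M (\<lambda>x. outer (f x) (g x))"
proof -
  interpret bounded_bilinear "outer :: real^'d \<Rightarrow> real^'d \<Rightarrow> real^'d^'d" by (rule outer_bounded_bilinear)
  obtain K where K: "0 \<le> K" "\<And>a b :: real^'d. norm (outer a b) \<le> norm a * norm b * K"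
    using nonneg_bounded by blast
  have le: "norm (outer a b) \<le> K * ((norm a)\<^sup>2 + (norm b)\<^sup>2)" for a b :: "real^'d"
  proof -
    have "norm a * norm b \<le> (norm a)\<^sup>2 + (norm b)\<^sup>2"
      using sum_squares_bound[of "norm a" "norm b"] mult_nonneg_nonneg[OF norm_ge_zero norm_ge_zero, of a b]
      unfolding mult.assoc by linarith
    then have "K * (norm a * norm b) \<le> K * ((norm a)\<^sup>2 + (norm b)\<^sup>2)" using K by (intro mult_left_mono)
    then show ?thesis using K(2)[of a b] by (simp add: algebra_simps)
  qed
  show ?thesis
  proof (rule Bochner_Integration.integrable_bound)
    show "integrable M (\<lambda>x. K * ((norm (f x))\<^sup>2 + (norm (g x))\<^sup>2))" using assms by auto
    show "(\<lambda>x. outer (f x) (g x)) \<in> borel_measurable M"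
      by (rule borel_measurable_continuous_Pair) (auto intro!: continuous_on continuous_intros)
    show "AE x in M. norm (outer (f x) (g x)) \<le> norm (K * ((norm (f x))\<^sup>2 + (norm (g x))\<^sup>2))"
      using le by (auto intro: order.trans[OF _ abs_ge_self])
  qed
qed

lemma integral_outer:
  fixes h :: "'b \<Rightarrow> real^'d"
  assumes "integrable M h"
  shows "(\<integral>y. outer (h y) a \<partial>M) = outer (\<integral>y. h y \<partial>M) a"
    and "(\<integral>y. outer a (h y) \<partial>M) = outer a (\<integral>y. h y \<partial>M)"
proof -
  interpret bounded_bilinear "outer :: real^'d \<Rightarrow> real^'d \<Rightarrow> real^'d^'d" by (rule outer_bounded_bilinear)
  show "(\<integral>y. outer (h y) a \<partial>M) = outer (\<integral>y. h y \<partial>M) a"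
    by (rule integral_bounded_linear[OF bounded_linear_left assms])
  show "(\<integral>y. outer a (h y) \<partial>M) = outer a (\<integral>y. h y \<partial>M)"
    by (rule integral_bounded_linear[OF bounded_linear_right assms])
qed

context
  fixes \<mu> :: "(real^'d) measure"
  assumes prob: "prob_space \<mu>" and sets: "sets \<mu> = sets borel"
    and int: "integrable \<mu> (\<lambda>x. x)" and mean: "(\<integral>x. x \<partial>\<mu>) = 0"
    and sq: "integrable \<mu> (\<lambda>x. (norm x)\<^sup>2)"
begin

interpretation \<mu>: prob_space \<mu> by (rule prob)

private abbreviation (input) P :: "(real^'d) \<times> (real^'d) \<Rightarrow> ((real^'d) \<times> (real^'d)) measure" where
  "P \<equiv> step_kernel zigzag_step \<mu>"

private abbreviation (input) F :: "(real^'d) \<times> (real^'d) \<Rightarrow> real^'d" where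
  "F \<equiv> zigzag_F"

text \<open>A step moves the second component to the first place and draws a fresh second one. Q and
  Q' are kept apart so that this covers both an invariant law and successive powers of the
  kernel.\<close>

lemma zigzag_step_laws:
  assumes Q: "prob_space Q" "sets Q = sets borel" and Q': "sets Q' = sets borel"
    and step: "\<And>A. A \<in> sets borel \<Longrightarrow> emeasure Q' A = (\<integral>\<^sup>+x. emeasure (P x) A \<partial>Q)"
  shows "distr Q' borel snd = \<mu>" "distr Q' borel fst = distr Q borel snd"
proof -
  interpret Q: prob_space Q by (rule Q)
  have meas: "measurable Q' borel = measurable borel borel" "measurable Q borel = measurable borel borel"
    using Q Q' by (auto intro!: measurable_cong_sets)
  have sp: "space Q' = UNIV" "space Q = UNIV" "space \<mu> = UNIV"
    using sets_eq_imp_space_eq[OF Q(2)] sets_eq_imp_space_eq[OF Q'] sets_eq_imp_space_eq[OF sets] by auto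
  have m: "snd -` A \<in> sets (borel :: ((real^'d) \<times> (real^'d)) measure)" "fst -` A \<in> sets (borel :: ((real^'d) \<times> (real^'d)) measure)"
    if "A \<in> sets borel" for A :: "(real^'d) set"
    using measurable_sets[OF fst_snd_borel_measurable(2) that] measurable_sets[OF fst_snd_borel_measurable(1) that] by auto
  show "distr Q' borel snd = \<mu>"
  proof (rule measure_eqI)
    fix A assume "A \<in> sets (distr Q' borel (snd :: _ \<Rightarrow> real^'d))"
    then have A: "A \<in> sets borel" by simp
    have "emeasure (distr Q' borel snd) A = (\<integral>\<^sup>+x. emeasure (P x) (snd -` A) \<partial>Q)"
      using A by (simp add: emeasure_distr meas sp step m)
    also have "\<dots> = (\<integral>\<^sup>+x. emeasure \<mu> A \<partial>Q)"
      by (simp add: emeasure_zigzag_kernel[OF sets m(1)[OF A]])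
    also have "\<dots> = emeasure \<mu> A" by (simp add: Q.emeasure_space_1)
    finally show "emeasure (distr Q' borel snd) A = emeasure \<mu> A" .
  qed (simp add: sets)
  show "distr Q' borel fst = distr Q borel snd"
  proof (rule measure_eqI)
    fix A assume "A \<in> sets (distr Q' borel (fst :: _ \<Rightarrow> real^'d))"
    then have A: "A \<in> sets borel" by simp
    have "emeasure (distr Q' borel fst) A = (\<integral>\<^sup>+x. emeasure (P x) (fst -` A) \<partial>Q)"
      using A by (simp add: emeasure_distr meas sp step m)
    \<comment> \<open>Given x the new first component is \<open>snd x\<close>, so the event has
      probability 0 or 1.\<close>
    also have "\<dots> = (\<integral>\<^sup>+x. indicator (snd -` A) x \<partial>Q)"
    proof (rule nn_integral_cong)
      fix x :: "(real^'d) \<times> (real^'d)"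
      have "emeasure (P x) (fst -` A) = emeasure \<mu> {w. snd x \<in> A}"
        by (simp add: emeasure_zigzag_kernel[OF sets m(2)[OF A]])
      also have "\<dots> = indicator (snd -` A) x"
        using \<mu>.emeasure_space_1 by (cases "snd x \<in> A") (auto simp: sp)
      finally show "emeasure (P x) (fst -` A) = indicator (snd -` A) x" .
    qed
    also have "\<dots> = emeasure (distr Q borel snd) A"
      using A m(1)[OF A] by (simp add: emeasure_distr meas sp Q)
    finally show "emeasure (distr Q' borel fst) A = emeasure (distr Q borel snd) A" .
  qed simp
qed

lemma zigzag_marginal_integral:
  fixes h :: "real^'d \<Rightarrow> 'e::{banach, second_countable_topology}"
  assumes Q: "sets Q = sets borel" and laws: "distr Q borel snd = \<mu>" "distr Q borel fst = \<mu>"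
    and h: "h \<in> borel_measurable borel" "integrable \<mu> h"
  shows "integrable Q (\<lambda>x. h (snd x))" "(\<integral>x. h (snd x) \<partial>Q) = (\<integral>x. h x \<partial>\<mu>)"
    "integrable Q (\<lambda>x. h (fst x))" "(\<integral>x. h (fst x) \<partial>Q) = (\<integral>x. h x \<partial>\<mu>)"
proof -
  have m: "snd \<in> borel_measurable Q" "fst \<in> borel_measurable Q"
    unfolding measurable_cong_sets[OF Q refl] by (rule fst_snd_borel_measurable)+
  note d = integrable_distr_eq[OF m(1) h(1)] integrable_distr_eq[OF m(2) h(1)]
    integral_distr[OF m(1) h(1)] integral_distr[OF m(2) h(1)]
  show "integrable Q (\<lambda>x. h (snd x))" using d(1) h(2) unfolding laws by blast
  show "integrable Q (\<lambda>x. h (fst x))" using d(2) h(2) unfolding laws by blast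
  show "(\<integral>x. h (snd x) \<partial>Q) = (\<integral>x. h x \<partial>\<mu>)" using d(3) unfolding laws by simp
  show "(\<integral>x. h (fst x) \<partial>Q) = (\<integral>x. h x \<partial>\<mu>)" using d(4) unfolding laws by simp
qed

text \<open>Phrased through the marginals so as to cover the invariant law and, from the second step
  on, the powers of the kernel.\<close>

lemma zigzag_moments:
  assumes Q: "sets Q = sets borel" and laws: "distr Q borel snd = \<mu>" "distr Q borel fst = \<mu>"
  shows "integrable Q F" "(\<integral>x. F x \<partial>Q) = 0" "integrable Q (\<lambda>x. (norm (F x))\<^sup>2)"
    "integrable Q (\<lambda>x. (norm (snd x))\<^sup>2)" "integrable Q (\<lambda>x. (norm (fst x))\<^sup>2)"
proof -
  note push = zigzag_marginal_integral[OF Q laws]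
  note i = push[OF _ int, simplified]
  have Fi: "integrable Q (\<lambda>x. (1 / sqrt 2) *\<^sub>R (snd x - fst x))"
    using i by (intro integrable_scaleR_right Bochner_Integration.integrable_diff)
  then show "integrable Q F" by (simp add: zigzag_F_def[abs_def])
  show "(\<integral>x. F x \<partial>Q) = 0"
    using i mean by (simp add: zigzag_F_def)
  show s: "integrable Q (\<lambda>x. (norm (snd x))\<^sup>2)" and f: "integrable Q (\<lambda>x. (norm (fst x))\<^sup>2)"
    using push(1,3)[OF _ sq] by simp_all
  have le: "(norm (F x))\<^sup>2 \<le> (norm (snd x))\<^sup>2 + (norm (fst x))\<^sup>2" for x
  proof -
    have "(norm (snd x - fst x))\<^sup>2 \<le> 2 * (norm (snd x))\<^sup>2 + 2 * (norm (fst x))\<^sup>2"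
      by (intro order.trans[OF power_mono square_sum_le] norm_triangle_ineq4) auto
    then show ?thesis by (simp add: zigzag_F_def power_mult_distrib power_divide)
  qed
  show "integrable Q (\<lambda>x. (norm (F x))\<^sup>2)"
  proof (rule integrable_dominated_square[OF _ _ le])
    show "(\<lambda>x. norm (F x)) \<in> borel_measurable Q"
      unfolding measurable_cong_sets[OF Q refl] by measurable
  qed (use s f in auto)
qed

lemma zigzag_invariant_laws:
  assumes "invariant_prob P \<pi>"
  shows "distr \<pi> borel snd = \<mu>" "distr \<pi> borel fst = \<mu>"
proof -
  have "prob_space \<pi>" "sets \<pi> = sets borel" "\<And>A. A \<in> sets borel \<Longrightarrow> emeasure \<pi> A = (\<integral>\<^sup>+x. emeasure (P x) A \<partial>\<pi>)"
    using assms by (auto simp: invariant_prob_def)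
  from zigzag_step_laws[OF this(1,2,2,3)] show "distr \<pi> borel snd = \<mu>" "distr \<pi> borel fst = \<mu>" by auto
qed

context
  assumes kernel: "markov_kernel P"
begin

text \<open>After one step the second component is fresh noise and after two steps both are,
  whatever the starting point.\<close>

lemma zigzag_kernel_pow:
  "kernel_pow P n x \<in> space (prob_algebra borel)"
  "distr (kernel_pow P (Suc n) x) borel snd = \<mu>"
  "distr (kernel_pow P (Suc (Suc n)) x) borel fst = \<mu>"
proof -
  have P: "P \<in> measurable borel (prob_algebra borel)" using kernel by (simp add: markov_kernel_def)
  have pa: "kernel_pow P n x \<in> space (prob_algebra borel)" for n
  proof (induction n)
    case 0
    show ?case by (simp add: space_prob_algebra prob_space_return)
  next
    case (Suc n)
    \<comment> \<open>This rule speaks of parametrized measures; a constant family over the reals,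
      evaluated at 0, yields the single measure wanted.\<close>
    show ?case using measurable_bind_prob_space[OF _ P, of "\<lambda>_. kernel_pow P n x" "borel :: real measure"] Suc
      by (auto dest!: measurable_space[where x = 0])
  qed
  show "kernel_pow P n x \<in> space (prob_algebra borel)" by (rule pa)
  have pr: "prob_space (kernel_pow P n x)" "sets (kernel_pow P n x) = sets borel" for n
    using pa[of n] by (auto simp: space_prob_algebra)
  have em: "emeasure (kernel_pow P (Suc n) x) A = (\<integral>\<^sup>+y. emeasure (P y) A \<partial>kernel_pow P n x)"
    if "A \<in> sets borel" for A n
  proof -
    have "P \<in> measurable (kernel_pow P n x) (subprob_algebra borel)"
      using measurable_prob_algebraD[OF P] by (simp add: measurable_cong_sets[OF pr(2) refl])
    moreover have "space (kernel_pow P n x) \<noteq> {}" using sets_eq_imp_space_eq[OF pr(2)[of n]] by simp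
    ultimately show ?thesis using that by (simp add: emeasure_bind)
  qed
  note laws = zigzag_step_laws[OF pr pr(2) em]
  show "distr (kernel_pow P (Suc n) x) borel snd = \<mu>" by (rule laws(1))
  show "distr (kernel_pow P (Suc (Suc n)) x) borel fst = \<mu>"
    using laws(2)[of "Suc n"] laws(1)[of n] by simp
qed

text \<open>Lags beyond 1 vanish, since the noise is fresh by then, and the lags -1, 0 and 1 cancel.
  Summability is proved as well because \<open>infsum\<close> is 0 by default for families that are
  not summable.\<close>

lemma zigzag_autocov:
  assumes inv: "invariant_prob P \<pi>"
  shows "autocov P \<pi> F summable_on UNIV" "Sigma_CLT P \<pi> F = 0"
proof -
  interpret bounded_bilinear "outer :: real^'d \<Rightarrow> real^'d \<Rightarrow> real^'d^'d" by (rule outer_bounded_bilinear)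
  have sets\<pi>: "sets \<pi> = sets borel" using inv by (auto simp: invariant_prob_def)
  note laws = zigzag_invariant_laws[OF inv]
  note mom = zigzag_moments[OF sets\<pi> laws]
  note [measurable_cong] = sets\<pi>
  have P: "P \<in> measurable borel (subprob_algebra borel)"
    using kernel by (simp add: markov_kernel_def measurable_prob_algebraD)
  have pow1: "kernel_pow P 1 x = P x" for x
    using bind_return[OF P] by (simp add: One_nat_def[symmetric] del: One_nat_def) (simp add: numeral_eq_Suc)
  have outer_measurable [measurable]: "(\<lambda>y. outer a (F y)) \<in> borel_measurable borel" "(\<lambda>y. outer (F y) a) \<in> borel_measurable borel" for a
    by (rule borel_measurable_continuous_onI, intro continuous_on continuous_intros zigzag_F_continuous)+
  \<comment> \<open>The conditional mean of the next exploration term given the state x: the fresh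
    noise is centered, so only the old one remains, with a minus sign.\<close>
  define g where "g x = (- (1 / sqrt 2)) *\<^sub>R snd x" for x :: "(real^'d) \<times> (real^'d)"
  have zs: "zigzag_step x \<in> borel_measurable \<mu>" for x
    unfolding zigzag_step_def measurable_cong_sets[OF sets refl]
    by (intro borel_measurable_continuous_onI continuous_intros)
  have step: "integrable \<mu> (\<lambda>w. F (zigzag_step x w))" "(\<integral>w. F (zigzag_step x w) \<partial>\<mu>) = g x" for x
    using int mean by (simp_all add: zigzag_F_def zigzag_step_def g_def \<mu>.prob_space scaleR_right_diff_distrib)
  have c0: "autocov P \<pi> F 0 = (\<integral>x. outer (F x) (F x) \<partial>\<pi>)"
    by (simp add: autocov_def integral_return)
  have c1: "autocov P \<pi> F 1 = (\<integral>x. outer (F x) (g x) \<partial>\<pi>)"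
  proof -
    have "(\<integral>y. outer (F x) (F y) \<partial>P x) = outer (F x) (g x)" for x
      unfolding step_kernel_def using zs integral_outer(2)[OF step(1)[of x], of "F x"]
      by (simp add: integral_distr step(2))
    then show ?thesis by (simp add: autocov_def pow1[simplified])
  qed
  have cm1: "autocov P \<pi> F (- 1) = (\<integral>x. outer (g x) (F x) \<partial>\<pi>)"
  proof -
    have "(\<integral>y. outer (F y) (F x) \<partial>P x) = outer (g x) (F x)" for x
      unfolding step_kernel_def using zs integral_outer(1)[OF step(1)[of x], of "F x"]
      by (simp add: integral_distr step(2))
    then show ?thesis by (simp add: autocov_def pow1[simplified])
  qed
  have c2: "autocov P \<pi> F k = 0" if "k \<notin> {- 1, 0, 1}" for k
  proof -
    \<comment> \<open>From lag 2 on, F has mean 0 under the kernel from every starting point, so the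
      inner integral vanishes.\<close>
    have *: "integrable (kernel_pow P n x) F \<and> (\<integral>y. F y \<partial>kernel_pow P n x) = 0" if n2: "2 \<le> n" for n x
    proof -
      obtain m where n: "n = Suc (Suc m)" using that using less_eqE[OF n2] by (auto simp: numeral_2_eq_2)
      have "sets (kernel_pow P n x) = sets borel" using zigzag_kernel_pow(1)[of n x] by (auto simp: space_prob_algebra)
      from zigzag_moments(1,2)[OF this] show ?thesis
        using zigzag_kernel_pow(2)[of "Suc m" x] zigzag_kernel_pow(3)[of m x] unfolding n by blast
    qed
    have "(\<integral>y. outer (F x) (F y) \<partial>kernel_pow P n x) = 0 \<and> (\<integral>y. outer (F y) (F x) \<partial>kernel_pow P n x) = 0"
      if "2 \<le> n" for n x
      using *[OF that, of x] integral_outer(1)[of "kernel_pow P n x" F "F x"] integral_outer(2)[of "kernel_pow P n x" F "F x"]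
      by (simp add: zero_left zero_right)
    moreover have "2 \<le> nat k" if "0 \<le> k" using \<open>k \<notin> {- 1, 0, 1}\<close> that by auto
    moreover have "2 \<le> nat (- k)" if "\<not> 0 \<le> k" using \<open>k \<notin> {- 1, 0, 1}\<close> that by auto
    ultimately show ?thesis by (simp add: autocov_def)
  qed
  show "autocov P \<pi> F summable_on UNIV"
    by (rule finite_nonzero_values_imp_summable_on)
       (rule finite_subset[of _ "{- 1, 0, 1}"], use c2 in auto)
  have gsq: "integrable \<pi> (\<lambda>x. (norm (g x))\<^sup>2)" using mom(4) by (simp add: g_def power_mult_distrib power_divide)
  have gm [measurable]: "g \<in> borel_measurable \<pi>" unfolding g_def by measurable
  \<comment> \<open>The integrands of the three lags add up to half the difference of the outer
    squares of the two components, which have the same law.\<close>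
  have ident: "outer (F x) (F x) + outer (F x) (g x) + outer (g x) (F x)
      = (1 / 2) *\<^sub>R (outer (fst x) (fst x) - outer (snd x) (snd x))" for x
  proof -
    have "outer (s *\<^sub>R (b - a)) (s *\<^sub>R (b - a)) + outer (s *\<^sub>R (b - a)) ((- s) *\<^sub>R b) + outer ((- s) *\<^sub>R b) (s *\<^sub>R (b - a))
        = (s * s) *\<^sub>R (outer a a - outer b b)" for s and a b :: "real^'d"
      by (simp add: outer_def vec_eq_iff algebra_simps)
    from this[of "1 / sqrt 2" "snd x" "fst x"] show ?thesis by (simp add: zigzag_F_def g_def)
  qed
  have "Sigma_CLT P \<pi> F = (\<Sum>\<^sub>\<infinity>k\<in>{- 1, 0, 1}. autocov P \<pi> F k)"
    unfolding Sigma_CLT_def by (rule infsum_cong_neutral) (use c2 in auto)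
  also have "\<dots> = autocov P \<pi> F 0 + autocov P \<pi> F 1 + autocov P \<pi> F (- 1)" by simp
  also have "\<dots> = (\<integral>x. outer (F x) (F x) + outer (F x) (g x) + outer (g x) (F x) \<partial>\<pi>)"
    unfolding c0 c1 cm1 using mom gsq by (simp add: integrable_outer)
  also have "\<dots> = (1 / 2) *\<^sub>R ((\<integral>x. outer (fst x) (fst x) \<partial>\<pi>) - (\<integral>x. outer (snd x) (snd x) \<partial>\<pi>))"
    unfolding ident using mom by (simp add: integrable_outer)
  also have "(\<integral>x. outer (fst x) (fst x) \<partial>\<pi>) = (\<integral>x. outer (snd x) (snd x) \<partial>\<pi>)"
  proof -
    have m: "(\<lambda>x::real^'d. outer x x) \<in> borel_measurable borel"
      by (intro borel_measurable_continuous_onI continuous_on continuous_intros)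
    have "(\<integral>x. outer (fst x) (fst x) \<partial>\<pi>) = (\<integral>x. outer x x \<partial>distr \<pi> borel fst)"
      using m by (simp add: integral_distr)
    also have "\<dots> = (\<integral>x. outer (snd x) (snd x) \<partial>\<pi>)"
      unfolding laws(2) unfolding laws(1)[symmetric] using m by (simp add: integral_distr)
    finally show ?thesis .
  qed
  finally show "Sigma_CLT P \<pi> F = 0" by simp
qed

end

lemma emeasure_zigzag_joint_kernel:
  fixes fbar :: "real^'d \<Rightarrow> real^'d"
  assumes A: "A \<in> sets borel"
  shows "emeasure (joint_kernel P (\<lambda>\<theta> x. fbar \<theta> + F x) \<alpha> z) A
    = emeasure \<mu> {w. (fst z + \<alpha> *\<^sub>R (fbar (fst z) + F (snd (snd z), w)), (snd (snd z), w)) \<in> A}"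
proof -
  define G where "G y = (fst z + \<alpha> *\<^sub>R (fbar (fst z) + F y), y)" for y
  have "continuous_on UNIV G"
    unfolding G_def by (intro continuous_intros zigzag_F_continuous)
  then have G: "G \<in> borel_measurable borel" by (rule borel_measurable_continuous_onI)
  have setsP: "sets (P x) = sets borel" for x by (simp add: step_kernel_def)
  have sp: "space (P x) = UNIV" for x using sets_eq_imp_space_eq[OF setsP[of x]] by simp
  have GA: "G -` A \<in> sets borel" using measurable_sets[OF G A] by simp
  have "G \<in> borel_measurable (P (snd z))" unfolding measurable_cong_sets[OF setsP refl] by (rule G)
  then have "emeasure (joint_kernel P (\<lambda>\<theta> x. fbar \<theta> + F x) \<alpha> z) A = emeasure (P (snd z)) (G -` A)"
    using A by (simp add: joint_kernel_def G_def[abs_def] emeasure_distr sp)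
  also have "\<dots> = emeasure \<mu> {w. (snd (snd z), w) \<in> G -` A}"
    by (rule emeasure_zigzag_kernel[OF sets GA])
  finally show ?thesis by (simp add: G_def)
qed

text \<open>For \<open>Y z = fst z - (\<alpha> / sqrt 2) *\<^sub>R snd (snd z)\<close> the new noise cancels: the next value of \<open>Y\<close> is
  a function of the present state.\<close>

lemma zigzag_stationary_second_moment:
  fixes fbar :: "real^'d \<Rightarrow> real^'d" and z0 :: "real^'d"
  assumes V: "euler_lyapunov (\<lambda>x. fbar (x + z0)) V c K a C" and lip: "L-lipschitz_on UNIV fbar"
    and \<alpha>: "\<alpha> \<in> {0<..a}"
    and inv: "invariant_prob (joint_kernel P (\<lambda>\<theta> x. fbar \<theta> + F x) \<alpha>) \<nu>"
  shows "integrable \<nu> (\<lambda>z. (norm (fst z - z0))\<^sup>2)"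
    "(\<integral>z. (norm (fst z - z0))\<^sup>2 \<partial>\<nu>)
      \<le> 2 * (\<integral>x. (K / c * (C + L * (\<alpha> / sqrt 2 * norm x)))\<^sup>2 \<partial>\<mu>) + \<alpha>\<^sup>2 * (\<integral>x. (norm x)\<^sup>2 \<partial>\<mu>)"
proof -
  have \<nu>: "prob_space \<nu>" "sets \<nu> = sets borel"
    and inv': "A \<in> sets borel \<Longrightarrow> emeasure \<nu> A = (\<integral>\<^sup>+z. emeasure (joint_kernel P (\<lambda>\<theta> x. fbar \<theta> + F x) \<alpha> z) A \<partial>\<nu>)" for A
    using inv by (auto simp: invariant_prob_def)
  interpret \<nu>: prob_space \<nu> by (rule \<nu>)
  have sp: "space \<nu> = UNIV" "space \<mu> = UNIV"
    using sets_eq_imp_space_eq[OF \<nu>(2)] sets_eq_imp_space_eq[OF sets] by auto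
  have pos: "0 < c" "0 < K" "0 \<le> C" and cont: "continuous_on UNIV V" and Vn: "norm x \<le> V x" and ac: "a * c < 1" for x
    using V by (auto simp: euler_lyapunov_def)
  have L0: "0 \<le> L" by (rule lipschitz_on_nonneg[OF lip])
  have fcont: "continuous_on UNIV fbar" by (rule lipschitz_on_continuous_on[OF lip])
  have cs: "0 < c * \<alpha>" "c * \<alpha> < 1"
  proof -
    have "c * \<alpha> \<le> a * c" using \<alpha> pos by (simp add: mult.commute mult_left_mono)
    then show "c * \<alpha> < 1" using ac by linarith
  qed (use \<alpha> pos in auto)
  define q where "q z = snd (snd z)" for z :: "(real^'d) \<times> ((real^'d) \<times> (real^'d))"
  define Y where "Y z = fst z - (\<alpha> / sqrt 2) *\<^sub>R q z" for z
  \<comment> \<open>The companion A' is A after one step, written in the present state; stationarity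
    therefore makes the two equal in law.\<close>
  define A where "A z = (V (Y z - z0))\<^sup>2" for z
  define A' where "A' z = (V (Y z + \<alpha> *\<^sub>R fbar (fst z) - z0))\<^sup>2" for z
  define b where "b x = (K / c * (C + L * (\<alpha> / sqrt 2 * norm x)))\<^sup>2" for x :: "real^'d"
  have cont': "continuous_on UNIV q" "continuous_on UNIV A" "continuous_on UNIV A'"
    unfolding q_def A_def A'_def Y_def
    by (intro continuous_intros continuous_on_compose2[OF cont] continuous_on_compose2[OF fcont]; simp)+
  have bor: "q \<in> borel_measurable borel" "A \<in> borel_measurable borel" "A' \<in> borel_measurable borel"
    by (intro borel_measurable_continuous_onI cont')+
  have meas: "q \<in> borel_measurable \<nu>" "A \<in> borel_measurable \<nu>" "A' \<in> borel_measurable \<nu>"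
    unfolding measurable_cong_sets[OF \<nu>(2) refl] by (rule bor)+
  \<comment> \<open>The component q is the noise drawn last, hence distributed as \<mu> under
    stationarity.\<close>
  have qlaw: "distr \<nu> borel q = \<mu>"
  proof (rule measure_eqI)
    fix S assume "S \<in> sets (distr \<nu> borel q)"
    then have S: "S \<in> sets borel" by simp
    have m: "q -` S \<in> sets borel" using measurable_sets[OF bor(1) S] by simp
    have "emeasure (distr \<nu> borel q) S = emeasure \<nu> (q -` S)"
      using S meas by (simp add: emeasure_distr sp)
    also have "\<dots> = (\<integral>\<^sup>+z. emeasure \<mu> S \<partial>\<nu>)"
      unfolding inv'[OF m] emeasure_zigzag_joint_kernel[OF m] by (simp add: q_def)
    finally show "emeasure (distr \<nu> borel q) S = emeasure \<mu> S" by (simp add: \<nu>.emeasure_space_1)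
  qed (simp add: sets)
  have law: "distr \<nu> borel A' = distr \<nu> borel A"
  proof (rule measure_eqI)
    fix S assume "S \<in> sets (distr \<nu> borel A')"
    then have S: "S \<in> sets borel" by simp
    have m: "A -` S \<in> sets borel" "A' -` S \<in> sets borel"
      using measurable_sets[OF bor(2) S] measurable_sets[OF bor(3) S] by auto
    have "emeasure (distr \<nu> borel A) S = emeasure \<nu> (A -` S)"
      using S meas by (simp add: emeasure_distr sp)
    also have "\<dots> = (\<integral>\<^sup>+z. indicator (A' -` S) z \<partial>\<nu>)"
      unfolding inv'[OF m(1)] emeasure_zigzag_joint_kernel[OF m(1)]
    proof (rule nn_integral_cong)
      fix z
      have "A (fst z + \<alpha> *\<^sub>R (fbar (fst z) + F (snd (snd z), w)), (snd (snd z), w)) = A' z" for w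
        by (simp add: A_def A'_def Y_def q_def zigzag_F_def algebra_simps)
      then show "emeasure \<mu> {w. (fst z + \<alpha> *\<^sub>R (fbar (fst z) + F (snd (snd z), w)), (snd (snd z), w)) \<in> A -` S}
          = indicator (A' -` S) z"
        using \<mu>.emeasure_space_1 by (cases "A' z \<in> S") (auto simp: sp)
    qed
    also have "\<dots> = emeasure (distr \<nu> borel A') S"
      using S m meas by (simp add: emeasure_distr sp \<nu>(2))
    finally show "emeasure (distr \<nu> borel A') S = emeasure (distr \<nu> borel A) S" by simp
  qed simp
  have drift: "A' z \<le> (1 - c * \<alpha>) * A z + c * \<alpha> * b (q z)" for z
  proof -
    \<comment> \<open>The recursion evaluates fbar at \<theta> and not at Y; the Lipschitz bound
      makes the discrepancy of order \<alpha>.\<close>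
    define e where "e = fbar (fst z) - fbar (Y z)"
    have "norm e \<le> L * norm (fst z - Y z)"
      using lipschitz_onD[OF lip, of "fst z" "Y z"] by (simp add: e_def dist_norm)
    also have "norm (fst z - Y z) = \<alpha> / sqrt 2 * norm (q z)" using \<alpha> by (simp add: Y_def)
    finally have e: "norm e \<le> L * (\<alpha> / sqrt 2 * norm (q z))" .
    have "A' z = (V ((Y z - z0) + \<alpha> *\<^sub>R (fbar ((Y z - z0) + z0) + e)))\<^sup>2"
      by (simp add: A'_def e_def algebra_simps)
    also have "\<dots> \<le> (1 - c * \<alpha>) * A z + c * \<alpha> * (K / c * (C + norm e))\<^sup>2"
      unfolding A_def by (rule euler_lyapunov_square[OF V \<alpha>])
    also have "\<dots> \<le> (1 - c * \<alpha>) * A z + c * \<alpha> * b (q z)"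
      unfolding b_def using e cs pos by (intro add_left_mono mult_left_mono power_mono) auto
    finally show ?thesis .
  qed
  have bm: "b \<in> borel_measurable borel" unfolding b_def by measurable
  have bi: "integrable \<mu> b"
  proof -
    define t where "t = L * \<alpha> / sqrt 2"
    have "L * (\<alpha> / sqrt 2 * norm x) = t * norm x" for x :: "real^'d" by (simp add: t_def)
    then have "b x = (K / c)\<^sup>2 * (C + t * norm x)\<^sup>2" for x by (simp only: b_def power_mult_distrib)
    then have "b = (\<lambda>x. (K / c)\<^sup>2 * (C\<^sup>2 + 2 * C * t * norm x + t\<^sup>2 * (norm x)\<^sup>2))"
      by (auto simp: power2_sum power_mult_distrib)
    then show ?thesis using int sq by simp
  qed
  have push: "integrable \<nu> (\<lambda>z. h (q z))" "(\<integral>z. h (q z) \<partial>\<nu>) = (\<integral>x. h x \<partial>\<mu>)"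
    if "h \<in> borel_measurable borel" "integrable \<mu> h" for h :: "real^'d \<Rightarrow> real"
    using that integrable_distr_eq[OF meas(1) that(1)] integral_distr[OF meas(1) that(1)] by (simp_all add: qlaw)
  have A0: "0 \<le> A z" for z by (simp add: A_def)
  \<comment> \<open>Here r = 1 - c \<alpha>; the factor c \<alpha> in front of b cancels against 1 -
    r, so no negative power of \<alpha> enters the bound.\<close>
  have Ai: "integrable \<nu> A" and Ale: "(\<integral>z. A z \<partial>\<nu>) \<le> (\<integral>z. c * \<alpha> * b (q z) \<partial>\<nu>) / (1 - (1 - c * \<alpha>))"
    by (rule \<nu>.stationary_drift_bound[OF meas(2,3) law A0 _ _ drift];
        use cs push(1)[OF bm bi] in \<open>auto simp: b_def\<close>)+
  have Ale': "(\<integral>z. A z \<partial>\<nu>) \<le> (\<integral>x. b x \<partial>\<mu>)" using Ale pos(1) \<alpha> push(2)[OF bm bi] by simp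
  have sqm: "(\<lambda>x::real^'d. (norm x)\<^sup>2) \<in> borel_measurable borel" by measurable
  have le: "(norm (fst z - z0))\<^sup>2 \<le> 2 * A z + \<alpha>\<^sup>2 * (norm (q z))\<^sup>2" for z
  proof -
    have "norm (fst z - z0) \<le> norm (Y z - z0) + norm ((\<alpha> / sqrt 2) *\<^sub>R q z)"
      using norm_triangle_ineq[of "Y z - z0" "(\<alpha> / sqrt 2) *\<^sub>R q z"] by (simp add: Y_def algebra_simps)
    also have "\<dots> \<le> V (Y z - z0) + \<alpha> / sqrt 2 * norm (q z)" using Vn \<alpha> by (intro add_mono) auto
    finally have "(norm (fst z - z0))\<^sup>2 \<le> 2 * (V (Y z - z0))\<^sup>2 + 2 * (\<alpha> / sqrt 2 * norm (q z))\<^sup>2"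
      by (intro order.trans[OF power_mono square_sum_le]) auto
    then show ?thesis by (simp add: A_def power_mult_distrib power_divide)
  qed
  have hi: "integrable \<nu> (\<lambda>z. 2 * A z + \<alpha>\<^sup>2 * (norm (q z))\<^sup>2)" using Ai push(1)[OF sqm sq] by simp
  show i: "integrable \<nu> (\<lambda>z. (norm (fst z - z0))\<^sup>2)"
  proof (rule integrable_dominated_square[OF hi _ le])
    show "(\<lambda>z. norm (fst z - z0)) \<in> borel_measurable \<nu>"
      unfolding measurable_cong_sets[OF \<nu>(2) refl]
      by (intro borel_measurable_continuous_onI continuous_intros)
  qed
  have "(\<integral>z. (norm (fst z - z0))\<^sup>2 \<partial>\<nu>) \<le> (\<integral>z. 2 * A z + \<alpha>\<^sup>2 * (norm (q z))\<^sup>2 \<partial>\<nu>)"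
    by (rule integral_mono[OF i hi le])
  also have "\<dots> = 2 * (\<integral>z. A z \<partial>\<nu>) + \<alpha>\<^sup>2 * (\<integral>x. (norm x)\<^sup>2 \<partial>\<mu>)"
    using Ai push[OF sqm sq] by simp
  finally show "(\<integral>z. (norm (fst z - z0))\<^sup>2 \<partial>\<nu>)
      \<le> 2 * (\<integral>x. (K / c * (C + L * (\<alpha> / sqrt 2 * norm x)))\<^sup>2 \<partial>\<mu>) + \<alpha>\<^sup>2 * (\<integral>x. (norm x)\<^sup>2 \<partial>\<mu>)"
    using Ale' by (simp add: b_def)
qed

end

section \<open>Second moments of the averages in the two cases\<close>

lemma (in prob_space) theta_measurable:
  fixes fbar :: "real^'d \<Rightarrow> real^'d"
  assumes f: "continuous_on UNIV fbar" and \<theta>\<^sub>0: "\<theta>\<^sub>0 \<in> borel_measurable M"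
    and F: "\<And>n. (\<lambda>\<omega>. F (\<phi> \<omega> (Suc n))) \<in> borel_measurable M"
  shows "(\<lambda>\<omega>. theta (\<lambda>\<theta> x. fbar \<theta> + F x) \<alpha> (\<theta>\<^sub>0 \<omega>) (\<phi> \<omega>) n) \<in> borel_measurable M"
proof (induction n)
  case 0
  show ?case using \<theta>\<^sub>0 by simp
next
  case (Suc n)
  have "fbar \<in> borel_measurable borel" by (rule borel_measurable_continuous_onI[OF f])
  note [measurable] = Suc F this
  show ?case by simp
qed

lemma chain_iid: "chain iid_step x w (Suc n) = w (Suc n)"
  by (simp add: iid_step_def)

lemma snd_chain_zigzag: "snd (chain zigzag_step x w n) = (if n = 0 then snd x else w n)"
  by (cases n) (auto simp: zigzag_step_def)

lemma zigzag_F_chain: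
  "zigzag_F (chain zigzag_step x w (Suc n))
    = (1 / sqrt 2) *\<^sub>R (snd (chain zigzag_step x w (Suc n)) - snd (chain zigzag_step x w n))"
  by (simp add: zigzag_F_def zigzag_step_def)

lemma (in prob_space) iid_beta_bound:
  fixes fbar :: "real^'d \<Rightarrow> real^'d"
  assumes V: "euler_lyapunov fbar V c K a C" and cont: "continuous_on UNIV fbar" and \<alpha>: "\<alpha> \<in> {0<..a}"
    and z: "z \<in> borel_measurable M" "integrable M (\<lambda>\<omega>. (norm (z \<omega>))\<^sup>2)"
    and W: "indep_vars (\<lambda>_. borel) W UNIV" "\<And>n. integrable M (W n)" "\<And>n. (\<integral>\<omega>. W n \<omega> \<partial>M) = 0"
    and W2: "\<And>n. integrable M (\<lambda>\<omega>. (norm (W n \<omega>))\<^sup>2)" "\<And>n. (\<integral>\<omega>. (norm (W n \<omega>))\<^sup>2 \<partial>M) = \<sigma>"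
  shows "(\<forall>N. integrable M (\<lambda>\<omega>. (norm (beta iid_step iid_F fbar \<alpha> (z \<omega>) (\<lambda>n. W n \<omega>) N))\<^sup>2)) \<and>
    (\<lambda>N. \<integral>\<omega>. (norm (beta iid_step iid_F fbar \<alpha> (z \<omega>) (\<lambda>n. W n \<omega>) N))\<^sup>2 \<partial>M) \<in> O(\<lambda>N. 1 / real N)"
proof -
  define \<phi> where "\<phi> \<omega> = chain iid_step (snd (z \<omega>)) (\<lambda>n. W n \<omega>)" for \<omega>
  define \<theta> where "\<theta> n \<omega> = theta (\<lambda>\<theta> x. fbar \<theta> + iid_F x) \<alpha> (fst (z \<omega>)) (\<phi> \<omega>) n" for n \<omega>
  have Wm: "W n \<in> borel_measurable M" for n using W(2) by auto
  have F: "iid_F (\<phi> \<omega> (Suc n)) = W (Suc n) \<omega>" for n \<omega> by (simp only: \<phi>_def chain_iid iid_F_def)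
  have fz: "(\<lambda>\<omega>. fst (z \<omega>)) \<in> borel_measurable M"
    by (rule measurable_compose[OF z(1) fst_snd_borel_measurable(1)])
  have \<theta>m: "\<theta> n \<in> borel_measurable M" for n
    unfolding \<theta>_def[abs_def] by (rule theta_measurable[OF cont fz]) (simp add: F Wm)
  have "norm (fst (z \<omega>)) \<le> norm (z \<omega>)" for \<omega>
    using norm_fst_le[of "fst (z \<omega>)" "snd (z \<omega>)"] by simp
  then have \<theta>0: "integrable M (\<lambda>\<omega>. (norm (\<theta> 0 \<omega>))\<^sup>2)"
    by (intro integrable_dominated_square[OF z(2)])
       (use fz in \<open>auto simp: \<theta>_def intro!: power_mono\<close>)
  have rec: "\<theta> (Suc n) \<omega> = \<theta> n \<omega> + \<alpha> *\<^sub>R (fbar (\<theta> n \<omega>) + W (Suc n) \<omega>)" for n \<omega>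
    by (simp add: \<theta>_def F)
  obtain D where D: "\<And>n. integrable M (\<lambda>\<omega>. (norm (\<theta> n \<omega>))\<^sup>2) \<and> (\<integral>\<omega>. (norm (\<theta> n \<omega>))\<^sup>2 \<partial>M) \<le> D"
    using euler_second_moment_bounded[OF V \<alpha> \<theta>m Wm \<theta>0 W2(1) _ rec] W2(2) by (metis order_refl)
  define S where "S N \<omega> = (\<Sum>n\<in>{1..N}. W n \<omega>)" for N \<omega>
  have S: "integrable M (\<lambda>\<omega>. (norm (S N \<omega>))\<^sup>2)" "(\<integral>\<omega>. (norm (S N \<omega>))\<^sup>2 \<partial>M) = real N * \<sigma>" for N
    using indep_centered_sum_second_moment[OF W W2(1), of N] by (auto simp: S_def W2(2))
  have Sm: "S N \<in> borel_measurable M" for N unfolding S_def using Wm by auto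
  have b: "beta iid_step iid_F fbar \<alpha> (z \<omega>) (\<lambda>n. W n \<omega>) N
      = (1 / real N) *\<^sub>R ((1 / \<alpha>) *\<^sub>R (\<theta> N \<omega> - \<theta> 0 \<omega>) - S N \<omega>)" for N \<omega>
  proof -
    have "(\<Sum>n<N. iid_F (\<phi> \<omega> (Suc n))) = S N \<omega>"
      unfolding F S_def by (simp add: sum.atLeast1_atMost_eq)
    then show ?thesis
      using sum_mean_field_theta[of \<alpha> fbar iid_F "fst (z \<omega>)" "\<phi> \<omega>" N] \<alpha>
      by (simp add: beta_def \<theta>_def \<phi>_def)
  qed
  note main = beta_second_moment[where \<theta> = \<theta> and \<alpha> = \<alpha> and S = "S N" and N = N for N, OF \<theta>m \<theta>m Sm D S(1) b]
  have "0 \<le> (\<integral>\<omega>. (norm (W 0 \<omega>))\<^sup>2 \<partial>M)" by simp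
  then have \<sigma>0: "0 \<le> \<sigma>" by (simp only: W2(2))
  have D0: "0 \<le> D" using order.trans[OF _ conjunct2[OF D[of 0]]] by simp
  have "(\<lambda>N. \<integral>\<omega>. (norm (beta iid_step iid_F fbar \<alpha> (z \<omega>) (\<lambda>n. W n \<omega>) N))\<^sup>2 \<partial>M) \<in> O(\<lambda>N. 1 / real N)"
  proof (rule bigoI[where c = "8 * D / \<alpha>\<^sup>2 + 2 * \<sigma>"], rule eventually_mono[OF eventually_gt_at_top[of 0]])
    fix N :: nat assume N: "0 < N"
    have "(\<integral>\<omega>. (norm (beta iid_step iid_F fbar \<alpha> (z \<omega>) (\<lambda>n. W n \<omega>) N))\<^sup>2 \<partial>M)
        \<le> 1 / (real N)\<^sup>2 * (8 * D / \<alpha>\<^sup>2 + 2 * (real N * \<sigma>))" using main(2)[of N] by (simp only: S)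
    \<comment> \<open>For N \<ge> 1 the boundary term, bounded uniformly in N, is at most N times
      itself and joins the noise term of order N.\<close>
    also have "\<dots> \<le> 1 / (real N)\<^sup>2 * (real N * (8 * D / \<alpha>\<^sup>2) + 2 * (real N * \<sigma>))"
    proof -
      have "1 * (8 * D / \<alpha>\<^sup>2) \<le> real N * (8 * D / \<alpha>\<^sup>2)" using N D0 by (intro mult_right_mono) auto
      then show ?thesis by (intro mult_left_mono) auto
    qed
    also have "\<dots> = (8 * D / \<alpha>\<^sup>2 + 2 * \<sigma>) * (1 / real N)" using N by (simp add: field_simps power2_eq_square)
    finally show "norm (\<integral>\<omega>. (norm (beta iid_step iid_F fbar \<alpha> (z \<omega>) (\<lambda>n. W n \<omega>) N))\<^sup>2 \<partial>M)
        \<le> (8 * D / \<alpha>\<^sup>2 + 2 * \<sigma>) * norm (1 / real N)" by simp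
  qed
  then show ?thesis using main(1) by blast
qed

lemma (in prob_space) zigzag_beta_bound:
  fixes fbar :: "real^'d \<Rightarrow> real^'d"
  assumes V: "euler_lyapunov fbar V c K a C" and lip: "L-lipschitz_on UNIV fbar" and \<alpha>: "\<alpha> \<in> {0<..a}"
    and z: "z \<in> borel_measurable M" "integrable M (\<lambda>\<omega>. (norm (z \<omega>))\<^sup>2)"
    and Wm: "\<And>n. W n \<in> borel_measurable M"
    and W2: "\<And>n. integrable M (\<lambda>\<omega>. (norm (W n \<omega>))\<^sup>2)" "\<And>n. (\<integral>\<omega>. (norm (W n \<omega>))\<^sup>2 \<partial>M) = \<sigma>"
  shows "(\<forall>N. integrable M (\<lambda>\<omega>. (norm (beta zigzag_step zigzag_F fbar \<alpha> (z \<omega>) (\<lambda>n. W n \<omega>) N))\<^sup>2)) \<and>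
    (\<lambda>N. \<integral>\<omega>. (norm (beta zigzag_step zigzag_F fbar \<alpha> (z \<omega>) (\<lambda>n. W n \<omega>) N))\<^sup>2 \<partial>M) \<in> O(\<lambda>N. 1 / (real N)\<^sup>2)"
proof -
  define \<phi> where "\<phi> \<omega> = chain zigzag_step (snd (z \<omega>)) (\<lambda>n. W n \<omega>)" for \<omega>
  define q where "q n \<omega> = snd (\<phi> \<omega> n)" for n \<omega>
  define \<theta> where "\<theta> n \<omega> = theta (\<lambda>\<theta> x. fbar \<theta> + zigzag_F x) \<alpha> (fst (z \<omega>)) (\<phi> \<omega>) n" for n \<omega>
  define y where "y n \<omega> = \<theta> n \<omega> - (\<alpha> / sqrt 2) *\<^sub>R q n \<omega>" for n \<omega>
  define e where "e n \<omega> = fbar (\<theta> n \<omega>) - fbar (y n \<omega>)" for n \<omega>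
  have L0: "0 \<le> L" by (rule lipschitz_on_nonneg[OF lip])
  have cont: "continuous_on UNIV fbar" by (rule lipschitz_on_continuous_on[OF lip])
  have F: "zigzag_F (\<phi> \<omega> (Suc n)) = (1 / sqrt 2) *\<^sub>R (q (Suc n) \<omega> - q n \<omega>)" for n \<omega>
    by (simp only: \<phi>_def q_def zigzag_F_chain)
  \<comment> \<open>At time 0 the stored noise comes from the initial condition and not from
    \<open>W 0\<close>, so its second moment is accounted for separately in Q.\<close>
  have q: "q n = (if n = 0 then (\<lambda>\<omega>. snd (snd (z \<omega>))) else W n)" for n
    by (auto simp: q_def \<phi>_def snd_chain_zigzag simp del: chain.simps)
  have fz: "(\<lambda>\<omega>. fst (z \<omega>)) \<in> borel_measurable M" "(\<lambda>\<omega>. snd (snd (z \<omega>))) \<in> borel_measurable M"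
    by (rule measurable_compose[OF z(1)], intro borel_measurable_continuous_onI continuous_intros)+
  have qm: "q n \<in> borel_measurable M" for n using fz Wm by (simp add: q)
  have fm: "fbar \<in> borel_measurable borel" by (rule borel_measurable_continuous_onI[OF cont])
  have \<theta>m: "\<theta> n \<in> borel_measurable M" for n
    unfolding \<theta>_def[abs_def] by (rule theta_measurable[OF cont fz(1)]) (use qm in \<open>simp add: F\<close>)
  have ym: "y n \<in> borel_measurable M" for n unfolding y_def using \<theta>m qm by simp
  have em: "e n \<in> borel_measurable M" for n
    unfolding e_def
    using measurable_compose[OF \<theta>m fm] measurable_compose[OF ym fm] by (intro borel_measurable_diff)
  have nz: "norm (fst (z \<omega>)) \<le> norm (z \<omega>)" "norm (snd (snd (z \<omega>))) \<le> norm (z \<omega>)" for \<omega>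
    using norm_fst_le[of "fst (z \<omega>)" "snd (z \<omega>)"] norm_snd_le[of "snd (z \<omega>)" "fst (z \<omega>)"]
      norm_snd_le[of "snd (snd (z \<omega>))" "fst (snd (z \<omega>))"] by simp_all
  have q2: "integrable M (\<lambda>\<omega>. (norm (q n \<omega>))\<^sup>2)" for n
  proof (cases "n = 0")
    case True
    show ?thesis
      by (rule integrable_dominated_square[OF z(2)])
         (use True qm[of n] nz in \<open>auto simp: q intro!: power_mono\<close>)
  qed (use W2 in \<open>simp add: q\<close>)
  define Q where "Q = (\<integral>\<omega>. (norm (q 0 \<omega>))\<^sup>2 \<partial>M) + \<sigma>"
  have "0 \<le> (\<integral>\<omega>. (norm (W 0 \<omega>))\<^sup>2 \<partial>M)" by simp
  then have \<sigma>0: "0 \<le> \<sigma>" by (simp only: W2(2))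
  have Q: "(\<integral>\<omega>. (norm (q n \<omega>))\<^sup>2 \<partial>M) \<le> Q" for n
    using \<sigma>0 W2(2)[of n] by (cases "n = 0") (auto simp: q Q_def)
  have ele: "(norm (e n \<omega>))\<^sup>2 \<le> (L * \<alpha> / sqrt 2)\<^sup>2 * (norm (q n \<omega>))\<^sup>2" for n \<omega>
  proof -
    have "norm (e n \<omega>) \<le> L * norm (\<theta> n \<omega> - y n \<omega>)"
      using lipschitz_onD[OF lip, of "\<theta> n \<omega>" "y n \<omega>"] by (simp add: e_def dist_norm)
    also have "\<dots> = L * \<alpha> / sqrt 2 * norm (q n \<omega>)" using \<alpha> by (simp add: y_def)
    finally show ?thesis unfolding power_mult_distrib[symmetric] by (intro power_mono) auto
  qed
  have e2: "integrable M (\<lambda>\<omega>. (norm (e n \<omega>))\<^sup>2)" for n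
    by (rule integrable_dominated_square[OF _ _ ele]) (use em q2 in auto)
  have eB: "(\<integral>\<omega>. (norm (e n \<omega>))\<^sup>2 \<partial>M) \<le> (L * \<alpha> / sqrt 2)\<^sup>2 * Q" for n
  proof -
    have "(\<integral>\<omega>. (norm (e n \<omega>))\<^sup>2 \<partial>M) \<le> (\<integral>\<omega>. (L * \<alpha> / sqrt 2)\<^sup>2 * (norm (q n \<omega>))\<^sup>2 \<partial>M)"
      by (intro integral_mono e2 ele) (use q2 in auto)
    also have "\<dots> = (L * \<alpha> / sqrt 2)\<^sup>2 * (\<integral>\<omega>. (norm (q n \<omega>))\<^sup>2 \<partial>M)" by simp
    also have "\<dots> \<le> (L * \<alpha> / sqrt 2)\<^sup>2 * Q" by (intro mult_left_mono Q) auto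
    finally show ?thesis .
  qed
  have diff2: "(norm (u - v))\<^sup>2 \<le> 2 * (norm u)\<^sup>2 + 2 * (norm v)\<^sup>2" for u v :: "real^'d"
    by (intro order.trans[OF power_mono square_sum_le] norm_triangle_ineq4) auto
  have y0: "integrable M (\<lambda>\<omega>. (norm (y 0 \<omega>))\<^sup>2)"
  proof (rule integrable_dominated_square)
    have "integrable M (\<lambda>\<omega>. (norm (fst (z \<omega>)))\<^sup>2)"
      by (rule integrable_dominated_square[OF z(2)]) (use fz nz in \<open>auto intro!: power_mono\<close>)
    then show "integrable M (\<lambda>\<omega>. 2 * (norm (fst (z \<omega>)))\<^sup>2 + 2 * (norm ((\<alpha> / sqrt 2) *\<^sub>R q 0 \<omega>))\<^sup>2)"
      using q2[of 0] by (simp add: power_mult_distrib power_divide)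
    show "(norm (y 0 \<omega>))\<^sup>2 \<le> 2 * (norm (fst (z \<omega>)))\<^sup>2 + 2 * (norm ((\<alpha> / sqrt 2) *\<^sub>R q 0 \<omega>))\<^sup>2" for \<omega>
      using diff2[of "fst (z \<omega>)" "(\<alpha> / sqrt 2) *\<^sub>R q 0 \<omega>"] by (simp add: y_def \<theta>_def)
  qed (use ym in auto)
  have rec: "y (Suc n) \<omega> = y n \<omega> + \<alpha> *\<^sub>R (fbar (y n \<omega>) + e n \<omega>)" for n \<omega>
  proof -
    have "\<theta> (Suc n) \<omega> = \<theta> n \<omega> + \<alpha> *\<^sub>R (fbar (\<theta> n \<omega>) + (1 / sqrt 2) *\<^sub>R (q (Suc n) \<omega> - q n \<omega>))"
      by (simp add: \<theta>_def F)
    then show ?thesis by (simp add: y_def e_def algebra_simps)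
  qed
  obtain D where D: "\<And>n. integrable M (\<lambda>\<omega>. (norm (y n \<omega>))\<^sup>2) \<and> (\<integral>\<omega>. (norm (y n \<omega>))\<^sup>2 \<partial>M) \<le> D"
    using euler_second_moment_bounded[OF V \<alpha> ym em y0 e2 eB rec] by blast
  have \<theta>le: "(norm (\<theta> n \<omega>))\<^sup>2 \<le> 2 * (norm (y n \<omega>))\<^sup>2 + \<alpha>\<^sup>2 * (norm (q n \<omega>))\<^sup>2" for n \<omega>
    using diff2[of "y n \<omega>" "- ((\<alpha> / sqrt 2) *\<^sub>R q n \<omega>)"] by (simp add: y_def power_mult_distrib power_divide)
  have \<theta>2: "integrable M (\<lambda>\<omega>. (norm (\<theta> n \<omega>))\<^sup>2) \<and> (\<integral>\<omega>. (norm (\<theta> n \<omega>))\<^sup>2 \<partial>M) \<le> 2 * D + \<alpha>\<^sup>2 * Q" for n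
  proof
    have hi: "integrable M (\<lambda>\<omega>. 2 * (norm (y n \<omega>))\<^sup>2 + \<alpha>\<^sup>2 * (norm (q n \<omega>))\<^sup>2)" using D[of n] q2[of n] by simp
    show i: "integrable M (\<lambda>\<omega>. (norm (\<theta> n \<omega>))\<^sup>2)"
      by (rule integrable_dominated_square[OF hi _ \<theta>le]) (use \<theta>m in auto)
    have "(\<integral>\<omega>. (norm (\<theta> n \<omega>))\<^sup>2 \<partial>M) \<le> (\<integral>\<omega>. 2 * (norm (y n \<omega>))\<^sup>2 + \<alpha>\<^sup>2 * (norm (q n \<omega>))\<^sup>2 \<partial>M)"
      by (rule integral_mono[OF i hi \<theta>le])
    also have "\<dots> = 2 * (\<integral>\<omega>. (norm (y n \<omega>))\<^sup>2 \<partial>M) + \<alpha>\<^sup>2 * (\<integral>\<omega>. (norm (q n \<omega>))\<^sup>2 \<partial>M)"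
      using D[of n] q2[of n] by simp
    also have "\<dots> \<le> 2 * D + \<alpha>\<^sup>2 * Q" using D[of n] Q[of n] by (intro add_mono mult_left_mono) auto
    finally show "(\<integral>\<omega>. (norm (\<theta> n \<omega>))\<^sup>2 \<partial>M) \<le> 2 * D + \<alpha>\<^sup>2 * Q" .
  qed
  define S where "S N \<omega> = (1 / sqrt 2) *\<^sub>R (q N \<omega> - q 0 \<omega>)" for N \<omega>
  have Sm: "S N \<in> borel_measurable M" for N unfolding S_def using qm by simp
  have Sle: "(norm (S N \<omega>))\<^sup>2 \<le> (norm (q N \<omega>))\<^sup>2 + (norm (q 0 \<omega>))\<^sup>2" for N \<omega>
    using diff2[of "q N \<omega>" "q 0 \<omega>"] by (simp add: S_def power_mult_distrib power_divide)
  have S: "integrable M (\<lambda>\<omega>. (norm (S N \<omega>))\<^sup>2)" for N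
    by (rule integrable_dominated_square[OF _ _ Sle]) (use Sm q2 in auto)
  have SQ: "(\<integral>\<omega>. (norm (S N \<omega>))\<^sup>2 \<partial>M) \<le> 2 * Q" for N
  proof -
    have "(\<integral>\<omega>. (norm (S N \<omega>))\<^sup>2 \<partial>M) \<le> (\<integral>\<omega>. (norm (q N \<omega>))\<^sup>2 + (norm (q 0 \<omega>))\<^sup>2 \<partial>M)"
      by (intro integral_mono S Sle) (use q2 in auto)
    then show ?thesis using Q[of N] Q[of 0] q2 by simp
  qed
  have b: "beta zigzag_step zigzag_F fbar \<alpha> (z \<omega>) (\<lambda>n. W n \<omega>) N
      = (1 / real N) *\<^sub>R ((1 / \<alpha>) *\<^sub>R (\<theta> N \<omega> - \<theta> 0 \<omega>) - S N \<omega>)" for N \<omega>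
  proof -
    \<comment> \<open>Telescoping leaves a boundary term with second moment bounded in N, which is
      the source of the order 1 / N^2.\<close>
    have "(\<Sum>n<N. zigzag_F (\<phi> \<omega> (Suc n))) = S N \<omega>"
      unfolding F S_def scaleR_sum_right[symmetric] sum_lessThan_telescope[of "\<lambda>n. q n \<omega>"] by simp
    then show ?thesis
      using sum_mean_field_theta[of \<alpha> fbar zigzag_F "fst (z \<omega>)" "\<phi> \<omega>" N] \<alpha>
      by (simp add: beta_def \<theta>_def \<phi>_def)
  qed
  note main = beta_second_moment[where \<theta> = \<theta> and \<alpha> = \<alpha> and S = "S N" and N = N for N, OF \<theta>m \<theta>m Sm \<theta>2 S b]
  have "(\<lambda>N. \<integral>\<omega>. (norm (beta zigzag_step zigzag_F fbar \<alpha> (z \<omega>) (\<lambda>n. W n \<omega>) N))\<^sup>2 \<partial>M) \<in> O(\<lambda>N. 1 / (real N)\<^sup>2)"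
  \<comment> \<open>The bound holds for all N: at N = 0 the convention 1 / 0 = 0 makes both sides
    0.\<close>
  proof (rule bigoI[where c = "8 * (2 * D + \<alpha>\<^sup>2 * Q) / \<alpha>\<^sup>2 + 4 * Q"], rule always_eventually, rule allI)
    fix N :: nat
    have "(\<integral>\<omega>. (norm (beta zigzag_step zigzag_F fbar \<alpha> (z \<omega>) (\<lambda>n. W n \<omega>) N))\<^sup>2 \<partial>M)
        \<le> 1 / (real N)\<^sup>2 * (8 * (2 * D + \<alpha>\<^sup>2 * Q) / \<alpha>\<^sup>2 + 2 * (\<integral>\<omega>. (norm (S N \<omega>))\<^sup>2 \<partial>M))" by (rule main(2))
    also have "\<dots> \<le> 1 / (real N)\<^sup>2 * (8 * (2 * D + \<alpha>\<^sup>2 * Q) / \<alpha>\<^sup>2 + 4 * Q)"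
      using SQ[of N] by (intro mult_left_mono) auto
    finally show "norm (\<integral>\<omega>. (norm (beta zigzag_step zigzag_F fbar \<alpha> (z \<omega>) (\<lambda>n. W n \<omega>) N))\<^sup>2 \<partial>M)
        \<le> (8 * (2 * D + \<alpha>\<^sup>2 * Q) / \<alpha>\<^sup>2 + 4 * Q) * norm (1 / (real N)\<^sup>2)" by (simp add: mult.commute)
  qed
  then show ?thesis using main(1) by blast
qed

lemma exp_square_integrable_imp_square_integrable:
  fixes X :: "'w \<Rightarrow> 'b::{banach, second_countable_topology}"
  assumes X: "X \<in> borel_measurable M" and e: "0 < e" and int: "integrable M (\<lambda>\<omega>. exp (e * (norm (X \<omega>))\<^sup>2))"
  shows "integrable M (\<lambda>\<omega>. (norm (X \<omega>))\<^sup>2)"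
proof (rule integrable_dominated_square)
  show "integrable M (\<lambda>\<omega>. exp (e * (norm (X \<omega>))\<^sup>2) / e)" using int by simp
  show "(norm (X \<omega>))\<^sup>2 \<le> exp (e * (norm (X \<omega>))\<^sup>2) / e" for \<omega>
  proof -
    have "e * (norm (X \<omega>))\<^sup>2 \<le> exp (e * (norm (X \<omega>))\<^sup>2)"
      using exp_ge_add_one_self[of "e * (norm (X \<omega>))\<^sup>2"] by linarith
    then show ?thesis using e by (simp add: pos_le_divide_eq mult.commute)
  qed
qed (use X in simp)

lemma assumptions_B_euler_lyapunov:
  assumes "assumptions_B P \<pi> V W F fbar"
  obtains L Va c K a C where "L-lipschitz_on UNIV fbar" "euler_lyapunov fbar Va c K a C"
proof -
  obtain L h where L: "L-lipschitz_on UNIV fbar" and h: "field_at_infinity fbar h" "asymptotically_stable h 0"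
    using assms unfolding assumptions_B_def by blast
  show thesis using field_at_infinity_euler_lyapunov[OF L h] that[OF L] by blast
qed

theorem corollary3p1:
  fixes M :: "'w measure" and W :: "nat \<Rightarrow> 'w \<Rightarrow> real^'d" and \<epsilon>\<^sub>0 :: real
    and \<Gamma> :: "real^'d \<Rightarrow> real" and G :: "real^'d \<Rightarrow> real^'d^'d"
    and \<mu> :: "(real^'d) measure" and fbar :: "real^'d \<Rightarrow> real^'d"
  assumes "iid_noise M W"
    and "\<mu> = distr M borel (W 0)"
    and "\<forall>n. integrable M (W n) \<and> (\<integral>\<omega>. W n \<omega> \<partial>M) = 0"
    and "\<epsilon>\<^sub>0 > 0"
    and "\<forall>n. integrable M (\<lambda>\<omega>. exp (\<epsilon>\<^sub>0 * (norm (W n \<omega>))\<^sup>2))"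
    and "continuously_differentiable \<Gamma>"
    and "continuously_differentiable G"
    and "fbar = sgd_field \<Gamma> G"
  shows
    "(\<forall>\<pi> V Wd. assumptions_B (step_kernel iid_step \<mu>) \<pi> V Wd iid_F fbar \<longrightarrow>
        (\<exists>\<alpha>\<^sub>0>0. \<forall>\<alpha>\<in>{0<..\<alpha>\<^sub>0}. \<forall>z. initial_condition M W z \<longrightarrow>
           (\<forall>N. integrable M (\<lambda>\<omega>. (norm (beta iid_step iid_F fbar \<alpha> (z \<omega>) (\<lambda>n. W n \<omega>) N))\<^sup>2)) \<and>
           (\<lambda>N. \<integral>\<omega>. (norm (beta iid_step iid_F fbar \<alpha> (z \<omega>) (\<lambda>n. W n \<omega>) N))\<^sup>2 \<partial>M)
             \<in> O(\<lambda>N. 1 / real N)))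
     \<and>
     (\<forall>\<pi> V Wd. assumptions_B (step_kernel zigzag_step \<mu>) \<pi> V Wd zigzag_F fbar \<longrightarrow>
        (\<exists>\<alpha>\<^sub>0>0.
           (\<forall>\<alpha>\<in>{0<..\<alpha>\<^sub>0}. \<forall>z. initial_condition M W z \<longrightarrow>
              (\<forall>N. integrable M (\<lambda>\<omega>. (norm (beta zigzag_step zigzag_F fbar \<alpha> (z \<omega>) (\<lambda>n. W n \<omega>) N))\<^sup>2)) \<and>
              (\<lambda>N. \<integral>\<omega>. (norm (beta zigzag_step zigzag_F fbar \<alpha> (z \<omega>) (\<lambda>n. W n \<omega>) N))\<^sup>2 \<partial>M)
                \<in> O(\<lambda>N. 1 / (real N)\<^sup>2)) \<and>
           (\<forall>\<theta>s. assumptions_A (step_kernel zigzag_step \<mu>) \<pi> V Wd (\<lambda>\<theta> x. fbar \<theta> + zigzag_F x) \<theta>s \<longrightarrow>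
              autocov (step_kernel zigzag_step \<mu>) \<pi> zigzag_F summable_on UNIV \<and>
              (\<forall>Z. lyapunov_solution (jacobian fbar (at \<theta>s))
                     (Sigma_CLT (step_kernel zigzag_step \<mu>) \<pi> zigzag_F) Z \<longleftrightarrow> Z = 0) \<and>
              (\<forall>\<nu>. (\<forall>\<alpha>\<in>{0<..\<alpha>\<^sub>0}.
                      invariant_prob
                        (joint_kernel (step_kernel zigzag_step \<mu>) (\<lambda>\<theta> x. fbar \<theta> + zigzag_F x) \<alpha>) (\<nu> \<alpha>)) \<longrightarrow>
                 (\<forall>\<alpha>\<in>{0<..\<alpha>\<^sub>0}. integrable (\<nu> \<alpha>) (\<lambda>z. (norm (fst z - \<theta>s))\<^sup>2)) \<and>
                 (\<lambda>\<alpha>. \<integral>z. (norm (fst z - \<theta>s))\<^sup>2 \<partial>\<nu> \<alpha>) \<in> O[at_right 0](\<lambda>\<alpha>. \<alpha>\<^sup>2)))))"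
proof -
  interpret M: prob_space M using assms(1) by (simp add: iid_noise_def)
  have ind: "M.indep_vars (\<lambda>_. borel) W UNIV" and id: "distr M borel (W n) = \<mu>" for n
    using assms(1,2) by (auto simp: iid_noise_def)
  have W: "integrable M (W n)" "(\<integral>\<omega>. W n \<omega> \<partial>M) = 0" for n using assms(3) by auto
  have Wm: "W n \<in> borel_measurable M" for n using W(1)[of n] by auto
  have W2: "integrable M (\<lambda>\<omega>. (norm (W n \<omega>))\<^sup>2)" for n
    using exp_square_integrable_imp_square_integrable[OF Wm assms(4)] assms(5) by blast
  define \<sigma> where "\<sigma> = (\<integral>x. (norm x)\<^sup>2 \<partial>\<mu>)"
  have sqm: "(\<lambda>x::real^'d. (norm x)\<^sup>2) \<in> borel_measurable borel" by measurable
  have W\<sigma>: "(\<integral>\<omega>. (norm (W n \<omega>))\<^sup>2 \<partial>M) = \<sigma>" for n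
    unfolding \<sigma>_def id[of n, symmetric] by (rule integral_distr[OF Wm sqm, symmetric])
  have \<mu>: "prob_space \<mu>" "sets \<mu> = sets borel"
    unfolding assms(2) by (auto intro: M.prob_space_distr Wm)
  have \<mu>i: "integrable \<mu> (\<lambda>x. x)" "(\<integral>x. x \<partial>\<mu>) = 0" "integrable \<mu> (\<lambda>x. (norm x)\<^sup>2)"
    unfolding assms(2) using W W2[of 0] Wm[of 0] sqm
    by (simp_all add: integrable_distr_eq integral_distr)
  have \<sigma>0: "0 \<le> \<sigma>" by (simp add: \<sigma>_def)
  let ?P = "step_kernel zigzag_step \<mu>"
  show ?thesis
  proof (intro conjI allI impI)
    fix \<pi> V Wd assume B: "assumptions_B (step_kernel iid_step \<mu>) \<pi> V Wd iid_F fbar"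
    obtain L Va c K a C where L: "L-lipschitz_on UNIV fbar" and Va: "euler_lyapunov fbar Va c K a C"
      using assumptions_B_euler_lyapunov[OF B] .
    show "\<exists>\<alpha>\<^sub>0>0. \<forall>\<alpha>\<in>{0<..\<alpha>\<^sub>0}. \<forall>z. initial_condition M W z \<longrightarrow>
           (\<forall>N. integrable M (\<lambda>\<omega>. (norm (beta iid_step iid_F fbar \<alpha> (z \<omega>) (\<lambda>n. W n \<omega>) N))\<^sup>2)) \<and>
           (\<lambda>N. \<integral>\<omega>. (norm (beta iid_step iid_F fbar \<alpha> (z \<omega>) (\<lambda>n. W n \<omega>) N))\<^sup>2 \<partial>M) \<in> O(\<lambda>N. 1 / real N)"
    proof (intro exI[of _ a] conjI ballI allI impI)
      show "0 < a" using Va by (simp add: euler_lyapunov_def)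
    next
      fix \<alpha> and z :: "'w \<Rightarrow> (real^'d) \<times> (real^'d)"
      assume \<alpha>: "\<alpha> \<in> {0<..a}" and z: "initial_condition M W z"
      note main = M.iid_beta_bound[OF Va lipschitz_on_continuous_on[OF L] \<alpha> _ _ ind W W2 W\<sigma>, of z]
      show "integrable M (\<lambda>\<omega>. (norm (beta iid_step iid_F fbar \<alpha> (z \<omega>) (\<lambda>n. W n \<omega>) N))\<^sup>2)" for N
        using main z by (simp add: initial_condition_def)
      show "(\<lambda>N. \<integral>\<omega>. (norm (beta iid_step iid_F fbar \<alpha> (z \<omega>) (\<lambda>n. W n \<omega>) N))\<^sup>2 \<partial>M) \<in> O(\<lambda>N. 1 / real N)"
        using main z by (simp add: initial_condition_def)
    qed
  next
    fix \<pi> V Wd assume B: "assumptions_B ?P \<pi> V Wd zigzag_F fbar"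
    obtain L Va c K a C where L: "L-lipschitz_on UNIV fbar" and Va: "euler_lyapunov fbar Va c K a C"
      using assumptions_B_euler_lyapunov[OF B] .
    have L0: "0 \<le> L" by (rule lipschitz_on_nonneg[OF L])
    have ker: "markov_kernel ?P" and inv: "invariant_prob ?P \<pi>"
      using B by (auto simp: assumptions_B_def assumption_A2ii_def unique_invariant_prob_def)
    have \<pi>: "prob_space \<pi>" "sets \<pi> = sets borel" using inv by (auto simp: invariant_prob_def)
    have a0: "0 < a" using Va by (simp add: euler_lyapunov_def)
    \<comment> \<open>Exploration is centered under \<pi>, so (A5), which is stated for the mean
      field, becomes a statement about fbar.\<close>
    have mf: "mean_field \<pi> (\<lambda>\<theta> x. fbar \<theta> + zigzag_F x) = fbar"
    proof
      fix \<theta>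
      interpret \<pi>: prob_space \<pi> by (rule \<pi>(1))
      have "integrable \<pi> zigzag_F" "(\<integral>x. zigzag_F x \<partial>\<pi>) = 0"
        using zigzag_moments(1,2)[OF \<mu> \<mu>i \<pi>(2)] zigzag_invariant_laws[OF \<mu> \<mu>i inv] by blast+
      then show "mean_field \<pi> (\<lambda>\<theta> x. fbar \<theta> + zigzag_F x) \<theta> = fbar \<theta>"
        by (simp add: mean_field_def \<pi>.prob_space)
    qed
    show "\<exists>\<alpha>\<^sub>0>0.
           (\<forall>\<alpha>\<in>{0<..\<alpha>\<^sub>0}. \<forall>z. initial_condition M W z \<longrightarrow>
              (\<forall>N. integrable M (\<lambda>\<omega>. (norm (beta zigzag_step zigzag_F fbar \<alpha> (z \<omega>) (\<lambda>n. W n \<omega>) N))\<^sup>2)) \<and>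
              (\<lambda>N. \<integral>\<omega>. (norm (beta zigzag_step zigzag_F fbar \<alpha> (z \<omega>) (\<lambda>n. W n \<omega>) N))\<^sup>2 \<partial>M)
                \<in> O(\<lambda>N. 1 / (real N)\<^sup>2)) \<and>
           (\<forall>\<theta>s. assumptions_A ?P \<pi> V Wd (\<lambda>\<theta> x. fbar \<theta> + zigzag_F x) \<theta>s \<longrightarrow>
              autocov ?P \<pi> zigzag_F summable_on UNIV \<and>
              (\<forall>Z. lyapunov_solution (jacobian fbar (at \<theta>s)) (Sigma_CLT ?P \<pi> zigzag_F) Z \<longleftrightarrow> Z = 0) \<and>
              (\<forall>\<nu>. (\<forall>\<alpha>\<in>{0<..\<alpha>\<^sub>0}. invariant_prob (joint_kernel ?P (\<lambda>\<theta> x. fbar \<theta> + zigzag_F x) \<alpha>) (\<nu> \<alpha>)) \<longrightarrow>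
                 (\<forall>\<alpha>\<in>{0<..\<alpha>\<^sub>0}. integrable (\<nu> \<alpha>) (\<lambda>z. (norm (fst z - \<theta>s))\<^sup>2)) \<and>
                 (\<lambda>\<alpha>. \<integral>z. (norm (fst z - \<theta>s))\<^sup>2 \<partial>\<nu> \<alpha>) \<in> O[at_right 0](\<lambda>\<alpha>. \<alpha>\<^sup>2)))"
    proof (rule exI[of _ a], rule conjI[OF a0], rule conjI, intro ballI allI impI)
      fix \<alpha> and z :: "'w \<Rightarrow> (real^'d) \<times> ((real^'d) \<times> (real^'d))"
      assume \<alpha>: "\<alpha> \<in> {0<..a}" and z: "initial_condition M W z"
      then have z': "z \<in> borel_measurable M" "integrable M (\<lambda>\<omega>. (norm (z \<omega>))\<^sup>2)"
        by (auto simp: initial_condition_def)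
      show "(\<forall>N. integrable M (\<lambda>\<omega>. (norm (beta zigzag_step zigzag_F fbar \<alpha> (z \<omega>) (\<lambda>n. W n \<omega>) N))\<^sup>2)) \<and>
          (\<lambda>N. \<integral>\<omega>. (norm (beta zigzag_step zigzag_F fbar \<alpha> (z \<omega>) (\<lambda>n. W n \<omega>) N))\<^sup>2 \<partial>M) \<in> O(\<lambda>N. 1 / (real N)\<^sup>2)"
        by (rule M.zigzag_beta_bound[OF Va L \<alpha> z' Wm W2 W\<sigma>])
    next
      show "\<forall>\<theta>s. assumptions_A ?P \<pi> V Wd (\<lambda>\<theta> x. fbar \<theta> + zigzag_F x) \<theta>s \<longrightarrow>
              autocov ?P \<pi> zigzag_F summable_on UNIV \<and>
              (\<forall>Z. lyapunov_solution (jacobian fbar (at \<theta>s)) (Sigma_CLT ?P \<pi> zigzag_F) Z \<longleftrightarrow> Z = 0) \<and>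
              (\<forall>\<nu>. (\<forall>\<alpha>\<in>{0<..a}. invariant_prob (joint_kernel ?P (\<lambda>\<theta> x. fbar \<theta> + zigzag_F x) \<alpha>) (\<nu> \<alpha>)) \<longrightarrow>
                 (\<forall>\<alpha>\<in>{0<..a}. integrable (\<nu> \<alpha>) (\<lambda>z. (norm (fst z - \<theta>s))\<^sup>2)) \<and>
                 (\<lambda>\<alpha>. \<integral>z. (norm (fst z - \<theta>s))\<^sup>2 \<partial>\<nu> \<alpha>) \<in> O[at_right 0](\<lambda>\<alpha>. \<alpha>\<^sup>2))"
      proof (intro allI impI)
        fix \<theta>s assume "assumptions_A ?P \<pi> V Wd (\<lambda>\<theta> x. fbar \<theta> + zigzag_F x) \<theta>s"
        then have A5: "assumption_A5 fbar \<theta>s" unfolding assumptions_A_def mf by blast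
        define A where "A = jacobian fbar (at \<theta>s)"
        have gas: "globally_asymptotically_stable fbar \<theta>s" and hur: "hurwitz A"
          using A5 by (auto simp: assumption_A5_def A_def)
        have "fbar differentiable (at \<theta>s)"
          using A5 unfolding assumption_A5_def continuously_differentiable_def differentiable_def by blast
        then have der: "(fbar has_derivative (*v) A) (at \<theta>s)" by (simp add: jacobian_works A_def)
        obtain VA cA KA aA where VA: "euler_lyapunov ((*v) A) VA cA KA aA 0"
          using hurwitz_euler_lyapunov[OF hur] by blast
        obtain V' c' K' a' where V': "euler_lyapunov (\<lambda>x. fbar (x + \<theta>s)) V' c' K' a' 0"
          using globally_stable_euler_lyapunov[OF L gas Va VA der] by blast
        note ac = zigzag_autocov[OF \<mu> \<mu>i ker inv]
        have Z: "lyapunov_solution A (Sigma_CLT ?P \<pi> zigzag_F) Z \<longleftrightarrow> Z = 0" for Z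
        proof
          assume "lyapunov_solution A (Sigma_CLT ?P \<pi> zigzag_F) Z"
          then have t: "transpose Z = Z" and e: "0 = A ** Z + Z ** transpose A + 0"
            unfolding lyapunov_solution_def pos_semidef_def ac(2) by blast+
          from e[symmetric] have "A ** Z + Z ** transpose A = 0" by (simp only: add_0_right)
          then show "Z = 0" by (rule homogeneous_lyapunov_equation[OF hur t])
        next
          assume "Z = 0"
          then show "lyapunov_solution A (Sigma_CLT ?P \<pi> zigzag_F) Z"
            unfolding lyapunov_solution_def pos_semidef_def ac(2)
            by (auto simp: transpose_def vec_eq_iff matrix_matrix_mult_def matrix_vector_mult_def inner_vec_def)
        qed
        have \<nu>: "(\<forall>\<alpha>\<in>{0<..a}. integrable (\<nu> \<alpha>) (\<lambda>z. (norm (fst z - \<theta>s))\<^sup>2)) \<and>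
              (\<lambda>\<alpha>. \<integral>z. (norm (fst z - \<theta>s))\<^sup>2 \<partial>\<nu> \<alpha>) \<in> O[at_right 0](\<lambda>\<alpha>. \<alpha>\<^sup>2)"
          if \<nu>: "\<forall>\<alpha>\<in>{0<..a}. invariant_prob (joint_kernel ?P (\<lambda>\<theta> x. fbar \<theta> + zigzag_F x) \<alpha>) (\<nu> \<alpha>)" for \<nu>
        proof
          \<comment> \<open>For all steps up to a, the function of the field at infinity is used,
            recentred at \<theta>s; its offset does no harm to integrability.\<close>
          show "\<forall>\<alpha>\<in>{0<..a}. integrable (\<nu> \<alpha>) (\<lambda>z. (norm (fst z - \<theta>s))\<^sup>2)"
            using zigzag_stationary_second_moment(1)[OF \<mu> \<mu>i euler_lyapunov_shift[OF Va L] L] \<nu> by blast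
          \<comment> \<open>The drift bound contributes 2 (K' L / c')^2 \<alpha>^2 \<sigma> / 2, and
            the passage from Y back to \<theta> contributes \<alpha>^2 \<sigma>.\<close>
          define B where "B = (K' / c' * L)\<^sup>2 * \<sigma> + \<sigma>"
          have a': "0 < min a a'" using V' a0 by (auto simp: euler_lyapunov_def)
          show "(\<lambda>\<alpha>. \<integral>z. (norm (fst z - \<theta>s))\<^sup>2 \<partial>\<nu> \<alpha>) \<in> O[at_right 0](\<lambda>\<alpha>. \<alpha>\<^sup>2)"
          proof (rule bigoI[where c = B], rule eventually_at_rightI[OF _ a'])
            fix \<alpha> assume "\<alpha> \<in> {0<..<min a a'}"
            then have \<alpha>: "\<alpha> \<in> {0<..a}" "\<alpha> \<in> {0<..a'}" by auto
            have "(\<integral>z. (norm (fst z - \<theta>s))\<^sup>2 \<partial>\<nu> \<alpha>)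
                \<le> 2 * (\<integral>x. (K' / c' * (0 + L * (\<alpha> / sqrt 2 * norm x)))\<^sup>2 \<partial>\<mu>) + \<alpha>\<^sup>2 * \<sigma>"
              unfolding \<sigma>_def using \<alpha> \<nu>
              by (intro zigzag_stationary_second_moment(2)[OF \<mu> \<mu>i V' L]) auto
            also have "(\<lambda>x::real^'d. (K' / c' * (0 + L * (\<alpha> / sqrt 2 * norm x)))\<^sup>2)
                = (\<lambda>x. (K' / c' * L)\<^sup>2 * \<alpha>\<^sup>2 / 2 * (norm x)\<^sup>2)"
              by (simp add: power_mult_distrib power_divide mult.assoc)
            also have "2 * (\<integral>x. (K' / c' * L)\<^sup>2 * \<alpha>\<^sup>2 / 2 * (norm x)\<^sup>2 \<partial>\<mu>) + \<alpha>\<^sup>2 * \<sigma> = B * \<alpha>\<^sup>2"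
              unfolding integral_mult_right_zero \<sigma>_def[symmetric] by (simp add: B_def algebra_simps)
            finally show "norm (\<integral>z. (norm (fst z - \<theta>s))\<^sup>2 \<partial>\<nu> \<alpha>) \<le> B * norm (\<alpha>\<^sup>2)" by simp
          qed
        qed
        show "autocov ?P \<pi> zigzag_F summable_on UNIV \<and>
              (\<forall>Z. lyapunov_solution (jacobian fbar (at \<theta>s)) (Sigma_CLT ?P \<pi> zigzag_F) Z \<longleftrightarrow> Z = 0) \<and>
              (\<forall>\<nu>. (\<forall>\<alpha>\<in>{0<..a}. invariant_prob (joint_kernel ?P (\<lambda>\<theta> x. fbar \<theta> + zigzag_F x) \<alpha>) (\<nu> \<alpha>)) \<longrightarrow>
                 (\<forall>\<alpha>\<in>{0<..a}. integrable (\<nu> \<alpha>) (\<lambda>z. (norm (fst z - \<theta>s))\<^sup>2)) \<and>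
                 (\<lambda>\<alpha>. \<integral>z. (norm (fst z - \<theta>s))\<^sup>2 \<partial>\<nu> \<alpha>) \<in> O[at_right 0](\<lambda>\<alpha>. \<alpha>\<^sup>2))"
          using ac(1) Z[unfolded A_def] \<nu> by blast
      qed
    qed
  qed
qed

end
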